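(* Let $A$ be a finite dimensional $\mathbb{K}$-algebra such that there are only finitely many functorially finite torsion classes in $\mathrm{mod}(A)$. Then $\alpha$ yields a bijection $$\mathrm{tors}(A)\longrightarrow \mathrm{wide}(A)$$ from the class of all torsion classes in $\mathrm{mod}(A)$ to the class of all wide subcategories of $\mathrm{mod}(A)$. Moreover, all torsion classes and all wide subcategories in $\mathrm{mod}(A)$ are functorially finite.
   Context: $\mathbb{K}$ is an algebraically closed field, and $\mathrm{mod}(A)$ is the category of finitely generated left $A$-modules. All subcategories are full and replete. A subcategory $\mathcal{C}$ of $\mathrm{mod}(A)$ is functorially finite if for every $X\in\mathrm{mod}(A)$ there are $C_1,C_2\in\mathcal{C}$ and morphisms $g_1:X\to C_1$ and $g_2:C_2\to X$ such that $\mathrm{Hom}_A(g_1,\tilde C)$ and $\mathrm{Hom}_A(\tilde C,g_2)$ are surjective for all $\tilde C\in\mathcal{C}$. A subcategory is wide if it is exact abelian (i.e. contains $0$ and is closed under kernels and cokernels in $\mathrm{mod}(A)$) and closed under extensions. A torsion class is a (nonempty) subcategory of $\mathrm{mod}(A)$ closed under quotients and extensions. The map $\alpha$ sends a torsion class $\mathcal{T}$ to $$\alpha(\mathcal{T}) := \{X\in\mathcal{T} \mid \text{for every } Y\in\mathcal{T} \text{ and every } A\text{-linear map } g:Y\to X,\ \ker(g)\in\mathcal{T}\},$$ which is known to be a wide subcategory of $\mathrm{mod}(A)$. *)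

theory Defs
  imports "HOL-Algebra.Algebra"
begin

section \<open>Finite dimensional algebras and their modules\<close>

text \<open>The library's locale \<open>module\<close> requires a commutative ring and its locale \<open>algebra\<close> a
  commutative algebra. The locales below are the same without commutativity of \<open>A\<close>. As in the
  library, the fields \<open>mult\<close> and \<open>one\<close> of the record carrying a module are meaningless.\<close>

locale left_module = A?: ring A + M?: abelian_group M
  for A :: "('a, 'r) ring_scheme" (structure) and M :: "('a, 'm, 'x) module_scheme" (structure) +
  assumes smult_closed:
      "a \<in> carrier A \<Longrightarrow> x \<in> carrier M \<Longrightarrow> a \<odot>\<^bsub>M\<^esub> x \<in> carrier M"
    and smult_l_distr:
      "a \<in> carrier A \<Longrightarrow> b \<in> carrier A \<Longrightarrow> x \<in> carrier M \<Longrightarrow>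
        (a \<oplus> b) \<odot>\<^bsub>M\<^esub> x = a \<odot>\<^bsub>M\<^esub> x \<oplus>\<^bsub>M\<^esub> b \<odot>\<^bsub>M\<^esub> x"
    and smult_r_distr:
      "a \<in> carrier A \<Longrightarrow> x \<in> carrier M \<Longrightarrow> y \<in> carrier M \<Longrightarrow>
        a \<odot>\<^bsub>M\<^esub> (x \<oplus>\<^bsub>M\<^esub> y) = a \<odot>\<^bsub>M\<^esub> x \<oplus>\<^bsub>M\<^esub> a \<odot>\<^bsub>M\<^esub> y"
    and smult_assoc1:
      "a \<in> carrier A \<Longrightarrow> b \<in> carrier A \<Longrightarrow> x \<in> carrier M \<Longrightarrow>
        (a \<otimes> b) \<odot>\<^bsub>M\<^esub> x = a \<odot>\<^bsub>M\<^esub> (b \<odot>\<^bsub>M\<^esub> x)"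
    and smult_one:
      "x \<in> carrier M \<Longrightarrow> \<one> \<odot>\<^bsub>M\<^esub> x = x"

definition fin_gen :: "('a, 'r) ring_scheme \<Rightarrow> ('a, 'm, 'x) module_scheme \<Rightarrow> bool" where
  "fin_gen A M \<longleftrightarrow> (\<exists>S. finite S \<and> S \<subseteq> carrier M \<and>
     (\<forall>x\<in>carrier M. \<exists>c\<in>S \<rightarrow> carrier A. x = (\<Oplus>\<^bsub>M\<^esub>s\<in>S. c s \<odot>\<^bsub>M\<^esub> s)))"

locale fin_dim_algebra = K?: field K + module K A + A?: ring A
  for K :: "('k, 'r) ring_scheme" (structure) and A :: "('k, 'a, 'x) module_scheme" (structure) +
  assumes smult_mult_left:
      "k \<in> carrier K \<Longrightarrow> x \<in> carrier A \<Longrightarrow> y \<in> carrier A \<Longrightarrow>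
        (k \<odot>\<^bsub>A\<^esub> x) \<otimes>\<^bsub>A\<^esub> y = k \<odot>\<^bsub>A\<^esub> (x \<otimes>\<^bsub>A\<^esub> y)"
    and smult_mult_right:
      "k \<in> carrier K \<Longrightarrow> x \<in> carrier A \<Longrightarrow> y \<in> carrier A \<Longrightarrow>
        x \<otimes>\<^bsub>A\<^esub> (k \<odot>\<^bsub>A\<^esub> y) = k \<odot>\<^bsub>A\<^esub> (x \<otimes>\<^bsub>A\<^esub> y)"
    and finite_dimension: "fin_gen K A"

text \<open>Linear maps are extensional, so that \<open>Hom A M N\<close> is the actual set of linear maps.\<close>

definition Hom ::
  "('a, 'r) ring_scheme \<Rightarrow> ('a, 'm, 'x) module_scheme \<Rightarrow> ('a, 'n, 'y) module_scheme \<Rightarrow> ('m \<Rightarrow> 'n) set"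
  where "Hom A M N = {g \<in> carrier M \<rightarrow>\<^sub>E carrier N.
     (\<forall>x\<in>carrier M. \<forall>y\<in>carrier M. g (x \<oplus>\<^bsub>M\<^esub> y) = g x \<oplus>\<^bsub>N\<^esub> g y) \<and>
     (\<forall>a\<in>carrier A. \<forall>x\<in>carrier M. g (a \<odot>\<^bsub>M\<^esub> x) = a \<odot>\<^bsub>N\<^esub> g x)}"

definition module_iso ::
  "('a, 'r) ring_scheme \<Rightarrow> ('a, 'm, 'x) module_scheme \<Rightarrow> ('a, 'n, 'y) module_scheme \<Rightarrow> bool" where
  "module_iso A M N \<longleftrightarrow> (\<exists>g\<in>Hom A M N. bij_betw g (carrier M) (carrier N))"

text \<open>The objects of \<open>mod(A)\<close>. The carriers are arbitrary subsets of one fixed type, with arbitrary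
  operations; the lemma \<open>fg_module_iso_mod\<close> below shows that the type \<open>'a list\<close> is large enough for
  every finitely generated module, over whatever type, to have an isomorphic copy here.\<close>

definition mod_cat :: "('a, 'r) ring_scheme \<Rightarrow> ('a, 'a list) module set" where
  "mod_cat A = {M. left_module A M \<and> fin_gen A M}"


section \<open>Subcategories\<close>

text \<open>A full replete subcategory is given by its isomorphism-closed class of objects.\<close>

definition subcategory :: "('a, 'r) ring_scheme \<Rightarrow> ('a, 'a list) module set \<Rightarrow> bool" where
  "subcategory A C \<longleftrightarrow> C \<subseteq> mod_cat A \<and>
     (\<forall>M\<in>C. \<forall>N\<in>mod_cat A. module_iso A M N \<longrightarrow> N \<in> C)"

definition functorially_finite :: "('a, 'r) ring_scheme \<Rightarrow> ('a, 'a list) module set \<Rightarrow> bool" where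
  "functorially_finite A C \<longleftrightarrow> (\<forall>M\<in>mod_cat A. \<exists>C1\<in>C. \<exists>C2\<in>C. \<exists>g1\<in>Hom A M C1. \<exists>g2\<in>Hom A C2 M.
     \<forall>D\<in>C. (\<lambda>h. compose (carrier M) h g1) ` Hom A C1 D = Hom A M D \<and>
           (\<lambda>h. compose (carrier D) g2 h) ` Hom A D C2 = Hom A D M)"

definition ker_mod ::
  "('a, 'm) module \<Rightarrow> ('a, 'n) module \<Rightarrow> ('m \<Rightarrow> 'n) \<Rightarrow> ('a, 'm) module" where
  "ker_mod M N g = M\<lparr>carrier := a_kernel M N g\<rparr>"

text \<open>Up to isomorphism, the quotients of \<open>M\<close> are the targets of surjections from \<open>M\<close>.\<close>

definition closed_under_quotients :: "('a, 'r) ring_scheme \<Rightarrow> ('a, 'a list) module set \<Rightarrow> bool" where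
  "closed_under_quotients A C \<longleftrightarrow>
     (\<forall>M\<in>C. \<forall>N\<in>mod_cat A. \<forall>p\<in>Hom A M N. p ` carrier M = carrier N \<longrightarrow> N \<in> C)"

definition short_exact ::
  "('a, 'r) ring_scheme \<Rightarrow> ('a, 'a list) module \<Rightarrow> ('a, 'a list) module \<Rightarrow> ('a, 'a list) module \<Rightarrow>
   ('a list \<Rightarrow> 'a list) \<Rightarrow> ('a list \<Rightarrow> 'a list) \<Rightarrow> bool" where
  "short_exact A M N L f g \<longleftrightarrow> f \<in> Hom A M N \<and> g \<in> Hom A N L \<and>
     inj_on f (carrier M) \<and> f ` carrier M = a_kernel N L g \<and> g ` carrier N = carrier L"

definition closed_under_extensions :: "('a, 'r) ring_scheme \<Rightarrow> ('a, 'a list) module set \<Rightarrow> bool" where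
  "closed_under_extensions A C \<longleftrightarrow>
     (\<forall>M\<in>C. \<forall>L\<in>C. \<forall>N\<in>mod_cat A. \<forall>f g. short_exact A M N L f g \<longrightarrow> N \<in> C)"

definition contains_zero :: "('a, 'a list) module set \<Rightarrow> bool" where
  "contains_zero C \<longleftrightarrow> (\<exists>L\<in>C. carrier L = {\<zero>\<^bsub>L\<^esub>})"

definition closed_under_kernels :: "('a, 'r) ring_scheme \<Rightarrow> ('a, 'a list) module set \<Rightarrow> bool" where
  "closed_under_kernels A C \<longleftrightarrow> (\<forall>M\<in>C. \<forall>N\<in>C. \<forall>g\<in>Hom A M N. ker_mod M N g \<in> C)"

text \<open>A cokernel of \<open>g : M \<rightarrow> N\<close> is a module \<open>L\<close> with a surjection \<open>p : N \<rightarrow> L\<close> whose kernel is the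
  image of \<open>g\<close>. The literal quotient \<open>N / g(M)\<close> has a carrier of a different type.\<close>

definition closed_under_cokernels :: "('a, 'r) ring_scheme \<Rightarrow> ('a, 'a list) module set \<Rightarrow> bool" where
  "closed_under_cokernels A C \<longleftrightarrow> (\<forall>M\<in>C. \<forall>N\<in>C. \<forall>g\<in>Hom A M N. \<forall>L\<in>mod_cat A. \<forall>p\<in>Hom A N L.
     p ` carrier N = carrier L \<and> a_kernel N L p = g ` carrier M \<longrightarrow> L \<in> C)"

definition tors :: "('a, 'r) ring_scheme \<Rightarrow> ('a, 'a list) module set set" where
  "tors A = {T. subcategory A T \<and> T \<noteq> {} \<and>
     closed_under_quotients A T \<and> closed_under_extensions A T}"

definition wide :: "('a, 'r) ring_scheme \<Rightarrow> ('a, 'a list) module set set" where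
  "wide A = {W. subcategory A W \<and> contains_zero W \<and> closed_under_kernels A W \<and>
     closed_under_cokernels A W \<and> closed_under_extensions A W}"

definition alpha ::
  "('a, 'r) ring_scheme \<Rightarrow> ('a, 'a list) module set \<Rightarrow> ('a, 'a list) module set" where
  "alpha A T = {M \<in> T. \<forall>N\<in>T. \<forall>g\<in>Hom A N M. ker_mod N M g \<in> T}"


section \<open>The carrier type of \<open>mod_cat\<close> is large enough\<close>

lemma transport_module:
  fixes A :: "('a, 'r) ring_scheme" and M :: "('a, 'm, 'x) module_scheme" and e :: "'m \<Rightarrow> 'n"
  assumes M: "left_module A M" and fg: "fin_gen A M" and inj: "inj_on e (carrier M)"
  shows "\<exists>N :: ('a, 'n) module. left_module A N \<and> fin_gen A N \<and> module_iso A M N"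
proof -
  interpret left_module A M by fact
  define d where "d = inv_into (carrier M) e"
  define N :: "('a, 'n) module" where
    "N = \<lparr>carrier = e ` carrier M, monoid.mult = undefined, one = undefined, ring.zero = e \<zero>\<^bsub>M\<^esub>,
          ring.add = (\<lambda>x y. e (d x \<oplus>\<^bsub>M\<^esub> d y)), module.smult = (\<lambda>a x. e (a \<odot>\<^bsub>M\<^esub> d x))\<rparr>"
  have d: "d (e x) = x" if "x \<in> carrier M" for x
    using inj that by (simp add: d_def)
  have N_simps: "carrier N = e ` carrier M" "\<zero>\<^bsub>N\<^esub> = e \<zero>\<^bsub>M\<^esub>"
    "\<And>x y. x \<oplus>\<^bsub>N\<^esub> y = e (d x \<oplus>\<^bsub>M\<^esub> d y)" "\<And>a x. a \<odot>\<^bsub>N\<^esub> x = e (a \<odot>\<^bsub>M\<^esub> d x)"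
    by (simp_all add: N_def)
  have "abelian_group N"
  proof (rule abelian_groupI)
    fix x assume "x \<in> carrier N"
    then obtain y where y: "y \<in> carrier M" "x = e y" by (auto simp: N_simps)
    then have "e (\<ominus>\<^bsub>M\<^esub> y) \<in> carrier N" "e (\<ominus>\<^bsub>M\<^esub> y) \<oplus>\<^bsub>N\<^esub> x = \<zero>\<^bsub>N\<^esub>"
      by (auto simp: N_simps d M.l_neg)
    then show "\<exists>y\<in>carrier N. y \<oplus>\<^bsub>N\<^esub> x = \<zero>\<^bsub>N\<^esub>" by blast
  qed (auto simp: N_simps d M.a_ac)
  then have N: "left_module A N"
    by (intro left_module.intro left_module_axioms.intro A.ring_axioms)
       (auto simp: N_simps d smult_closed smult_l_distr smult_r_distr smult_assoc1 smult_one)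
  interpret N: left_module A N by fact
  have sum: "e (\<Oplus>\<^bsub>M\<^esub>s\<in>S. f s) = (\<Oplus>\<^bsub>N\<^esub>s\<in>S. e (f s))"
    if "finite S" "f \<in> S \<rightarrow> carrier M" for S :: "'m set" and f
    using that
  proof (induction S)
    case empty
    then show ?case by (simp add: N_simps(2))
  next
    case (insert s S)
    then have f: "f \<in> S \<rightarrow> carrier M" "f s \<in> carrier M" by auto
    then have "e \<circ> f \<in> S \<rightarrow> carrier N" "e (f s) \<in> carrier N" by (auto simp: N_simps)
    moreover from f have "finsum M f S \<in> carrier M" by simp
    moreover have "e (finsum M f S) = (\<Oplus>\<^bsub>N\<^esub>s\<in>S. e (f s))"
      using insert.IH f by simp
    ultimately show ?case
      using insert.hyps f
      by (subst N.finsum_insert) (auto simp: N_simps d simp flip: \<open>e (finsum M f S) = _\<close>)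
  qed
  from fg obtain S where S: "finite S" "S \<subseteq> carrier M"
    "\<And>x. x \<in> carrier M \<Longrightarrow> \<exists>c\<in>S \<rightarrow> carrier A. x = (\<Oplus>\<^bsub>M\<^esub>s\<in>S. c s \<odot>\<^bsub>M\<^esub> s)"
    by (auto simp: fin_gen_def)
  have "fin_gen A N"
    unfolding fin_gen_def
  proof (intro exI[of _ "e ` S"] conjI ballI)
    fix x assume "x \<in> carrier N"
    then obtain y where y: "y \<in> carrier M" "x = e y" by (auto simp: N_simps)
    obtain c where c: "c \<in> S \<rightarrow> carrier A" "y = (\<Oplus>\<^bsub>M\<^esub>s\<in>S. c s \<odot>\<^bsub>M\<^esub> s)"
      using S(3)[OF y(1)] by blast
    have inS: "inj_on e S" using inj S(2) by (rule inj_on_subset)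
    have cl: "c s \<odot>\<^bsub>M\<^esub> s \<in> carrier M" if "s \<in> S" for s
      using c(1) S(2) that by (auto intro!: smult_closed)
    have "x = (\<Oplus>\<^bsub>N\<^esub>s\<in>S. e (c s \<odot>\<^bsub>M\<^esub> s))"
      unfolding y(2) c(2) using cl by (intro sum S(1)) auto
    also have "\<dots> = (\<Oplus>\<^bsub>N\<^esub>s\<in>S. c (d (e s)) \<odot>\<^bsub>N\<^esub> e s)"
    proof (rule N.finsum_cong')
      show "(\<lambda>s. c (d (e s)) \<odot>\<^bsub>N\<^esub> e s) \<in> S \<rightarrow> carrier N"
        using S(2) cl by (auto simp: N_simps d subset_iff)
    qed (use S(2) in \<open>auto simp: N_simps d subset_iff\<close>)
    also have "\<dots> = (\<Oplus>\<^bsub>N\<^esub>s\<in>e ` S. c (d s) \<odot>\<^bsub>N\<^esub> s)"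
    proof (rule N.finsum_reindex[symmetric])
      show "(\<lambda>s. c (d s) \<odot>\<^bsub>N\<^esub> s) \<in> e ` S \<rightarrow> carrier N"
        using S(2) cl by (auto simp: N_simps d subset_iff)
    qed fact
    finally have "x = (\<Oplus>\<^bsub>N\<^esub>s\<in>e ` S. c (d s) \<odot>\<^bsub>N\<^esub> s)" .
    moreover have "(\<lambda>s. c (d s)) \<in> e ` S \<rightarrow> carrier A"
      using c(1) S(2) by (auto simp: d subset_iff)
    ultimately show "\<exists>c\<in>e ` S \<rightarrow> carrier A. x = (\<Oplus>\<^bsub>N\<^esub>s\<in>e ` S. c s \<odot>\<^bsub>N\<^esub> s)"
      by (intro bexI[of _ "\<lambda>s. c (d s)"])
  qed (use S in \<open>auto simp: N_simps\<close>)
  moreover have "module_iso A M N"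
    unfolding module_iso_def
  proof (intro bexI)
    show "restrict e (carrier M) \<in> Hom A M N"
      by (auto simp: Hom_def N_simps d smult_closed)
    show "bij_betw (restrict e (carrier M)) (carrier M) (carrier N)"
      using inj by (auto simp: bij_betw_def N_simps inj_on_def)
  qed
  ultimately show ?thesis using N by blast
qed

lemma fg_module_iso_mod:
  fixes A :: "('a, 'r) ring_scheme" and M :: "('a, 'm, 'x) module_scheme"
  assumes "left_module A M" and "fin_gen A M"
  shows "\<exists>N\<in>mod_cat A. module_iso A M N"
proof -
  from assms(2) obtain S where S: "finite S"
    "\<And>x. x \<in> carrier M \<Longrightarrow> \<exists>c\<in>S \<rightarrow> carrier A. x = (\<Oplus>\<^bsub>M\<^esub>s\<in>S. c s \<odot>\<^bsub>M\<^esub> s)"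
    and SM: "S \<subseteq> carrier M"
    by (auto simp: fin_gen_def)
  obtain ss where ss: "set ss = S" using finite_list[OF S(1)] by blast
  obtain c where c: "\<And>x. x \<in> carrier M \<Longrightarrow> c x \<in> S \<rightarrow> carrier A"
    "\<And>x. x \<in> carrier M \<Longrightarrow> x = (\<Oplus>\<^bsub>M\<^esub>s\<in>S. c x s \<odot>\<^bsub>M\<^esub> s)"
    using S(2) by metis
  interpret left_module A M by fact
  have "inj_on (\<lambda>x. map (c x) ss) (carrier M)"
  proof (rule inj_onI)
    fix x y assume xy: "x \<in> carrier M" "y \<in> carrier M" "map (c x) ss = map (c y) ss"
    then have eq: "c x s = c y s" if "s \<in> S" for s
      using that ss by auto
    have "(\<Oplus>\<^bsub>M\<^esub>s\<in>S. c x s \<odot>\<^bsub>M\<^esub> s) = (\<Oplus>\<^bsub>M\<^esub>s\<in>S. c y s \<odot>\<^bsub>M\<^esub> s)"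
      using c(1)[OF xy(2)] SM eq by (intro M.finsum_cong') (auto intro!: smult_closed)
    then show "x = y" using c(2)[OF xy(1)] c(2)[OF xy(2)] by simp
  qed
  from transport_module[OF assms this] show ?thesis
    by (auto simp: mod_cat_def)
qed

end

theory Submission
  imports Defs
begin

text \<open>A torsion class \<open>T\<close> is functorially finite iff it has a universal element: some \<open>p \<in> P \<in> T\<close> such that
  every element of every \<open>Y \<in> T\<close> is the image of \<open>p\<close> under a map \<open>P \<rightarrow> Y\<close>. Let \<open>T\<close> be functorially finite
  and let \<open>T0\<close> be a torsion class not containing \<open>T\<close>. By Zorn's lemma there is a maximal torsion class
  below \<open>T\<close> that contains \<open>T \<inter> T0\<close> but not \<open>P\<close>, and a module of least length among the nonzero modules of
  \<open>T\<close> that are torsion free for it is a simple object \<open>S\<close> of \<open>\<alpha>(T)\<close> with \<open>Hom(T \<inter> T0, S) = 0\<close>. This makes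
  \<open>\<alpha>\<close> injective on functorially finite torsion classes. Moreover \<open>T \<inter> {Y. Hom(Y, S) = 0}\<close> is again
  functorially finite, so a minimal functorially finite torsion class above an arbitrary torsion class
  is equal to it, and finiteness of their number makes all torsion classes functorially finite.
  A wide subcategory \<open>W\<close> is \<open>\<alpha>\<close> of the smallest torsion class that contains it, and it inherits
  approximations from that class.\<close>

section \<open>Left modules\<close>

text \<open>A torsion class always has right approximations, because the radical of a module is one.
  Functorial finiteness is therefore a statement about left approximations, and these reduce to the
  regular module since they survive direct sums and quotients; this is why a single pair
  \<open>(P, p)\<close> decides it. The same pair makes Zorn's lemma applicable: for a torsion class
  \<open>T1 \<subseteq> T\<close>, being proper means omitting \<open>P\<close>, and this passes to
  unions of chains. That no torsion class lies strictly between the maximal \<open>T1\<close> and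
  \<open>T\<close> is what puts \<open>S\<close> into \<open>\<alpha>(T)\<close>. The step down to
  \<open>T \<inter> {Y. Hom(Y, S) = 0}\<close> needs surjections whose kernels lie in
  \<open>T\<close>, the usual task of an Ext-progenerator. Ext groups and decompositions into
  indecomposables are avoided: a module or map is chosen so that some subspace of bounded dimension
  is maximal, and adding a direct summand then contradicts maximality unless the desired lift
  exists. Wide subcategories have no radical, so their right approximations need an argument of
  their own; it starts from a universal element supplied by the left approximations.\<close>

context left_module
begin

lemma smult_zero_right: "a \<in> carrier A \<Longrightarrow> a \<odot>\<^bsub>M\<^esub> \<zero>\<^bsub>M\<^esub> = \<zero>\<^bsub>M\<^esub>"
  using smult_r_distr[of a "\<zero>\<^bsub>M\<^esub>" "\<zero>\<^bsub>M\<^esub>"] smult_closed[of a "\<zero>\<^bsub>M\<^esub>"]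
  by (metis M.add.l_cancel_one M.zero_closed M.r_zero)

lemma smult_zero_left: "x \<in> carrier M \<Longrightarrow> \<zero> \<odot>\<^bsub>M\<^esub> x = \<zero>\<^bsub>M\<^esub>"
  using smult_l_distr[of "\<zero>" "\<zero>" x] smult_closed[of "\<zero>" x]
  by (metis M.add.l_cancel_one A.zero_closed A.r_zero)

lemma smult_uminus_one: "x \<in> carrier M \<Longrightarrow> (\<ominus> \<one>) \<odot>\<^bsub>M\<^esub> x = \<ominus>\<^bsub>M\<^esub> x"
  using smult_l_distr[of "\<ominus> \<one>" "\<one>" x]
  by (simp add: A.l_neg smult_zero_left smult_one smult_closed M.minus_equality)

end

text \<open>\<open>N\<close> is a bare structure here: the module axioms are inherited along
  \<open>p\<close>. For \<open>quo\<close> this spares all computations with coset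
  representatives.\<close>

lemma left_module_image:
  fixes A :: "('a, 'r) ring_scheme" and M :: "('a, 'm, 'x) module_scheme"
    and N :: "('a, 'n, 'y) module_scheme"
  assumes "left_module A M" and surj: "p ` carrier M = carrier N"
    and p_add: "\<And>x y. x \<in> carrier M \<Longrightarrow> y \<in> carrier M \<Longrightarrow> p (x \<oplus>\<^bsub>M\<^esub> y) = p x \<oplus>\<^bsub>N\<^esub> p y"
    and p_smult: "\<And>a x. a \<in> carrier A \<Longrightarrow> x \<in> carrier M \<Longrightarrow> p (a \<odot>\<^bsub>M\<^esub> x) = a \<odot>\<^bsub>N\<^esub> p x"
    and p_zero: "p \<zero>\<^bsub>M\<^esub> = \<zero>\<^bsub>N\<^esub>"
  shows "left_module A N"
proof -
  interpret left_module A M by fact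
  have "abelian_group N"
  proof (rule abelian_groupI, unfold surj[symmetric])
    fix x assume "x \<in> p ` carrier M"
    then obtain y where y: "y \<in> carrier M" "x = p y" by blast
    then have "p (\<ominus>\<^bsub>M\<^esub> y) \<oplus>\<^bsub>N\<^esub> x = \<zero>\<^bsub>N\<^esub>"
      by (metis M.a_inv_closed p_add M.l_neg p_zero)
    then show "\<exists>y\<in>p ` carrier M. y \<oplus>\<^bsub>N\<^esub> x = \<zero>\<^bsub>N\<^esub>" using y by blast
  qed (auto simp: p_add[symmetric] p_zero[symmetric] M.a_ac)
  then show ?thesis
  proof (intro left_module.intro left_module_axioms.intro A.ring_axioms, unfold surj[symmetric])
  qed (auto simp: p_add[symmetric] p_smult[symmetric] smult_closed smult_l_distr smult_r_distr
        smult_assoc1 smult_one)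
qed

section \<open>Subsets closed under addition and a set of scalars\<close>

text \<open>The scalars form an arbitrary set \<open>R\<close>, so that one notion covers submodules
  (\<open>carrier A\<close>), subspaces (\<open>Z\<close>) and additive submonoids
  (\<open>{}\<close>). Negatives are available as soon as \<open>R\<close> contains minus
  one.\<close>

definition subm :: "'a set \<Rightarrow> ('a, 'm, 'x) module_scheme \<Rightarrow> 'm set \<Rightarrow> bool" where
  "subm R M U \<longleftrightarrow> U \<subseteq> carrier M \<and> \<zero>\<^bsub>M\<^esub> \<in> U \<and> (\<forall>x\<in>U. \<forall>y\<in>U. x \<oplus>\<^bsub>M\<^esub> y \<in> U) \<and>
     (\<forall>a\<in>R. \<forall>x\<in>U. a \<odot>\<^bsub>M\<^esub> x \<in> U)"

lemma submI:
  assumes "U \<subseteq> carrier M" and "\<zero>\<^bsub>M\<^esub> \<in> U" and "\<And>x y. x \<in> U \<Longrightarrow> y \<in> U \<Longrightarrow> x \<oplus>\<^bsub>M\<^esub> y \<in> U"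
    and "\<And>a x. a \<in> R \<Longrightarrow> x \<in> U \<Longrightarrow> a \<odot>\<^bsub>M\<^esub> x \<in> U"
  shows "subm R M U"
  using assms by (auto simp: subm_def)

lemma subm_subset: "subm R M U \<Longrightarrow> U \<subseteq> carrier M"
  and subm_mem: "subm R M U \<Longrightarrow> x \<in> U \<Longrightarrow> x \<in> carrier M"
  and subm_zero: "subm R M U \<Longrightarrow> \<zero>\<^bsub>M\<^esub> \<in> U"
  and subm_add: "subm R M U \<Longrightarrow> x \<in> U \<Longrightarrow> y \<in> U \<Longrightarrow> x \<oplus>\<^bsub>M\<^esub> y \<in> U"
  and subm_smult: "subm R M U \<Longrightarrow> a \<in> R \<Longrightarrow> x \<in> U \<Longrightarrow> a \<odot>\<^bsub>M\<^esub> x \<in> U"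
  by (auto simp: subm_def)

lemma subm_mono: "subm R M U \<Longrightarrow> R' \<subseteq> R \<Longrightarrow> subm R' M U"
  by (auto simp: subm_def)

text \<open>The linear combinations of \<open>S\<close> form the smallest submodule containing
  \<open>S\<close>. Generation is used only in this second form afterwards, which removes finite
  sums from all later arguments.\<close>

lemma (in left_module) fin_gen_iff:
  "fin_gen A M \<longleftrightarrow> (\<exists>S. finite S \<and> S \<subseteq> carrier M \<and>
     (\<forall>U. subm (carrier A) M U \<and> S \<subseteq> U \<longrightarrow> U = carrier M))"
proof
  assume "fin_gen A M"
  then obtain S where S: "finite S" "S \<subseteq> carrier M"
    "\<And>x. x \<in> carrier M \<Longrightarrow> \<exists>c\<in>S \<rightarrow> carrier A. x = (\<Oplus>\<^bsub>M\<^esub>s\<in>S. c s \<odot>\<^bsub>M\<^esub> s)"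
    by (auto simp: fin_gen_def)
  have "U = carrier M" if U: "subm (carrier A) M U" "S \<subseteq> U" for U
  proof
    show "carrier M \<subseteq> U"
    proof
      fix x assume "x \<in> carrier M"
      then obtain c where c: "c \<in> S \<rightarrow> carrier A" "x = (\<Oplus>\<^bsub>M\<^esub>s\<in>S. c s \<odot>\<^bsub>M\<^esub> s)" using S(3) by blast
      have "(\<Oplus>\<^bsub>M\<^esub>s\<in>F. c s \<odot>\<^bsub>M\<^esub> s) \<in> U" if "finite F" "F \<subseteq> S" for F
        using that
      proof (induction F)
        case (insert s F)
        then have "c s \<odot>\<^bsub>M\<^esub> s \<in> U" using U c(1) by (auto intro: subm_smult)
        moreover have "(\<lambda>s. c s \<odot>\<^bsub>M\<^esub> s) \<in> F \<rightarrow> carrier M"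
          using insert.prems S(2) c(1) by (auto intro!: smult_closed)
        ultimately show ?case
          using insert U(1) by (subst M.finsum_insert) (auto intro: subm_add subm_mem)
      qed (use U in \<open>auto intro: subm_zero\<close>)
      then show "x \<in> U" using c(2) S(1) by simp
    qed
  qed (use U in \<open>auto simp: subm_def\<close>)
  then show "\<exists>S. finite S \<and> S \<subseteq> carrier M \<and>
     (\<forall>U. subm (carrier A) M U \<and> S \<subseteq> U \<longrightarrow> U = carrier M)" using S(1,2) by blast
next
  assume "\<exists>S. finite S \<and> S \<subseteq> carrier M \<and>
     (\<forall>U. subm (carrier A) M U \<and> S \<subseteq> U \<longrightarrow> U = carrier M)"
  then obtain S where S: "finite S" "S \<subseteq> carrier M"
    "\<And>U. subm (carrier A) M U \<Longrightarrow> S \<subseteq> U \<Longrightarrow> U = carrier M" by blast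
  let ?lc = "\<lambda>c. (\<Oplus>\<^bsub>M\<^esub>s\<in>S. c s \<odot>\<^bsub>M\<^esub> s)"
  define U where "U = ?lc ` (S \<rightarrow> carrier A)"
  have cl: "(\<lambda>s. c s \<odot>\<^bsub>M\<^esub> s) \<in> S \<rightarrow> carrier M" if "c \<in> S \<rightarrow> carrier A" for c
    using that S(2) by (auto intro!: smult_closed)
  have lc_zero: "?lc (\<lambda>_. \<zero>) = \<zero>\<^bsub>M\<^esub>"
    using S(2) by (intro M.add.finprod_one_eqI) (auto simp: smult_zero_left)
  have "subm (carrier A) M U"
  proof (rule submI)
    show "\<zero>\<^bsub>M\<^esub> \<in> U" unfolding U_def by (rule image_eqI[where x = "\<lambda>_. \<zero>"]) (auto simp: lc_zero)
  next
    fix x y assume "x \<in> U" "y \<in> U"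
    then obtain c d where cd: "c \<in> S \<rightarrow> carrier A" "d \<in> S \<rightarrow> carrier A" "x = ?lc c" "y = ?lc d"
      by (auto simp: U_def)
    have "x \<oplus>\<^bsub>M\<^esub> y = (\<Oplus>\<^bsub>M\<^esub>s\<in>S. c s \<odot>\<^bsub>M\<^esub> s \<oplus>\<^bsub>M\<^esub> d s \<odot>\<^bsub>M\<^esub> s)"
      using cd by (simp add: M.finsum_addf cl)
    also have "\<dots> = ?lc (\<lambda>s. c s \<oplus> d s)"
      using cd S(2) by (intro M.finsum_cong') (auto simp: smult_l_distr subset_iff Pi_iff intro!: smult_closed)
    finally show "x \<oplus>\<^bsub>M\<^esub> y \<in> U" unfolding U_def using cd by (intro image_eqI[where x = "\<lambda>s. c s \<oplus> d s"]) auto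
  next
    fix a x assume a: "a \<in> carrier A" and "x \<in> U"
    then obtain c where c: "c \<in> S \<rightarrow> carrier A" "x = ?lc c"
      by (auto simp: U_def)
    have "a \<odot>\<^bsub>M\<^esub> (\<Oplus>\<^bsub>M\<^esub>s\<in>F. c s \<odot>\<^bsub>M\<^esub> s) = (\<Oplus>\<^bsub>M\<^esub>s\<in>F. (a \<otimes> c s) \<odot>\<^bsub>M\<^esub> s)"
      if "finite F" "F \<subseteq> S" for F
      using that
    proof (induction F)
      case empty
      then show ?case using a by (simp add: smult_zero_right)
    next
      case (insert s F)
      have cl1: "c t \<in> carrier A" "t \<in> carrier M" if "t \<in> insert s F" for t
        using that insert.prems S(2) c(1) by auto
      have cl2: "(\<lambda>s. c s \<odot>\<^bsub>M\<^esub> s) \<in> F \<rightarrow> carrier M" "(\<lambda>s. (a \<otimes> c s) \<odot>\<^bsub>M\<^esub> s) \<in> F \<rightarrow> carrier M"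
        using cl1 a by (auto intro!: smult_closed)
      show ?case
        using insert cl1[of s] a cl2
        by (simp add: smult_r_distr smult_closed smult_assoc1)
    qed
    from this[OF S(1) subset_refl] show "a \<odot>\<^bsub>M\<^esub> x \<in> U"
      unfolding U_def c(2) using c(1) a by (intro image_eqI[where x = "\<lambda>s. a \<otimes> c s"]) auto
  qed (use cl in \<open>auto simp: U_def\<close>)
  moreover have "S \<subseteq> U"
  proof
    fix s assume s: "s \<in> S"
    have "?lc (\<lambda>t. if t = s then \<one> else \<zero>) = (\<Oplus>\<^bsub>M\<^esub>t\<in>S. if s = t then t else \<zero>\<^bsub>M\<^esub>)"
      using S(2) by (intro M.finsum_cong') (auto simp: smult_one smult_zero_left subset_iff)
    also have "\<dots> = s"
      using s S by (intro M.finsum_singleton) (auto simp: subset_iff)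
    finally show "s \<in> U" unfolding U_def
      by (intro image_eqI[where x = "\<lambda>t. if t = s then \<one> else \<zero>"]) auto
  qed
  ultimately have "U = carrier M" by (rule S(3))
  then show "fin_gen A M" using S(1,2) unfolding fin_gen_def U_def by (metis (no_types, lifting) imageE)
qed

text \<open>Membership in \<open>Hom\<close> without extensionality, so that composites, sums and
  differences of maps are plain abstractions. \<open>Hom_iff\<close> and \<open>Hom_restrict\<close>
  translate between the two.\<close>

definition is_linear ::
  "('a, 'r) ring_scheme \<Rightarrow> ('a, 'm, 'x) module_scheme \<Rightarrow> ('a, 'n, 'y) module_scheme \<Rightarrow>
   ('m \<Rightarrow> 'n) \<Rightarrow> bool"
  where "is_linear A M N g \<longleftrightarrow> g \<in> carrier M \<rightarrow> carrier N \<and>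
     (\<forall>x\<in>carrier M. \<forall>y\<in>carrier M. g (x \<oplus>\<^bsub>M\<^esub> y) = g x \<oplus>\<^bsub>N\<^esub> g y) \<and>
     (\<forall>a\<in>carrier A. \<forall>x\<in>carrier M. g (a \<odot>\<^bsub>M\<^esub> x) = a \<odot>\<^bsub>N\<^esub> g x)"

lemma Hom_iff: "g \<in> Hom A M N \<longleftrightarrow> is_linear A M N g \<and> g \<in> extensional (carrier M)"
  by (auto simp: Hom_def is_linear_def PiE_def)

lemma is_linearI:
  assumes "\<And>x. x \<in> carrier M \<Longrightarrow> g x \<in> carrier N"
    and "\<And>x y. x \<in> carrier M \<Longrightarrow> y \<in> carrier M \<Longrightarrow> g (x \<oplus>\<^bsub>M\<^esub> y) = g x \<oplus>\<^bsub>N\<^esub> g y"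
    and "\<And>a x. a \<in> carrier A \<Longrightarrow> x \<in> carrier M \<Longrightarrow> g (a \<odot>\<^bsub>M\<^esub> x) = a \<odot>\<^bsub>N\<^esub> g x"
  shows "is_linear A M N g"
  using assms by (auto simp: is_linear_def)

lemma mem_a_kernel [simp]: "x \<in> a_kernel M N g \<longleftrightarrow> x \<in> carrier M \<and> g x = \<zero>\<^bsub>N\<^esub>"
  by (auto simp: a_kernel_def')

lemma linear_closed: "is_linear A M N g \<Longrightarrow> x \<in> carrier M \<Longrightarrow> g x \<in> carrier N"
  and linear_add: "is_linear A M N g \<Longrightarrow> x \<in> carrier M \<Longrightarrow> y \<in> carrier M \<Longrightarrow>
        g (x \<oplus>\<^bsub>M\<^esub> y) = g x \<oplus>\<^bsub>N\<^esub> g y"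
  and linear_smult: "is_linear A M N g \<Longrightarrow> a \<in> carrier A \<Longrightarrow> x \<in> carrier M \<Longrightarrow>
        g (a \<odot>\<^bsub>M\<^esub> x) = a \<odot>\<^bsub>N\<^esub> g x"
  by (auto simp: is_linear_def)

lemma linear_zero:
  assumes "left_module A M" and "left_module A N" and g: "is_linear A M N g"
  shows "g \<zero>\<^bsub>M\<^esub> = \<zero>\<^bsub>N\<^esub>"
proof -
  interpret M: left_module A M by fact
  interpret N: left_module A N by fact
  have "g (\<zero>\<^bsub>A\<^esub> \<odot>\<^bsub>M\<^esub> \<zero>\<^bsub>M\<^esub>) = \<zero>\<^bsub>A\<^esub> \<odot>\<^bsub>N\<^esub> g \<zero>\<^bsub>M\<^esub>"
    by (rule linear_smult[OF g]) simp_all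
  then show ?thesis
    by (simp add: M.smult_zero_left N.smult_zero_left linear_closed[OF g])
qed

lemma linear_comp:
  assumes "is_linear A L M g" and "is_linear A M N f"
  shows "is_linear A L N (\<lambda>x. f (g x))"
  using assms by (auto simp: is_linear_def Pi_iff)

lemma fin_gen_surj:
  assumes M: "left_module A M" and N: "left_module A N" and "fin_gen A M"
    and p: "is_linear A M N p" "p ` carrier M = carrier N"
  shows "fin_gen A N"
proof -
  interpret M: left_module A M by fact
  obtain S where S: "finite S" "S \<subseteq> carrier M"
    "\<And>U. subm (carrier A) M U \<Longrightarrow> S \<subseteq> U \<Longrightarrow> U = carrier M"
    using assms(3) left_module.fin_gen_iff[OF M] by blast
  have "U = carrier N" if U: "subm (carrier A) N U" "p ` S \<subseteq> U" for U
  proof -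
    have "subm (carrier A) M {x \<in> carrier M. p x \<in> U}"
      using U(1) linear_zero[OF M N p(1)]
      by (auto simp: subm_def linear_add[OF p(1)] linear_smult[OF p(1)] M.smult_closed)
    then have "{x \<in> carrier M. p x \<in> U} = carrier M"
      by (rule S(3)) (use S(2) U(2) in auto)
    then have "carrier N \<subseteq> U" unfolding p(2)[symmetric] by blast
    then show ?thesis using U(1) by (auto simp: subm_def)
  qed
  then show ?thesis
    unfolding left_module.fin_gen_iff[OF N] using S(1,2) p(2)
    by (intro exI[of _ "p ` S"] conjI allI impI) auto
qed

section \<open>Bounded chains\<close>

text \<open>A strictly increasing rank function bounded by \<open>n\<close> stands in for a bound on
  the lengths of chains. Such a function restricts to subfamilies and pulls back along
  intersections, preimages and evaluations, which makes dimension estimates short.\<close>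

definition chain_bound :: "'x set set \<Rightarrow> nat \<Rightarrow> bool" where
  "chain_bound \<S> n \<longleftrightarrow> (\<exists>m :: 'x set \<Rightarrow> nat. (\<forall>V\<in>\<S>. m V \<le> n) \<and>
     (\<forall>V\<in>\<S>. \<forall>W\<in>\<S>. V \<subset> W \<longrightarrow> m V < m W))"

lemma chain_boundI:
  assumes "\<And>V. V \<in> \<S> \<Longrightarrow> m V \<le> n"
    and "\<And>V W. V \<in> \<S> \<Longrightarrow> W \<in> \<S> \<Longrightarrow> V \<subset> W \<Longrightarrow> m V < m W"
  shows "chain_bound \<S> n"
  unfolding chain_bound_def by (rule exI[of _ m]) (simp add: assms)

lemma chain_boundE:
  fixes \<S> :: "'x set set"
  assumes "chain_bound \<S> n"
  obtains m where "\<And>V. V \<in> \<S> \<Longrightarrow> m V \<le> n"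
    and "\<And>V W. V \<in> \<S> \<Longrightarrow> W \<in> \<S> \<Longrightarrow> V \<subset> W \<Longrightarrow> m V < m W"
proof -
  from assms obtain m :: "'x set \<Rightarrow> nat" where m: "(\<forall>V\<in>\<S>. m V \<le> n) \<and>
     (\<forall>V\<in>\<S>. \<forall>W\<in>\<S>. V \<subset> W \<longrightarrow> m V < m W)"
    unfolding chain_bound_def by (rule exE)
  show ?thesis by (rule that[of m]) (simp_all add: m)
qed

lemma chain_bound_antimono:
  assumes "chain_bound \<S> n" and "\<T> \<subseteq> \<S>"
  shows "chain_bound \<T> n"
proof -
  from assms(1) obtain m where m: "\<And>V. V \<in> \<S> \<Longrightarrow> m V \<le> n"
    "\<And>V W. V \<in> \<S> \<Longrightarrow> W \<in> \<S> \<Longrightarrow> V \<subset> W \<Longrightarrow> m V < m W"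
    using chain_boundE by blast
  show ?thesis
    by (rule chain_boundI[of _ m]) (use m assms(2) in auto)
qed

lemma chain_bound_maximal:
  assumes "chain_bound \<S> n" and "\<T> \<subseteq> \<S>" and "V0 \<in> \<T>"
  shows "\<exists>V\<in>\<T>. \<forall>W\<in>\<T>. V \<subseteq> W \<longrightarrow> W = V"
proof -
  from assms(1) obtain m where m: "\<And>V. V \<in> \<S> \<Longrightarrow> m V \<le> n"
    "\<And>V W. V \<in> \<S> \<Longrightarrow> W \<in> \<S> \<Longrightarrow> V \<subset> W \<Longrightarrow> m V < m W"
    using chain_boundE by blast
  have "\<exists>V. V \<in> \<T> \<and> (\<forall>W. W \<in> \<T> \<longrightarrow> m W \<le> m V)"
    using assms(2,3) m(1) by (intro ex_has_greatest_nat[where b = "Suc n" and k = V0]) (auto simp: le_imp_less_Suc)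
  then obtain V where V: "V \<in> \<T>" "\<And>W. W \<in> \<T> \<Longrightarrow> m W \<le> m V" by blast
  have "W = V" if "W \<in> \<T>" "V \<subseteq> W" for W
    using m(2)[of V W] V that assms(2) by (force simp: psubset_eq not_less)
  with V(1) show ?thesis by blast
qed

lemma chain_bound_minimal:
  assumes "chain_bound \<S> n" and "\<T> \<subseteq> \<S>" and "V0 \<in> \<T>"
  shows "\<exists>V\<in>\<T>. \<forall>W\<in>\<T>. W \<subseteq> V \<longrightarrow> W = V"
proof -
  from assms(1) obtain m where m: "\<And>V. V \<in> \<S> \<Longrightarrow> m V \<le> n"
    "\<And>V W. V \<in> \<S> \<Longrightarrow> W \<in> \<S> \<Longrightarrow> V \<subset> W \<Longrightarrow> m V < m W"
    using chain_boundE by blast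
  have "\<exists>V. V \<in> \<T> \<and> (\<forall>W. W \<in> \<T> \<longrightarrow> m V \<le> m W)"
    using assms(3) by (rule ex_has_least_nat)
  then obtain V where V: "V \<in> \<T>" "\<And>W. W \<in> \<T> \<Longrightarrow> m V \<le> m W" by blast
  have "W = V" if "W \<in> \<T>" "W \<subseteq> V" for W
    using m(2)[of W V] V that assms(2) by (force simp: psubset_eq not_less)
  with V(1) show ?thesis by blast
qed

section \<open>Modules of finite length\<close>

definition reg :: "('a, 'r) ring_scheme \<Rightarrow> ('a, 'a) module" where
  "reg A = \<lparr>carrier = carrier A, monoid.mult = undefined, one = undefined, ring.zero = \<zero>\<^bsub>A\<^esub>,
     ring.add = add A, module.smult = monoid.mult A\<rparr>"

lemma reg_simps [simp]:
  "carrier (reg A) = carrier A" "\<zero>\<^bsub>reg A\<^esub> = \<zero>\<^bsub>A\<^esub>" "x \<oplus>\<^bsub>reg A\<^esub> y = x \<oplus>\<^bsub>A\<^esub> y" "a \<odot>\<^bsub>reg A\<^esub> x = a \<otimes>\<^bsub>A\<^esub> x"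
  by (simp_all add: reg_def)

text \<open>\<open>Z\<close> is the image of the base field in the center of the algebra.\<close>

locale scalar_algebra = ring A for A :: "('a, 'r) ring_scheme" (structure) +
  fixes Z :: "'a set"
  assumes Z_subset: "Z \<subseteq> carrier A"
    and Z_one: "\<one> \<in> Z"
    and Z_uminus: "z \<in> Z \<Longrightarrow> \<ominus> z \<in> Z"
    and Z_add: "z \<in> Z \<Longrightarrow> w \<in> Z \<Longrightarrow> z \<oplus> w \<in> Z"
    and Z_mult: "z \<in> Z \<Longrightarrow> w \<in> Z \<Longrightarrow> z \<otimes> w \<in> Z"
    and Z_inverse: "z \<in> Z \<Longrightarrow> z \<noteq> \<zero> \<Longrightarrow> \<exists>w\<in>Z. w \<otimes> z = \<one>"
    and Z_central: "z \<in> Z \<Longrightarrow> a \<in> carrier A \<Longrightarrow> z \<otimes> a = a \<otimes> z"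
    and Z_finite: "\<exists>F. finite F \<and> F \<subseteq> carrier A \<and> (\<forall>U. subm Z (reg A) U \<and> F \<subseteq> U \<longrightarrow> U = carrier A)"
begin

abbreviation "lin \<equiv> is_linear A"
abbreviation "mods \<equiv> mod_cat A"
abbreviation "sub \<equiv> subm (carrier A)"

lemma Z_carrier: "z \<in> Z \<Longrightarrow> z \<in> carrier A"
  using Z_subset by blast

lemma sub_imp_subm_Z: "sub M U \<Longrightarrow> subm Z M U"
  using Z_subset by (rule subm_mono[rotated])

lemma subm_uminus:
  assumes "left_module A M" and U: "subm R M U" and "\<ominus> \<one> \<in> R" and "x \<in> U"
  shows "\<ominus>\<^bsub>M\<^esub> x \<in> U"
  using subm_smult[OF U assms(3,4)] subm_mem[OF U assms(4)]
  by (simp add: left_module.smult_uminus_one[OF assms(1)])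

lemma subm_minus:
  assumes "left_module A M" and "subm R M U" and "\<ominus> \<one> \<in> R" and "x \<in> U" and "y \<in> U"
  shows "x \<ominus>\<^bsub>M\<^esub> y \<in> U"
  using subm_add[OF assms(2,4) subm_uminus[OF assms(1-3,5)]] by (simp add: a_minus_def)

text \<open>Adjoining one vector raises the dimension by at most one. Here the inverses of nonzero
  scalars enter.\<close>

lemma chain_bound_add_line:
  assumes M: "left_module A M" and U: "subm Z M U" and v: "v \<in> carrier M"
    and bd: "chain_bound {V. subm Z M V \<and> V \<subseteq> U} n"
  shows "\<exists>U'. subm Z M U' \<and> v \<in> U' \<and> U \<subseteq> U' \<and> chain_bound {V. subm Z M V \<and> V \<subseteq> U'} (Suc n)"
proof -
  interpret M: left_module A M by fact
  note cl = subm_mem[OF U] Z_carrier M.smult_closed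
  have sm: "subm Z M V \<Longrightarrow> x \<in> V \<Longrightarrow> y \<in> V \<Longrightarrow> x \<ominus>\<^bsub>M\<^esub> y \<in> V" for V x y
    by (rule subm_minus[OF M]) (auto intro: Z_uminus Z_one)
  define U' where "U' = {u \<oplus>\<^bsub>M\<^esub> z \<odot>\<^bsub>M\<^esub> v | u z. u \<in> U \<and> z \<in> Z}"
  have U'I: "u \<oplus>\<^bsub>M\<^esub> z \<odot>\<^bsub>M\<^esub> v \<in> U'" if "u \<in> U" "z \<in> Z" for u z
    using that by (auto simp: U'_def)
  have zero: "\<zero> \<in> Z" using Z_add[OF Z_one Z_uminus[OF Z_one]] by (simp add: r_neg)
  have "subm Z M U'"
  proof (rule submI)
    show "\<zero>\<^bsub>M\<^esub> \<in> U'"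
      using U'I[OF subm_zero[OF U] zero] v by (simp add: M.smult_zero_left)
  next
    fix x y assume "x \<in> U'" "y \<in> U'"
    then obtain u z t w where "u \<in> U" "z \<in> Z" "x = u \<oplus>\<^bsub>M\<^esub> z \<odot>\<^bsub>M\<^esub> v"
       "t \<in> U" "w \<in> Z" "y = t \<oplus>\<^bsub>M\<^esub> w \<odot>\<^bsub>M\<^esub> v" by (auto simp: U'_def)
    moreover from this have "x \<oplus>\<^bsub>M\<^esub> y = (u \<oplus>\<^bsub>M\<^esub> t) \<oplus>\<^bsub>M\<^esub> (z \<oplus> w) \<odot>\<^bsub>M\<^esub> v"
      using v by (simp add: cl M.smult_l_distr M.a_ac)
    ultimately show "x \<oplus>\<^bsub>M\<^esub> y \<in> U'"
      using U'I[of "u \<oplus>\<^bsub>M\<^esub> t" "z \<oplus> w"] U by (simp add: subm_add Z_add)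
  next
    fix w x assume w: "w \<in> Z" and "x \<in> U'"
    then obtain u z where "u \<in> U" "z \<in> Z" "x = u \<oplus>\<^bsub>M\<^esub> z \<odot>\<^bsub>M\<^esub> v" by (auto simp: U'_def)
    then show "w \<odot>\<^bsub>M\<^esub> x \<in> U'"
      using U'I[of "w \<odot>\<^bsub>M\<^esub> u" "w \<otimes> z"] U v w
      by (simp add: cl M.smult_r_distr M.smult_assoc1 subm_smult Z_mult)
  qed (use v in \<open>auto simp: U'_def cl\<close>)
  moreover have "v \<in> U'"
    using U'I[OF subm_zero[OF U] Z_one] v by (simp add: M.smult_one)
  moreover have "U \<subseteq> U'"
  proof
    fix u assume "u \<in> U"
    then show "u \<in> U'" using U'I[of u, OF _ zero] v by (simp add: cl M.smult_zero_left)
  qed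
  moreover have "chain_bound {V. subm Z M V \<and> V \<subseteq> U'} (Suc n)"
  proof -
    obtain m where m: "\<And>V. V \<in> {V. subm Z M V \<and> V \<subseteq> U} \<Longrightarrow> m V \<le> n"
      "\<And>V W. V \<in> {V. subm Z M V \<and> V \<subseteq> U} \<Longrightarrow> W \<in> {V. subm Z M V \<and> V \<subseteq> U} \<Longrightarrow> V \<subset> W \<Longrightarrow> m V < m W"
      using chain_boundE[OF bd] by blast
    have int: "subm Z M (V \<inter> U)" if "subm Z M V" for V
      using that U by (auto simp: subm_def)
    \<comment> \<open>The second summand is the dimension of the image of \<open>V\<close> in
      \<open>U' / U\<close>, which is spanned by the class of \<open>v\<close>.\<close>
    define m' where "m' V = m (V \<inter> U) + (if V \<subseteq> U then 0 else 1)" for V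
    show ?thesis
    proof (rule chain_boundI[of _ m'])
      fix V assume "V \<in> {V. subm Z M V \<and> V \<subseteq> U'}"
      then show "m' V \<le> Suc n" using m(1)[of "V \<inter> U"] int[of V] by (auto simp: m'_def)
    next
      fix V W assume VW: "V \<in> {V. subm Z M V \<and> V \<subseteq> U'}" "W \<in> {V. subm Z M V \<and> V \<subseteq> U'}" "V \<subset> W"
      then have sV: "subm Z M V" and sW: "subm Z M W" by auto
      have le: "m (V \<inter> U) \<le> m (W \<inter> U)"
        using m(2)[of "V \<inter> U" "W \<inter> U"] VW int by (cases "V \<inter> U = W \<inter> U") force+
      show "m' V < m' W"
      proof (rule ccontr)
        assume "\<not> m' V < m' W"
        with le VW(3) have same: "V \<subseteq> U \<longleftrightarrow> W \<subseteq> U" and "\<not> m (V \<inter> U) < m (W \<inter> U)"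
          by (auto simp: m'_def split: if_splits)
        with m(2)[of "V \<inter> U" "W \<inter> U"] VW int have eq: "V \<inter> U = W \<inter> U" by auto
        show False
        proof (cases "V \<subseteq> U")
          case True
          with same eq VW(3) show False by auto
        next
          case False
          then obtain w where w: "w \<in> V" "w \<notin> U" by blast
          with VW(1) obtain u k where uk: "u \<in> U" "k \<in> Z" "w = u \<oplus>\<^bsub>M\<^esub> k \<odot>\<^bsub>M\<^esub> v"
            by (auto simp: U'_def)
          have "k \<noteq> \<zero>" using uk w(2) v by (auto simp: M.smult_zero_left cl)
          then obtain i where i: "i \<in> Z" "i \<otimes> k = \<one>" using Z_inverse uk(2) by blast
          \<comment> \<open>Subtracting the multiple \<open>c\<close> of \<open>w\<close> cancels
            the \<open>v\<close>-component of \<open>y\<close>. The difference lies in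
            \<open>W \<inter> U\<close>, which equals \<open>V \<inter> U\<close>.\<close>
          have "W \<subseteq> V"
          proof
            fix y assume y: "y \<in> W"
            with VW(2) obtain t l where tl: "t \<in> U" "l \<in> Z" "y = t \<oplus>\<^bsub>M\<^esub> l \<odot>\<^bsub>M\<^esub> v"
              by (auto simp: U'_def)
            define c where "c = l \<otimes> i"
            have c: "c \<in> Z" by (simp add: c_def Z_mult tl i)
            have ck: "c \<otimes> k = l" unfolding c_def
              using i uk(2) tl(2) by (simp add: m_assoc Z_carrier)
            have wc: "w \<in> carrier M" "y \<in> carrier M" using subm_mem[OF sV w(1)] subm_mem[OF sW y] by auto
            have cw: "c \<odot>\<^bsub>M\<^esub> w = c \<odot>\<^bsub>M\<^esub> u \<oplus>\<^bsub>M\<^esub> l \<odot>\<^bsub>M\<^esub> v"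
              using uk v c by (simp add: cl M.smult_r_distr M.smult_assoc1[symmetric] ck)
            have "y \<ominus>\<^bsub>M\<^esub> c \<odot>\<^bsub>M\<^esub> w = t \<ominus>\<^bsub>M\<^esub> c \<odot>\<^bsub>M\<^esub> u"
              unfolding cw tl(3) using tl uk v c
              by (simp add: cl a_minus_def M.minus_add M.a_ac M.r_neg)
            also have "\<dots> \<in> U" using U uk tl c by (intro sm) (auto intro: subm_smult)
            finally have inU: "y \<ominus>\<^bsub>M\<^esub> c \<odot>\<^bsub>M\<^esub> w \<in> U" .
            have cV: "c \<odot>\<^bsub>M\<^esub> w \<in> V" using sV c w by (auto intro: subm_smult)
            then have "y \<ominus>\<^bsub>M\<^esub> c \<odot>\<^bsub>M\<^esub> w \<in> W" using VW(3) y sW by (intro sm) auto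
            with inU eq have "y \<ominus>\<^bsub>M\<^esub> c \<odot>\<^bsub>M\<^esub> w \<in> V" by blast
            then have "(y \<ominus>\<^bsub>M\<^esub> c \<odot>\<^bsub>M\<^esub> w) \<oplus>\<^bsub>M\<^esub> c \<odot>\<^bsub>M\<^esub> w \<in> V" using cV sV by (intro subm_add)
            then show "y \<in> V" using wc c by (simp add: a_minus_def M.a_assoc cl M.l_neg)
          qed
          with VW(3) show False by auto
        qed
      qed
    qed
  qed
  ultimately show ?thesis by blast
qed

lemma chain_bound_finite:
  assumes M: "left_module A M" and "finite F" and "F \<subseteq> carrier M"
  shows "\<exists>U n. subm Z M U \<and> F \<subseteq> U \<and> chain_bound {V. subm Z M V \<and> V \<subseteq> U} n"
  using assms(2,3)
proof (induction F)
  case empty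
  interpret M: left_module A M by fact
  have "subm Z M {\<zero>\<^bsub>M\<^esub>}" by (auto simp: subm_def M.smult_zero_right Z_carrier)
  moreover have "chain_bound {V. subm Z M V \<and> V \<subseteq> {\<zero>\<^bsub>M\<^esub>}} 0"
    by (rule chain_boundI[of _ "\<lambda>_. 0"]) (auto simp: subm_def)
  ultimately show ?case by blast
next
  case (insert v F)
  then obtain U n where U: "subm Z M U" "F \<subseteq> U" "chain_bound {V. subm Z M V \<and> V \<subseteq> U} n" by auto
  obtain U' where "subm Z M U'" "v \<in> U'" "U \<subseteq> U'" "chain_bound {V. subm Z M V \<and> V \<subseteq> U'} (Suc n)"
    using chain_bound_add_line[OF M U(1) _ U(3), of v] insert.prems by auto
  with U(2) show ?case by blast
qed

text \<open>A finitely generated module over a finite dimensional algebra is finite dimensional: it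
  is spanned by the products of a spanning set \<open>F\<close> of the algebra with the generators
  \<open>S\<close>.\<close>

lemma chain_bound_subspaces:
  assumes M: "left_module A M" and "fin_gen A M"
  shows "\<exists>n. chain_bound {V. subm Z M V} n"
proof -
  interpret M: left_module A M by fact
  obtain S where S: "finite S" "S \<subseteq> carrier M" "\<And>U. sub M U \<Longrightarrow> S \<subseteq> U \<Longrightarrow> U = carrier M"
    using assms(2) M.fin_gen_iff by blast
  obtain F where F: "finite F" "F \<subseteq> carrier A" "\<And>U. subm Z (reg A) U \<Longrightarrow> F \<subseteq> U \<Longrightarrow> U = carrier A"
    using Z_finite by blast
  define E where "E = (\<lambda>(a, s). a \<odot>\<^bsub>M\<^esub> s) ` (F \<times> S)"
  have E: "a \<odot>\<^bsub>M\<^esub> s \<in> E" if "a \<in> F" "s \<in> S" for a s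
    using that by (auto simp: E_def)
  have "finite E" "E \<subseteq> carrier M" using F S by (auto simp: E_def intro!: M.smult_closed)
  from chain_bound_finite[OF M this] obtain U n where U: "subm Z M U" "E \<subseteq> U"
    "chain_bound {V. subm Z M V \<and> V \<subseteq> U} n" by blast
  \<comment> \<open>The largest submodule inside \<open>U\<close>. It contains a generator
    \<open>s\<close> because the scalars sending \<open>s\<close> into \<open>U\<close> form a
    subspace of the algebra that contains \<open>F\<close>.\<close>
  define W where "W = {x \<in> carrier M. \<forall>a\<in>carrier A. a \<odot>\<^bsub>M\<^esub> x \<in> U}"
  have "sub M W"
    using U(1) by (auto simp: W_def subm_def M.smult_zero_right M.smult_closed M.smult_r_distr
        M.smult_assoc1[symmetric])
  moreover have "S \<subseteq> W"
  proof
    fix s assume s: "s \<in> S"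
    have sc: "s \<in> carrier M" using s S by auto
    have "subm Z (reg A) {a \<in> carrier A. a \<odot>\<^bsub>M\<^esub> s \<in> U}"
      using U(1) sc by (auto simp: subm_def M.smult_zero_left M.smult_l_distr M.smult_assoc1 Z_carrier)
    then have "{a \<in> carrier A. a \<odot>\<^bsub>M\<^esub> s \<in> U} = carrier A"
      by (rule F(3)) (use F(2) E s U(2) in auto)
    then show "s \<in> W" using sc by (auto simp: W_def)
  qed
  ultimately have "W = carrier M" by (rule S(3))
  then have "carrier M \<subseteq> U" by (force simp: W_def M.smult_one dest: bspec[of _ _ \<one>])
  then have "{V. subm Z M V \<and> V \<subseteq> U} = {V. subm Z M V}" by (auto simp: subm_def)
  with U(3) show ?thesis by auto
qed

end

section \<open>Submodules, quotients and direct sums\<close>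

definition restr :: "('a, 'm, 'x) module_scheme \<Rightarrow> 'm set \<Rightarrow> ('a, 'm, 'x) module_scheme" where
  "restr M U = M\<lparr>carrier := U\<rparr>"

lemma restr_simps [simp]:
  "carrier (restr M U) = U" "\<zero>\<^bsub>restr M U\<^esub> = \<zero>\<^bsub>M\<^esub>" "x \<oplus>\<^bsub>restr M U\<^esub> y = x \<oplus>\<^bsub>M\<^esub> y"
  "a \<odot>\<^bsub>restr M U\<^esub> x = a \<odot>\<^bsub>M\<^esub> x" "restr (restr M U) V = restr M V" "restr M (carrier M) = M"
  by (simp_all add: restr_def)

lemma ker_mod_eq: "ker_mod M N g = restr M (a_kernel M N g)"
  by (simp add: ker_mod_def restr_def)

text \<open>The carrier of a quotient consists of coset representatives, so that it stays in the type of
  the carrier of \<open>M\<close>.\<close>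

definition prj :: "('a, 'm) module \<Rightarrow> 'm set \<Rightarrow> 'm \<Rightarrow> 'm" where
  "prj M U x = (SOME y. y \<in> carrier M \<and> x \<ominus>\<^bsub>M\<^esub> y \<in> U)"

definition quo :: "('a, 'm) module \<Rightarrow> 'm set \<Rightarrow> ('a, 'm) module" where
  "quo M U = \<lparr>carrier = prj M U ` carrier M, monoid.mult = undefined, one = undefined,
     ring.zero = prj M U \<zero>\<^bsub>M\<^esub>, ring.add = (\<lambda>x y. prj M U (x \<oplus>\<^bsub>M\<^esub> y)),
     module.smult = (\<lambda>a x. prj M U (a \<odot>\<^bsub>M\<^esub> x))\<rparr>"

definition dsum :: "('a, 'm) module \<Rightarrow> ('a, 'n) module \<Rightarrow> ('a, 'm \<times> 'n) module" where
  "dsum M N = \<lparr>carrier = carrier M \<times> carrier N, monoid.mult = undefined, one = undefined,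
     ring.zero = (\<zero>\<^bsub>M\<^esub>, \<zero>\<^bsub>N\<^esub>), ring.add = (\<lambda>d e. (fst d \<oplus>\<^bsub>M\<^esub> fst e, snd d \<oplus>\<^bsub>N\<^esub> snd e)),
     module.smult = (\<lambda>a d. (a \<odot>\<^bsub>M\<^esub> fst d, a \<odot>\<^bsub>N\<^esub> snd d))\<rparr>"

lemma dsum_simps [simp]:
  "carrier (dsum M N) = carrier M \<times> carrier N" "\<zero>\<^bsub>dsum M N\<^esub> = (\<zero>\<^bsub>M\<^esub>, \<zero>\<^bsub>N\<^esub>)"
  "d \<oplus>\<^bsub>dsum M N\<^esub> e = (fst d \<oplus>\<^bsub>M\<^esub> fst e, snd d \<oplus>\<^bsub>N\<^esub> snd e)"
  "a \<odot>\<^bsub>dsum M N\<^esub> d = (a \<odot>\<^bsub>M\<^esub> fst d, a \<odot>\<^bsub>N\<^esub> snd d)"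
  by (simp_all add: dsum_def)

definition ssum :: "('a, 'm, 'x) module_scheme \<Rightarrow> 'm set \<Rightarrow> 'm set \<Rightarrow> 'm set" where
  "ssum M U V = {x \<oplus>\<^bsub>M\<^esub> y | x y. x \<in> U \<and> y \<in> V}"

text \<open>The composition length, as the least bound of a rank function on submodules.\<close>

definition len :: "('a, 'r) ring_scheme \<Rightarrow> ('a, 'm, 'x) module_scheme \<Rightarrow> nat" where
  "len A M = (LEAST n. chain_bound {U. subm (carrier A) M U} n)"

context scalar_algebra
begin

lemma modsD: "M \<in> mods \<Longrightarrow> left_module A M"
  by (simp add: mod_cat_def)

lemma mods_zero [simp, intro]: "M \<in> mods \<Longrightarrow> \<zero>\<^bsub>M\<^esub> \<in> carrier M"
  and mods_add [simp, intro]: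
    "M \<in> mods \<Longrightarrow> x \<in> carrier M \<Longrightarrow> y \<in> carrier M \<Longrightarrow> x \<oplus>\<^bsub>M\<^esub> y \<in> carrier M"
  and mods_minus [simp, intro]:
    "M \<in> mods \<Longrightarrow> x \<in> carrier M \<Longrightarrow> y \<in> carrier M \<Longrightarrow> x \<ominus>\<^bsub>M\<^esub> y \<in> carrier M"
  and mods_smult [simp, intro]:
    "M \<in> mods \<Longrightarrow> a \<in> carrier A \<Longrightarrow> x \<in> carrier M \<Longrightarrow> a \<odot>\<^bsub>M\<^esub> x \<in> carrier M"
  and mods_add_zero [simp]: "M \<in> mods \<Longrightarrow> x \<in> carrier M \<Longrightarrow> x \<oplus>\<^bsub>M\<^esub> \<zero>\<^bsub>M\<^esub> = x"
  and mods_zero_add [simp]: "M \<in> mods \<Longrightarrow> x \<in> carrier M \<Longrightarrow> \<zero>\<^bsub>M\<^esub> \<oplus>\<^bsub>M\<^esub> x = x"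
  and mods_smult_zero [simp]: "M \<in> mods \<Longrightarrow> a \<in> carrier A \<Longrightarrow> a \<odot>\<^bsub>M\<^esub> \<zero>\<^bsub>M\<^esub> = \<zero>\<^bsub>M\<^esub>"
  and mods_diff_self [simp]: "M \<in> mods \<Longrightarrow> x \<in> carrier M \<Longrightarrow> x \<ominus>\<^bsub>M\<^esub> x = \<zero>\<^bsub>M\<^esub>"
  and mods_diff_add [simp]:
    "M \<in> mods \<Longrightarrow> x \<in> carrier M \<Longrightarrow> y \<in> carrier M \<Longrightarrow> (x \<ominus>\<^bsub>M\<^esub> y) \<oplus>\<^bsub>M\<^esub> y = x"
  and mods_diff_eq_zero:
    "M \<in> mods \<Longrightarrow> x \<in> carrier M \<Longrightarrow> y \<in> carrier M \<Longrightarrow> x \<ominus>\<^bsub>M\<^esub> y = \<zero>\<^bsub>M\<^esub> \<longleftrightarrow> x = y"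
proof -
  assume M: "M \<in> mods"
  interpret M: left_module A M using M by (rule modsD)
  show "\<zero>\<^bsub>M\<^esub> \<in> carrier M" by simp
  show "a \<in> carrier A \<Longrightarrow> a \<odot>\<^bsub>M\<^esub> \<zero>\<^bsub>M\<^esub> = \<zero>\<^bsub>M\<^esub>" by (rule M.smult_zero_right)
  assume x: "x \<in> carrier M"
  show "a \<in> carrier A \<Longrightarrow> a \<odot>\<^bsub>M\<^esub> x \<in> carrier M" using x by (intro M.smult_closed)
  show "x \<oplus>\<^bsub>M\<^esub> \<zero>\<^bsub>M\<^esub> = x" "\<zero>\<^bsub>M\<^esub> \<oplus>\<^bsub>M\<^esub> x = x" "x \<ominus>\<^bsub>M\<^esub> x = \<zero>\<^bsub>M\<^esub>"
    using x by (simp_all add: a_minus_def M.r_neg)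
  assume y: "y \<in> carrier M"
  show "x \<oplus>\<^bsub>M\<^esub> y \<in> carrier M" "x \<ominus>\<^bsub>M\<^esub> y \<in> carrier M" "(x \<ominus>\<^bsub>M\<^esub> y) \<oplus>\<^bsub>M\<^esub> y = x"
    using x y by (simp_all add: a_minus_def M.a_assoc M.l_neg)
  then show "x \<ominus>\<^bsub>M\<^esub> y = \<zero>\<^bsub>M\<^esub> \<longleftrightarrow> x = y"
    using x y by (metis M.l_zero M.r_neg a_minus_def)
qed

lemma mods_smult_minus:
  assumes M: "M \<in> mods" and "a \<in> carrier A" "x \<in> carrier M" "y \<in> carrier M"
  shows "a \<odot>\<^bsub>M\<^esub> (x \<ominus>\<^bsub>M\<^esub> y) = a \<odot>\<^bsub>M\<^esub> x \<ominus>\<^bsub>M\<^esub> a \<odot>\<^bsub>M\<^esub> y"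
proof -
  interpret M: left_module A M using M by (rule modsD)
  have "a \<odot>\<^bsub>M\<^esub> (\<ominus>\<^bsub>M\<^esub> y) = \<ominus>\<^bsub>M\<^esub> (a \<odot>\<^bsub>M\<^esub> y)"
    using assms M.smult_r_distr[of a "\<ominus>\<^bsub>M\<^esub> y" y]
    by (intro M.minus_equality[symmetric]) (simp_all add: M.l_neg M.smult_closed)
  then show ?thesis using assms by (simp add: a_minus_def M.smult_r_distr)
qed

lemma uminus_one_closed: "\<ominus> \<one> \<in> carrier A"
  by simp

lemma sub_minus: "M \<in> mods \<Longrightarrow> sub M U \<Longrightarrow> x \<in> U \<Longrightarrow> y \<in> U \<Longrightarrow> x \<ominus>\<^bsub>M\<^esub> y \<in> U"
  using subm_minus[OF modsD _ uminus_one_closed] by blast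

lemma sub_carrier: "M \<in> mods \<Longrightarrow> sub M (carrier M)"
  and sub_zero: "M \<in> mods \<Longrightarrow> sub M {\<zero>\<^bsub>M\<^esub>}"
  by (auto simp: subm_def)

lemma sub_Int: "sub M U \<Longrightarrow> sub M V \<Longrightarrow> sub M (U \<inter> V)"
  by (auto simp: subm_def)

lemma sub_restr_iff: "U \<subseteq> carrier M \<Longrightarrow> subm R (restr M U) V \<longleftrightarrow> subm R M V \<and> V \<subseteq> U"
  by (auto simp: subm_def)

lemma ssum_sub:
  assumes M: "M \<in> mods" and U: "sub M U" and V: "sub M V"
  shows "sub M (ssum M U V)" and "U \<subseteq> ssum M U V" and "V \<subseteq> ssum M U V"
proof -
  interpret M: left_module A M using M by (rule modsD)
  note cl = subm_mem[OF U] subm_mem[OF V]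
  show "sub M (ssum M U V)"
  proof (rule submI)
    show "\<zero>\<^bsub>M\<^esub> \<in> ssum M U V"
      using subm_zero[OF U] subm_zero[OF V] M.l_zero[of "\<zero>\<^bsub>M\<^esub>"] by (force simp: ssum_def)
  next
    fix x y assume "x \<in> ssum M U V" "y \<in> ssum M U V"
    then obtain u v u' v' where "u \<in> U" "v \<in> V" "u' \<in> U" "v' \<in> V" "x = u \<oplus>\<^bsub>M\<^esub> v" "y = u' \<oplus>\<^bsub>M\<^esub> v'"
      by (auto simp: ssum_def)
    moreover from this have "x \<oplus>\<^bsub>M\<^esub> y = (u \<oplus>\<^bsub>M\<^esub> u') \<oplus>\<^bsub>M\<^esub> (v \<oplus>\<^bsub>M\<^esub> v')"
      by (simp add: cl M.a_ac)
    ultimately show "x \<oplus>\<^bsub>M\<^esub> y \<in> ssum M U V"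
      using U V by (auto simp: ssum_def intro: subm_add)
  next
    fix a x assume "a \<in> carrier A" "x \<in> ssum M U V"
    then show "a \<odot>\<^bsub>M\<^esub> x \<in> ssum M U V"
      using U V by (auto simp: ssum_def cl M.smult_r_distr) (blast intro: subm_smult)
  qed (auto simp: ssum_def cl)
  show "U \<subseteq> ssum M U V" "V \<subseteq> ssum M U V"
    using subm_zero[OF U] subm_zero[OF V] M.l_zero M.r_zero cl by (force simp: ssum_def)+
qed

lemma ssum_least:
  assumes "sub M W" and "U \<subseteq> W" and "V \<subseteq> W"
  shows "ssum M U V \<subseteq> W"
  using assms by (auto simp: ssum_def intro: subm_add)

lemma cyclic_sub:
  assumes M: "M \<in> mods" and x: "x \<in> carrier M"
  shows "sub M ((\<lambda>a. a \<odot>\<^bsub>M\<^esub> x) ` carrier A)" and "x \<in> (\<lambda>a. a \<odot>\<^bsub>M\<^esub> x) ` carrier A"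
proof -
  interpret M: left_module A M using M by (rule modsD)
  show "sub M ((\<lambda>a. a \<odot>\<^bsub>M\<^esub> x) ` carrier A)"
  proof (rule submI)
    show "\<zero>\<^bsub>M\<^esub> \<in> (\<lambda>a. a \<odot>\<^bsub>M\<^esub> x) ` carrier A"
      using x by (intro image_eqI[where x = "\<zero>"]) (auto simp: M.smult_zero_left)
  qed (use x in \<open>auto simp: M.smult_l_distr[symmetric] M.smult_assoc1[symmetric] M.smult_closed\<close>)
  show "x \<in> (\<lambda>a. a \<odot>\<^bsub>M\<^esub> x) ` carrier A"
    using x by (intro image_eqI[where x = "\<one>"]) (auto simp: M.smult_one)
qed

lemma left_module_restr:
  assumes "left_module A M" and U: "sub M U"
  shows "left_module A (restr M U)"
proof -
  interpret M: left_module A M by fact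
  have "abelian_group (restr M U)"
  proof (rule abelian_groupI)
    fix x assume "x \<in> carrier (restr M U)"
    then show "\<exists>y\<in>carrier (restr M U). y \<oplus>\<^bsub>restr M U\<^esub> x = \<zero>\<^bsub>restr M U\<^esub>"
      using subm_uminus[OF assms uminus_one_closed] subm_mem[OF U]
      by (intro bexI[of _ "\<ominus>\<^bsub>M\<^esub> x"]) (auto simp: M.l_neg)
  qed (use subm_mem[OF U] in \<open>auto intro: subm_add[OF U] subm_zero[OF U] simp: M.a_ac\<close>)
  then show ?thesis
    by (intro left_module.intro left_module_axioms.intro ring_axioms)
       (use subm_mem[OF U] in \<open>auto intro: subm_smult[OF U] simp: M.smult_l_distr M.smult_r_distr
          M.smult_assoc1 M.smult_one\<close>)
qed

text \<open>The Noetherian property. A maximal finitely generated submodule of \<open>U\<close>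
  exists by the chain bound; adding a cyclic submodule keeps it finitely generated, so it already
  contains every element of \<open>U\<close>.\<close>

lemma restr_mods:
  assumes M: "M \<in> mods" and U: "sub M U"
  shows "restr M U \<in> mods"
proof -
  interpret M: left_module A M using M by (rule modsD)
  note lm = left_module_restr[OF M.left_module_axioms]
  obtain n where n: "chain_bound {V. subm Z M V} n"
    using chain_bound_subspaces[OF modsD[OF M]] M by (auto simp: mod_cat_def)
  define \<T> where "\<T> = {V. sub M V \<and> V \<subseteq> U \<and> fin_gen A (restr M V)}"
  have "\<T> \<subseteq> {V. subm Z M V}" unfolding \<T>_def using sub_imp_subm_Z by blast
  moreover have "{\<zero>\<^bsub>M\<^esub>} \<in> \<T>"
    using sub_zero[OF M] subm_zero[OF U]
    by (auto simp: \<T>_def left_module.fin_gen_iff[OF lm] subm_def intro!: exI[of _ "{}"])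
  ultimately obtain V where "V \<in> \<T>" and maxT: "\<forall>W\<in>\<T>. V \<subseteq> W \<longrightarrow> W = V"
    using chain_bound_maximal[OF n] by blast
  then have V: "sub M V" "V \<subseteq> U" "fin_gen A (restr M V)" by (simp_all add: \<T>_def)
  have max: "W = V" if "sub M W" "W \<subseteq> U" "fin_gen A (restr M W)" "V \<subseteq> W" for W
    using maxT that by (simp add: \<T>_def)
  have "x \<in> V" if x: "x \<in> U" for x
  proof -
    have xM: "x \<in> carrier M" using U x by (rule subm_mem)
    note cyc = cyclic_sub[OF M xM]
    define C where "C = (\<lambda>a. a \<odot>\<^bsub>M\<^esub> x) ` carrier A"
    have C: "sub M C" "x \<in> C" "C \<subseteq> U"
      using cyc x U by (auto simp: C_def intro: subm_smult)
    define W where "W = ssum M V C"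
    note W = ssum_sub[OF M V(1) C(1), folded W_def]
    obtain S where S: "finite S" "S \<subseteq> V" "\<And>T. sub (restr M V) T \<Longrightarrow> S \<subseteq> T \<Longrightarrow> T = V"
      using V(3) left_module.fin_gen_iff[OF lm[OF V(1)]] by auto
    have "T = W" if T: "sub (restr M W) T" "insert x S \<subseteq> T" for T
    proof
      have T': "sub M T" "T \<subseteq> W" using T(1) sub_restr_iff[OF subm_subset[OF W(1)]] by auto
      have "V \<inter> T = V"
        using T T' S(2) sub_Int[OF V(1) T'(1)] by (intro S(3)) (auto simp: sub_restr_iff subm_subset[OF V(1)])
      moreover have "C \<subseteq> T" using T'(1) T(2) by (auto simp: C_def intro: subm_smult)
      ultimately show "W \<subseteq> T" unfolding W_def by (intro ssum_least[OF T'(1)]) auto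
    qed (use T in \<open>auto simp: subm_def\<close>)
    moreover have "finite (insert x S)" "insert x S \<subseteq> W" using S C W by auto
    ultimately have "fin_gen A (restr M W)"
      unfolding left_module.fin_gen_iff[OF lm[OF W(1)]] by (intro exI[of _ "insert x S"]) auto
    then have "W = V" using max W ssum_least[OF U V(2) C(3)] by (auto simp: W_def)
    then show "x \<in> V" using W(3) C(2) by blast
  qed
  then have "V = U" using V(2) by blast
  then show ?thesis using V lm[OF U] by (simp add: mod_cat_def)
qed

subsection \<open>Linear maps\<close>

lemma lin_zero: "M \<in> mods \<Longrightarrow> N \<in> mods \<Longrightarrow> lin M N g \<Longrightarrow> g \<zero>\<^bsub>M\<^esub> = \<zero>\<^bsub>N\<^esub>"
  by (intro linear_zero[of A M N] modsD)

lemma lin_minus: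
  assumes MN: "M \<in> mods" "N \<in> mods" and g: "lin M N g" and xy: "x \<in> carrier M" "y \<in> carrier M"
  shows "g (x \<ominus>\<^bsub>M\<^esub> y) = g x \<ominus>\<^bsub>N\<^esub> g y"
proof -
  interpret M: left_module A M using MN(1) by (rule modsD)
  interpret N: left_module A N using MN(2) by (rule modsD)
  show ?thesis
    using g xy by (simp add: a_minus_def M.smult_uminus_one[symmetric] N.smult_uminus_one[symmetric]
        linear_closed[OF g] linear_add[OF g] linear_smult[OF g] M.smult_closed)
qed

lemma lin_id: "lin M M (\<lambda>x. x)"
  by (auto simp: is_linear_def)

lemma lin_const_zero: "N \<in> mods \<Longrightarrow> lin M N (\<lambda>_. \<zero>\<^bsub>N\<^esub>)"
  by (auto simp: is_linear_def)

lemma lin_plus: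
  assumes N: "N \<in> mods" and f: "lin M N f" and g: "lin M N g"
  shows "lin M N (\<lambda>x. f x \<oplus>\<^bsub>N\<^esub> g x)"
proof -
  interpret N: left_module A N using N by (rule modsD)
  show ?thesis
    by (rule is_linearI)
       (simp_all add: linear_closed[OF f] linear_closed[OF g] linear_add[OF f] linear_add[OF g]
         linear_smult[OF f] linear_smult[OF g] N.smult_r_distr N.a_ac)
qed

lemma lin_scalar:
  assumes N: "N \<in> mods" and f: "lin M N f" and z: "z \<in> Z"
  shows "lin M N (\<lambda>x. z \<odot>\<^bsub>N\<^esub> f x)"
proof -
  interpret N: left_module A N using N by (rule modsD)
  show ?thesis
    by (rule is_linearI)
       (use z in \<open>simp_all add: linear_closed[OF f] linear_add[OF f] Z_carrier N.smult_closed
         linear_smult[OF f] N.smult_r_distr N.smult_assoc1[symmetric] Z_central\<close>)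
qed

lemma lin_cong:
  "lin M N f \<Longrightarrow> M \<in> mods \<Longrightarrow> (\<And>x. x \<in> carrier M \<Longrightarrow> g x = f x) \<Longrightarrow> lin M N g"
  by (auto simp: is_linear_def Pi_iff)

lemma lin_diff:
  assumes M: "M \<in> mods" and N: "N \<in> mods" and f: "lin M N f" and g: "lin M N g"
  shows "lin M N (\<lambda>x. f x \<ominus>\<^bsub>N\<^esub> g x)"
proof -
  interpret N: left_module A N using N by (rule modsD)
  have "lin M N (\<lambda>x. f x \<oplus>\<^bsub>N\<^esub> (\<ominus> \<one>) \<odot>\<^bsub>N\<^esub> g x)"
    by (intro lin_plus N f lin_scalar g Z_uminus Z_one)
  then show ?thesis
    by (rule lin_cong[OF _ M]) (simp add: a_minus_def N.smult_uminus_one linear_closed[OF g])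
qed

lemma lin_restr: "lin M N g \<Longrightarrow> U \<subseteq> carrier M \<Longrightarrow> lin (restr M U) N g"
  by (auto simp: is_linear_def Pi_iff subset_iff)

lemma lin_into: "lin M N g \<Longrightarrow> g ` carrier M \<subseteq> V \<Longrightarrow> lin M (restr N V) g"
  by (auto simp: is_linear_def)

lemma lin_incl: "U \<subseteq> carrier M \<Longrightarrow> lin (restr M U) M (\<lambda>x. x)"
  by (auto simp: is_linear_def)

lemma sub_image:
  assumes MN: "M \<in> mods" "N \<in> mods" and g: "lin M N g" and U: "sub M U"
  shows "sub N (g ` U)"
proof (rule submI)
  show "\<zero>\<^bsub>N\<^esub> \<in> g ` U" using lin_zero[OF MN g] subm_zero[OF U] by (metis image_eqI)
qed (use U subm_mem[OF U] in \<open>auto simp: linear_closed[OF g] linear_add[OF g, symmetric]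
    linear_smult[OF g, symmetric] intro: subm_add subm_smult\<close>)

lemma sub_range: "M \<in> mods \<Longrightarrow> N \<in> mods \<Longrightarrow> lin M N g \<Longrightarrow> sub N (g ` carrier M)"
  by (rule sub_image[OF _ _ _ sub_carrier])

lemma sub_vimage:
  assumes MN: "M \<in> mods" "N \<in> mods" and g: "lin M N g" and V: "sub N V"
  shows "sub M {x \<in> carrier M. g x \<in> V}"
  using MN V lin_zero[OF MN g]
  by (intro submI) (auto simp: linear_add[OF g] linear_smult[OF g] intro: subm_add subm_smult subm_zero)

lemma sub_kernel:
  assumes MN: "M \<in> mods" "N \<in> mods" and g: "lin M N g"
  shows "sub M (a_kernel M N g)"
proof -
  have "a_kernel M N g = {x \<in> carrier M. g x \<in> {\<zero>\<^bsub>N\<^esub>}}" by auto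
  then show ?thesis using sub_vimage[OF MN g sub_zero[OF MN(2)]] by simp
qed

text \<open>The factor is \<open>t\<close> after a set-theoretic section of \<open>s\<close>. Since
  \<open>s\<close> may be any surjection, this serves for maps out of quotients and also, with
  \<open>t\<close> the identity, for inverting bijections.\<close>

lemma lin_factor:
  assumes L: "L \<in> mods" and M: "M \<in> mods" and N: "N \<in> mods"
    and s: "lin L M s" "s ` carrier L = carrier M" and t: "lin L N t"
    and ker: "\<And>x. x \<in> carrier L \<Longrightarrow> s x = \<zero>\<^bsub>M\<^esub> \<Longrightarrow> t x = \<zero>\<^bsub>N\<^esub>"
  shows "\<exists>h. lin M N h \<and> (\<forall>x\<in>carrier L. h (s x) = t x)"
proof -
  define r where "r y = (SOME x. x \<in> carrier L \<and> s x = y)" for y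
  have r: "r y \<in> carrier L \<and> s (r y) = y" if "y \<in> carrier M" for y
    unfolding r_def by (rule someI_ex) (use that in \<open>auto simp: s(2)[symmetric]\<close>)
  have eq: "t x = t y" if xy: "x \<in> carrier L" "y \<in> carrier L" "s x = s y" for x y
  proof -
    have "s (x \<ominus>\<^bsub>L\<^esub> y) = \<zero>\<^bsub>M\<^esub>"
      using xy L M by (simp add: lin_minus[OF L M s(1)] linear_closed[OF s(1)])
    then have "t (x \<ominus>\<^bsub>L\<^esub> y) = \<zero>\<^bsub>N\<^esub>" using ker xy L by simp
    then show ?thesis
      using xy L N by (simp add: lin_minus[OF L N t] linear_closed[OF t] mods_diff_eq_zero)
  qed
  have h: "t (r (s x)) = t x" if "x \<in> carrier L" for x
    using r[OF linear_closed[OF s(1) that]] that by (intro eq) simp_all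
  have "lin M N (\<lambda>y. t (r y))"
  proof (rule is_linearI)
    fix x y assume xy: "x \<in> carrier M" "y \<in> carrier M"
    then have "t (r (x \<oplus>\<^bsub>M\<^esub> y)) = t (r x \<oplus>\<^bsub>L\<^esub> r y)"
      using h[of "r x \<oplus>\<^bsub>L\<^esub> r y"] r[of x] r[of y] L by (simp add: linear_add[OF s(1)])
    then show "t (r (x \<oplus>\<^bsub>M\<^esub> y)) = t (r x) \<oplus>\<^bsub>N\<^esub> t (r y)"
      using r xy by (simp add: linear_add[OF t])
  next
    fix a x assume ax: "a \<in> carrier A" "x \<in> carrier M"
    then have "t (r (a \<odot>\<^bsub>M\<^esub> x)) = t (a \<odot>\<^bsub>L\<^esub> r x)"
      using h[of "a \<odot>\<^bsub>L\<^esub> r x"] r[of x] L by (simp add: linear_smult[OF s(1)])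
    then show "t (r (a \<odot>\<^bsub>M\<^esub> x)) = a \<odot>\<^bsub>N\<^esub> t (r x)"
      using r ax by (simp add: linear_smult[OF t])
  qed (use r in \<open>simp add: linear_closed[OF t]\<close>)
  with h show ?thesis by blast
qed

subsection \<open>Quotients\<close>

lemma prj_props:
  assumes M: "M \<in> mods" and U: "sub M U" and x: "x \<in> carrier M"
  shows "prj M U x \<in> carrier M" and "x \<ominus>\<^bsub>M\<^esub> prj M U x \<in> U"
proof -
  have "\<exists>y. y \<in> carrier M \<and> x \<ominus>\<^bsub>M\<^esub> y \<in> U"
    using x M subm_zero[OF U] by (intro exI[of _ x]) simp
  from someI_ex[OF this] show "prj M U x \<in> carrier M" and "x \<ominus>\<^bsub>M\<^esub> prj M U x \<in> U"
    by (auto simp: prj_def)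
qed

text \<open>Congruent elements give the same predicate under \<open>SOME\<close>, hence literally
  the same representative.\<close>

lemma prj_eq_iff:
  assumes M: "M \<in> mods" and U: "sub M U" and x: "x \<in> carrier M" and y: "y \<in> carrier M"
  shows "prj M U x = prj M U y \<longleftrightarrow> x \<ominus>\<^bsub>M\<^esub> y \<in> U"
proof -
  interpret M: left_module A M using M by (rule modsD)
  have diff: "(v \<ominus>\<^bsub>M\<^esub> w) \<ominus>\<^bsub>M\<^esub> (u \<ominus>\<^bsub>M\<^esub> w) = v \<ominus>\<^bsub>M\<^esub> u"
    if "v \<in> carrier M" "w \<in> carrier M" "u \<in> carrier M" for u v w
    using that M.r_neg2[of w "\<ominus>\<^bsub>M\<^esub> u"] by (simp add: a_minus_def M.minus_add M.a_ac)
  have sum: "(v \<ominus>\<^bsub>M\<^esub> w) \<oplus>\<^bsub>M\<^esub> (w \<ominus>\<^bsub>M\<^esub> u) = v \<ominus>\<^bsub>M\<^esub> u"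
    if "v \<in> carrier M" "w \<in> carrier M" "u \<in> carrier M" for u v w
    using that M.r_neg1[of w] by (simp add: a_minus_def M.a_assoc M.r_neg2)
  show ?thesis
  proof
    assume "prj M U x = prj M U y"
    then show "x \<ominus>\<^bsub>M\<^esub> y \<in> U"
      using diff[OF x prj_props(1)[OF M U x] y]
        sub_minus[OF M U prj_props(2)[OF M U x] prj_props(2)[OF M U y]] by simp
  next
    assume xy: "x \<ominus>\<^bsub>M\<^esub> y \<in> U"
    then have yx: "y \<ominus>\<^bsub>M\<^esub> x \<in> U"
      using diff[OF y y x] sub_minus[OF M U subm_zero[OF U] xy] y M by simp
    have "w \<in> carrier M \<and> x \<ominus>\<^bsub>M\<^esub> w \<in> U \<longleftrightarrow> w \<in> carrier M \<and> y \<ominus>\<^bsub>M\<^esub> w \<in> U" for w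
      using sum[of x y w] sum[of y x w] subm_add[OF U] xy yx x y by metis
    then show "prj M U x = prj M U y" by (simp add: prj_def)
  qed
qed

lemma quo_props:
  assumes M: "M \<in> mods" and U: "sub M U"
  shows quo_mods: "quo M U \<in> mods" and lin_prj: "lin M (quo M U) (prj M U)"
    and prj_surj: "prj M U ` carrier M = carrier (quo M U)"
    and prj_eq_zero: "x \<in> carrier M \<Longrightarrow> prj M U x = \<zero>\<^bsub>quo M U\<^esub> \<longleftrightarrow> x \<in> U"
proof -
  interpret M: left_module A M using M by (rule modsD)
  note cl = prj_props(1)[OF M U]
  show surj: "prj M U ` carrier M = carrier (quo M U)" by (simp add: quo_def)
  have padd: "prj M U (x \<oplus>\<^bsub>M\<^esub> y) = prj M U x \<oplus>\<^bsub>quo M U\<^esub> prj M U y"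
    if xy: "x \<in> carrier M" "y \<in> carrier M" for x y
  proof -
    have "(x \<oplus>\<^bsub>M\<^esub> y) \<ominus>\<^bsub>M\<^esub> (prj M U x \<oplus>\<^bsub>M\<^esub> prj M U y) =
        (x \<ominus>\<^bsub>M\<^esub> prj M U x) \<oplus>\<^bsub>M\<^esub> (y \<ominus>\<^bsub>M\<^esub> prj M U y)"
      using xy cl by (simp add: a_minus_def M.minus_add M.a_ac)
    also have "\<dots> \<in> U" using prj_props(2)[OF M U] xy by (intro subm_add[OF U])
    finally show ?thesis using xy cl M by (simp add: quo_def prj_eq_iff[OF M U])
  qed
  have psmult: "prj M U (a \<odot>\<^bsub>M\<^esub> x) = a \<odot>\<^bsub>quo M U\<^esub> prj M U x"
    if ax: "a \<in> carrier A" "x \<in> carrier M" for a x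
  proof -
    have "a \<odot>\<^bsub>M\<^esub> x \<ominus>\<^bsub>M\<^esub> a \<odot>\<^bsub>M\<^esub> prj M U x = a \<odot>\<^bsub>M\<^esub> (x \<ominus>\<^bsub>M\<^esub> prj M U x)"
      using ax cl M by (simp add: mods_smult_minus)
    also have "\<dots> \<in> U" using prj_props(2)[OF M U] ax by (intro subm_smult[OF U])
    finally show ?thesis using ax cl M by (simp add: quo_def prj_eq_iff[OF M U])
  qed
  show lin: "lin M (quo M U) (prj M U)"
    by (rule is_linearI) (use surj padd psmult in auto)
  have "left_module A (quo M U)"
    by (rule left_module_image[OF M.left_module_axioms surj])
       (use padd psmult in \<open>auto simp: quo_def\<close>)
  moreover from fin_gen_surj[OF M.left_module_axioms this _ lin surj]
  have "fin_gen A (quo M U)" using M by (simp add: mod_cat_def)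
  ultimately show "quo M U \<in> mods" by (simp add: mod_cat_def)
  show "prj M U x = \<zero>\<^bsub>quo M U\<^esub> \<longleftrightarrow> x \<in> U" if "x \<in> carrier M"
    using prj_eq_iff[OF M U that, of "\<zero>\<^bsub>M\<^esub>"] mods_diff_add[OF M that, of "\<zero>\<^bsub>M\<^esub>"] that M
    by (simp add: quo_def)
qed

subsection \<open>Direct sums and free modules\<close>

lemma dsum_module:
  assumes M: "M \<in> mods" and N: "N \<in> mods"
  shows "left_module A (dsum M N)" and "fin_gen A (dsum M N)"
proof -
  interpret M: left_module A M using M by (rule modsD)
  interpret N: left_module A N using N by (rule modsD)
  have "abelian_group (dsum M N)"
  proof (rule abelian_groupI)
    fix d assume "d \<in> carrier (dsum M N)"
    then show "\<exists>e\<in>carrier (dsum M N). e \<oplus>\<^bsub>dsum M N\<^esub> d = \<zero>\<^bsub>dsum M N\<^esub>"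
      by (intro bexI[of _ "(\<ominus>\<^bsub>M\<^esub> fst d, \<ominus>\<^bsub>N\<^esub> snd d)"]) (auto simp: M.l_neg N.l_neg)
  qed (auto simp: M.a_ac N.a_ac)
  then show D: "left_module A (dsum M N)"
    by (intro left_module.intro left_module_axioms.intro ring_axioms)
       (auto simp: M.smult_l_distr M.smult_r_distr M.smult_assoc1 M.smult_one M.smult_closed
          N.smult_l_distr N.smult_r_distr N.smult_assoc1 N.smult_one N.smult_closed)
  obtain S where S: "finite S" "S \<subseteq> carrier M" "\<And>U. sub M U \<Longrightarrow> S \<subseteq> U \<Longrightarrow> U = carrier M"
    using M M.fin_gen_iff by (auto simp: mod_cat_def)
  obtain T where T: "finite T" "T \<subseteq> carrier N" "\<And>U. sub N U \<Longrightarrow> T \<subseteq> U \<Longrightarrow> U = carrier N"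
    using N N.fin_gen_iff by (auto simp: mod_cat_def)
  let ?G = "(\<lambda>x. (x, \<zero>\<^bsub>N\<^esub>)) ` S \<union> (\<lambda>y. (\<zero>\<^bsub>M\<^esub>, y)) ` T"
  have "U = carrier (dsum M N)" if U: "sub (dsum M N) U" "?G \<subseteq> U" for U
  proof
    show "carrier (dsum M N) \<subseteq> U"
    proof
      fix d assume d: "d \<in> carrier (dsum M N)"
      note add = subm_add[OF U(1)] and sm = subm_smult[OF U(1)] and z = subm_zero[OF U(1)]
      have "{x \<in> carrier M. (x, \<zero>\<^bsub>N\<^esub>) \<in> U} = carrier M"
      proof (intro S(3) submI)
        fix x y assume "x \<in> {x \<in> carrier M. (x, \<zero>\<^bsub>N\<^esub>) \<in> U}" "y \<in> {x \<in> carrier M. (x, \<zero>\<^bsub>N\<^esub>) \<in> U}"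
        then show "x \<oplus>\<^bsub>M\<^esub> y \<in> {x \<in> carrier M. (x, \<zero>\<^bsub>N\<^esub>) \<in> U}"
          using add[of "(x, \<zero>\<^bsub>N\<^esub>)" "(y, \<zero>\<^bsub>N\<^esub>)"] by simp
      next
        fix a x assume "a \<in> carrier A" "x \<in> {x \<in> carrier M. (x, \<zero>\<^bsub>N\<^esub>) \<in> U}"
        then show "a \<odot>\<^bsub>M\<^esub> x \<in> {x \<in> carrier M. (x, \<zero>\<^bsub>N\<^esub>) \<in> U}"
          using sm[of a "(x, \<zero>\<^bsub>N\<^esub>)"] M N by simp
      qed (use z S(2) U(2) in auto)
      moreover have "{y \<in> carrier N. (\<zero>\<^bsub>M\<^esub>, y) \<in> U} = carrier N"
      proof (intro T(3) submI)
        fix x y assume "x \<in> {y \<in> carrier N. (\<zero>\<^bsub>M\<^esub>, y) \<in> U}" "y \<in> {y \<in> carrier N. (\<zero>\<^bsub>M\<^esub>, y) \<in> U}"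
        then show "x \<oplus>\<^bsub>N\<^esub> y \<in> {y \<in> carrier N. (\<zero>\<^bsub>M\<^esub>, y) \<in> U}"
          using add[of "(\<zero>\<^bsub>M\<^esub>, x)" "(\<zero>\<^bsub>M\<^esub>, y)"] by simp
      next
        fix a x assume "a \<in> carrier A" "x \<in> {y \<in> carrier N. (\<zero>\<^bsub>M\<^esub>, y) \<in> U}"
        then show "a \<odot>\<^bsub>N\<^esub> x \<in> {y \<in> carrier N. (\<zero>\<^bsub>M\<^esub>, y) \<in> U}"
          using sm[of a "(\<zero>\<^bsub>M\<^esub>, x)"] M N by simp
      qed (use z T(2) U(2) in auto)
      ultimately have "(fst d, \<zero>\<^bsub>N\<^esub>) \<in> U" "(\<zero>\<^bsub>M\<^esub>, snd d) \<in> U" using d by auto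
      from add[OF this] show "d \<in> U" using d by auto
    qed
  qed (use U in \<open>auto simp: subm_def\<close>)
  then show "fin_gen A (dsum M N)"
    unfolding left_module.fin_gen_iff[OF D] using S T by (intro exI[of _ ?G]) auto
qed

definition is_biproduct ::
  "('a, 'm) module \<Rightarrow> ('a, 'm) module \<Rightarrow> ('a, 'm) module \<Rightarrow> ('m \<Rightarrow> 'm) \<Rightarrow> ('m \<Rightarrow> 'm) \<Rightarrow>
   ('m \<Rightarrow> 'm \<Rightarrow> 'm) \<Rightarrow> bool" where
  "is_biproduct M N D f g p \<longleftrightarrow> lin D M f \<and> lin D N g \<and>
    (\<forall>x\<in>carrier M. \<forall>y\<in>carrier N. p x y \<in> carrier D \<and> f (p x y) = x \<and> g (p x y) = y) \<and>
    (\<forall>d\<in>carrier D. p (f d) (g d) = d)"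

lemma biproduct_exists:
  assumes M: "M \<in> mods" and N: "N \<in> mods"
  shows "\<exists>D. D \<in> mods \<and> (\<exists>f g p. is_biproduct M N D f g p)"
proof -
  note D = dsum_module[OF M N]
  obtain L where L: "L \<in> mods" "module_iso A (dsum M N) L"
    using fg_module_iso_mod[OF D] by blast
  then obtain h where h: "lin (dsum M N) L h" "bij_betw h (carrier M \<times> carrier N) (carrier L)"
    by (auto simp: module_iso_def Hom_iff)
  define r where "r = inv_into (carrier M \<times> carrier N) h"
  have r: "r d \<in> carrier M \<times> carrier N" "h (r d) = d" if "d \<in> carrier L" for d
    using that h(2) unfolding r_def by (auto simp: bij_betw_def inv_into_into f_inv_into_f)
  have rh: "r (h e) = e" if "e \<in> carrier M \<times> carrier N" for e
    using that h(2) unfolding r_def by (auto simp: bij_betw_def)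
  have radd: "r (d \<oplus>\<^bsub>L\<^esub> e) = r d \<oplus>\<^bsub>dsum M N\<^esub> r e" if "d \<in> carrier L" "e \<in> carrier L" for d e
    using rh[of "r d \<oplus>\<^bsub>dsum M N\<^esub> r e"] r[OF that(1)] r[OF that(2)] linear_add[OF h(1), of "r d" "r e"] M N
    by (auto simp: mem_Times_iff)
  have rsm: "r (a \<odot>\<^bsub>L\<^esub> d) = a \<odot>\<^bsub>dsum M N\<^esub> r d" if "a \<in> carrier A" "d \<in> carrier L" for a d
    using rh[of "a \<odot>\<^bsub>dsum M N\<^esub> r d"] r[OF that(2)] linear_smult[OF h(1) that(1), of "r d"] M N that(1)
    by (auto simp: mem_Times_iff)
  have "lin L M (\<lambda>d. fst (r d))" "lin L N (\<lambda>d. snd (r d))"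
    using r by (auto intro!: is_linearI simp: radd rsm mem_Times_iff)
  moreover have "\<forall>x\<in>carrier M. \<forall>y\<in>carrier N.
      h (x, y) \<in> carrier L \<and> fst (r (h (x, y))) = x \<and> snd (r (h (x, y))) = y"
    using linear_closed[OF h(1)] by (auto simp: rh)
  moreover have "\<forall>d\<in>carrier L. h (fst (r d), snd (r d)) = d"
    using r by auto
  ultimately have "is_biproduct M N L (\<lambda>d. fst (r d)) (\<lambda>d. snd (r d)) (\<lambda>x y. h (x, y))"
    by (simp add: is_biproduct_def)
  with L(1) show ?thesis by blast
qed

text \<open>Pairs leave the type \<open>'a list\<close>, so a copy of the direct sum inside
  \<open>mod_cat\<close> is fixed by choice, together with its projections and its pairing map. The
  injections are pairings with zero.\<close>

definition bip :: "('a, 'a list) module \<Rightarrow> ('a, 'a list) module \<Rightarrow> ('a, 'a list) module" where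
  "bip M N = (SOME D. D \<in> mods \<and> (\<exists>f g p. is_biproduct M N D f g p))"
definition fst_bip :: "('a, 'a list) module \<Rightarrow> ('a, 'a list) module \<Rightarrow> 'a list \<Rightarrow> 'a list" where
  "fst_bip M N = (SOME f. \<exists>g p. is_biproduct M N (bip M N) f g p)"
definition snd_bip :: "('a, 'a list) module \<Rightarrow> ('a, 'a list) module \<Rightarrow> 'a list \<Rightarrow> 'a list" where
  "snd_bip M N = (SOME g. \<exists>p. is_biproduct M N (bip M N) (fst_bip M N) g p)"
definition pair :: "('a, 'a list) module \<Rightarrow> ('a, 'a list) module \<Rightarrow> 'a list \<Rightarrow> 'a list \<Rightarrow> 'a list" where
  "pair M N = (SOME p. is_biproduct M N (bip M N) (fst_bip M N) (snd_bip M N) p)"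

lemma bip_props:
  assumes "M \<in> mods" and "N \<in> mods"
  shows bip_mods: "bip M N \<in> mods"
    and lin_fst: "lin (bip M N) M (fst_bip M N)" and lin_snd: "lin (bip M N) N (snd_bip M N)"
    and pair_closed:
      "x \<in> carrier M \<Longrightarrow> y \<in> carrier N \<Longrightarrow> pair M N x y \<in> carrier (bip M N)"
    and fst_pair: "x \<in> carrier M \<Longrightarrow> y \<in> carrier N \<Longrightarrow> fst_bip M N (pair M N x y) = x"
    and snd_pair: "x \<in> carrier M \<Longrightarrow> y \<in> carrier N \<Longrightarrow> snd_bip M N (pair M N x y) = y"
    and pair_fst_snd: "d \<in> carrier (bip M N) \<Longrightarrow> pair M N (fst_bip M N d) (snd_bip M N d) = d"
proof -
  have D: "bip M N \<in> mods \<and> (\<exists>f g p. is_biproduct M N (bip M N) f g p)"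
    unfolding bip_def by (rule someI_ex[OF biproduct_exists[OF assms]])
  note f = someI_ex[OF conjunct2[OF D], folded fst_bip_def]
  note g = someI_ex[OF f, folded snd_bip_def]
  note p = someI_ex[OF g, folded pair_def]
  note ** = conjunct1[OF D] p[unfolded is_biproduct_def]
  show "bip M N \<in> mods" "lin (bip M N) M (fst_bip M N)" "lin (bip M N) N (snd_bip M N)"
    using ** by simp_all
  show "x \<in> carrier M \<Longrightarrow> y \<in> carrier N \<Longrightarrow> pair M N x y \<in> carrier (bip M N)"
    "x \<in> carrier M \<Longrightarrow> y \<in> carrier N \<Longrightarrow> fst_bip M N (pair M N x y) = x"
    "x \<in> carrier M \<Longrightarrow> y \<in> carrier N \<Longrightarrow> snd_bip M N (pair M N x y) = y"
    "d \<in> carrier (bip M N) \<Longrightarrow> pair M N (fst_bip M N d) (snd_bip M N d) = d"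
    using ** by simp_all
qed

lemma bip_eqI:
  assumes MN: "M \<in> mods" "N \<in> mods" and "d \<in> carrier (bip M N)" "e \<in> carrier (bip M N)"
    and "fst_bip M N d = fst_bip M N e" "snd_bip M N d = snd_bip M N e"
  shows "d = e"
proof -
  have "d = pair M N (fst_bip M N d) (snd_bip M N d)" by (rule pair_fst_snd[OF MN assms(3), symmetric])
  also have "\<dots> = pair M N (fst_bip M N e) (snd_bip M N e)" by (simp only: assms(5,6))
  also have "\<dots> = e" by (rule pair_fst_snd[OF MN assms(4)])
  finally show ?thesis .
qed

lemma lin_pair:
  assumes MN: "M \<in> mods" "N \<in> mods" and L: "L \<in> mods" and f: "lin L M f" and g: "lin L N g"
  shows "lin L (bip M N) (\<lambda>x. pair M N (f x) (g x))"
proof -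
  note [simp] = linear_closed[OF f] linear_closed[OF g] pair_closed[OF MN] fst_pair[OF MN] snd_pair[OF MN]
    bip_mods[OF MN] L MN
  show ?thesis
  proof (rule is_linearI)
    fix x y assume "x \<in> carrier L" "y \<in> carrier L"
    then show "pair M N (f (x \<oplus>\<^bsub>L\<^esub> y)) (g (x \<oplus>\<^bsub>L\<^esub> y)) = pair M N (f x) (g x) \<oplus>\<^bsub>bip M N\<^esub> pair M N (f y) (g y)"
      by - (rule bip_eqI[OF MN], simp_all add: linear_add[OF f] linear_add[OF g]
        linear_add[OF lin_fst[OF MN]] linear_add[OF lin_snd[OF MN]])
  next
    fix a x assume "a \<in> carrier A" "x \<in> carrier L"
    then show "pair M N (f (a \<odot>\<^bsub>L\<^esub> x)) (g (a \<odot>\<^bsub>L\<^esub> x)) = a \<odot>\<^bsub>bip M N\<^esub> pair M N (f x) (g x)"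
      by - (rule bip_eqI[OF MN], simp_all add: linear_smult[OF f] linear_smult[OF g]
        linear_smult[OF lin_fst[OF MN]] linear_smult[OF lin_snd[OF MN]])
  qed simp
qed

lemma lin_inl: "M \<in> mods \<Longrightarrow> N \<in> mods \<Longrightarrow> lin M (bip M N) (\<lambda>x. pair M N x \<zero>\<^bsub>N\<^esub>)"
  and lin_inr: "M \<in> mods \<Longrightarrow> N \<in> mods \<Longrightarrow> lin N (bip M N) (\<lambda>y. pair M N \<zero>\<^bsub>M\<^esub> y)"
  by (intro lin_pair lin_id lin_const_zero; assumption)+

lemma lin_copair:
  assumes MN: "M \<in> mods" "N \<in> mods" and L: "L \<in> mods" and f: "lin M L f" and g: "lin N L g"
  shows "lin (bip M N) L (\<lambda>d. f (fst_bip M N d) \<oplus>\<^bsub>L\<^esub> g (snd_bip M N d))"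
  by (intro lin_plus L linear_comp[OF lin_fst[OF MN] f] linear_comp[OF lin_snd[OF MN] g])

lemma bip_split:
  assumes MN: "M \<in> mods" "N \<in> mods" and d: "d \<in> carrier (bip M N)"
  shows "pair M N (fst_bip M N d) \<zero>\<^bsub>N\<^esub> \<oplus>\<^bsub>bip M N\<^esub> pair M N \<zero>\<^bsub>M\<^esub> (snd_bip M N d) = d"
proof -
  note [simp] = linear_closed[OF lin_fst[OF MN] d] linear_closed[OF lin_snd[OF MN] d]
    pair_closed[OF MN] fst_pair[OF MN] snd_pair[OF MN] bip_mods[OF MN] MN d
  show ?thesis
    by (rule bip_eqI[OF MN])
       (simp_all add: linear_add[OF lin_fst[OF MN]] linear_add[OF lin_snd[OF MN]])
qed

text \<open>A copy of the regular module, with \<open>u\<close> the image of \<open>\<one>\<close>.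
  Its freeness identifies elements of a module with maps from it, which links universal elements to
  approximations.\<close>

lemma free_module_exists:
  "\<exists>M\<in>mods. \<exists>u\<in>carrier M. (\<forall>U. sub M U \<longrightarrow> u \<in> U \<longrightarrow> U = carrier M) \<and>
     (\<forall>N\<in>mods. \<forall>y\<in>carrier N. \<exists>h. lin M N h \<and> h u = y)"
proof -
  have R: "left_module A (reg A)"
  proof (intro left_module.intro left_module_axioms.intro ring_axioms)
    show "abelian_group (reg A)"
    proof (rule abelian_groupI)
      fix x assume "x \<in> carrier (reg A)"
      then show "\<exists>y\<in>carrier (reg A). y \<oplus>\<^bsub>reg A\<^esub> x = \<zero>\<^bsub>reg A\<^esub>"
        by (intro bexI[of _ "\<ominus> x"]) (auto simp: l_neg)
    qed (auto simp: a_ac)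
  qed (auto simp: l_distr r_distr m_assoc)
  have "U = carrier A" if U: "sub (reg A) U" "{\<one>} \<subseteq> U" for U
    using subm_smult[OF U(1), of _ "\<one>"] U subm_subset[OF U(1)] by auto
  then have "fin_gen A (reg A)"
    unfolding left_module.fin_gen_iff[OF R] by (intro exI[of _ "{\<one>}"]) auto
  then obtain M where M: "M \<in> mods" "module_iso A (reg A) M"
    using fg_module_iso_mod[OF R] by blast
  then obtain g where g: "lin (reg A) M g" "bij_betw g (carrier A) (carrier M)"
    by (auto simp: module_iso_def Hom_iff)
  have "\<exists>h. lin M N h \<and> h (g \<one>) = y" if N: "N \<in> mods" and y: "y \<in> carrier N" for N y
  proof -
    interpret N: left_module A N using N by (rule modsD)
    define r where "r = inv_into (carrier A) g"
    have r: "r x \<in> carrier A" "g (r x) = x" if "x \<in> carrier M" for x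
      using that g(2) unfolding r_def by (auto simp: bij_betw_def inv_into_into f_inv_into_f)
    have rg: "r (g a) = a" if "a \<in> carrier A" for a
      using that g(2) unfolding r_def by (auto simp: bij_betw_def)
    have radd: "r (x \<oplus>\<^bsub>M\<^esub> x') = r x \<oplus> r x'" if "x \<in> carrier M" "x' \<in> carrier M" for x x'
      using rg[of "r x \<oplus> r x'"] r[OF that(1)] r[OF that(2)] linear_add[OF g(1), of "r x" "r x'"] by simp
    have rsm: "r (a \<odot>\<^bsub>M\<^esub> x) = a \<otimes> r x" if "a \<in> carrier A" "x \<in> carrier M" for a x
      using rg[of "a \<otimes> r x"] r[OF that(2)] linear_smult[OF g(1) that(1), of "r x"] that(1) by simp
    have "lin M N (\<lambda>x. r x \<odot>\<^bsub>N\<^esub> y)"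
      by (rule is_linearI) (use r y N in \<open>simp_all add: radd rsm N.smult_l_distr N.smult_assoc1\<close>)
    then show ?thesis
      by (intro exI[of _ "\<lambda>x. r x \<odot>\<^bsub>N\<^esub> y"]) (use y in \<open>simp add: rg N.smult_one\<close>)
  qed
  moreover have "U = carrier M" if U: "sub M U" "g \<one> \<in> U" for U
  proof
    show "carrier M \<subseteq> U"
    proof
      fix x assume "x \<in> carrier M"
      then obtain a where a: "a \<in> carrier A" "x = g a" using g(2) unfolding bij_betw_def by blast
      then have "x = a \<odot>\<^bsub>M\<^esub> g \<one>" using linear_smult[OF g(1), of a "\<one>"] by simp
      then show "x \<in> U" using subm_smult[OF U(1) a(1) U(2)] by simp
    qed
  qed (rule subm_subset[OF U(1)])
  ultimately show ?thesis using M(1) linear_closed[OF g(1), of "\<one>"]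
    by (intro bexI[of _ M] bexI[of _ "g \<one>"]) simp_all
qed

subsection \<open>Length\<close>

lemma len_chain_bound:
  assumes "M \<in> mods"
  shows "chain_bound {U. sub M U} (len A M)"
proof -
  obtain n where "chain_bound {V. subm Z M V} n"
    using chain_bound_subspaces[OF modsD[OF assms]] assms by (auto simp: mod_cat_def)
  then have "chain_bound {U. sub M U} n"
    by (rule chain_bound_antimono) (use sub_imp_subm_Z in blast)
  then show ?thesis unfolding len_def by (rule LeastI[of "\<lambda>n. chain_bound {U. sub M U} n"])
qed

lemma len_restr_less:
  assumes M: "M \<in> mods" and U: "sub M U" "U \<noteq> carrier M"
  shows "len A (restr M U) < len A M"
proof -
  obtain m where m: "\<And>V. V \<in> {U. sub M U} \<Longrightarrow> m V \<le> len A M"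
    "\<And>V W. V \<in> {U. sub M U} \<Longrightarrow> W \<in> {U. sub M U} \<Longrightarrow> V \<subset> W \<Longrightarrow> m V < m W"
    using chain_boundE[OF len_chain_bound[OF M]] by blast
  note m = m[unfolded mem_Collect_eq]
  have "U \<subset> carrier M" using U(2) subm_subset[OF U(1)] by blast
  then have *: "m U < len A M"
    using m(1)[of "carrier M"] m(2)[of U "carrier M"] U(1) sub_carrier[OF M] by simp
  have "chain_bound {V. sub (restr M U) V} (m U)"
  proof (rule chain_boundI[of _ m])
    fix V assume "V \<in> {V. sub (restr M U) V}"
    then have "sub M V" "V \<subseteq> U" by (auto simp: sub_restr_iff[OF subm_subset[OF U(1)]])
    then show "m V \<le> m U" using m(2)[of V U] U(1) by (cases "V = U") (simp_all add: psubset_eq less_imp_le)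
  next
    fix V W assume "V \<in> {V. sub (restr M U) V}" "W \<in> {V. sub (restr M U) V}" "V \<subset> W"
    then show "m V < m W" using m(2)[of V W] by (auto simp: sub_restr_iff[OF subm_subset[OF U(1)]])
  qed
  then have "len A (restr M U) \<le> m U"
    unfolding len_def by (rule Least_le[of "\<lambda>n. chain_bound {V. sub (restr M U) V} n"])
  with * show ?thesis by simp
qed

text \<open>A submodule of \<open>N\<close> gets the rank of its preimage minus one. This is
  harmless because every preimage contains the nonzero \<open>x\<close>, so its rank is positive.
  The consequence used later is that a surjective endomorphism is injective.\<close>

lemma len_quotient_less:
  assumes M: "M \<in> mods" and N: "N \<in> mods" and p: "lin M N p" "p ` carrier M = carrier N"
    and x: "x \<in> carrier M" "p x = \<zero>\<^bsub>N\<^esub>" "x \<noteq> \<zero>\<^bsub>M\<^esub>"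
  shows "len A N < len A M"
proof -
  obtain m where m: "\<And>V. V \<in> {U. sub M U} \<Longrightarrow> m V \<le> len A M"
    "\<And>V W. V \<in> {U. sub M U} \<Longrightarrow> W \<in> {U. sub M U} \<Longrightarrow> V \<subset> W \<Longrightarrow> m V < m W"
    using chain_boundE[OF len_chain_bound[OF M]] by blast
  note m = m[unfolded mem_Collect_eq]
  let ?v = "\<lambda>V. {x \<in> carrier M. p x \<in> V}"
  have v: "sub M (?v V)" if "sub N V" for V using sub_vimage[OF M N p(1) that] .
  have pos: "0 < m (?v V)" if V: "sub N V" for V
  proof -
    have "\<zero>\<^bsub>M\<^esub> \<in> ?v V" "x \<in> ?v V"
      using x subm_zero[OF V] lin_zero[OF M N p(1)] M by simp_all
    then have "{\<zero>\<^bsub>M\<^esub>} \<subset> ?v V" using x(3) by blast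
    then show ?thesis using m(2)[of "{\<zero>\<^bsub>M\<^esub>}" "?v V"] v[OF V] sub_zero[OF M] by auto
  qed
  have "chain_bound {V. sub N V} (len A M - 1)"
  proof (rule chain_boundI[of _ "\<lambda>V. m (?v V) - 1"])
    fix V assume "V \<in> {V. sub N V}"
    then show "m (?v V) - 1 \<le> len A M - 1" using m(1)[of "?v V"] v[of V] by auto
  next
    fix V W assume VW: "V \<in> {V. sub N V}" "W \<in> {V. sub N V}" "V \<subset> W"
    then obtain y where y: "y \<in> W" "y \<notin> V" by blast
    have "y \<in> carrier N" using VW(2) y(1) by (auto intro: subm_mem)
    then obtain w where w: "w \<in> carrier M" "y = p w" unfolding p(2)[symmetric] by blast
    then have "w \<in> ?v W" "w \<notin> ?v V" "?v V \<subseteq> ?v W" using VW(3) y by auto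
    then have "?v V \<subset> ?v W" by blast
    then show "m (?v V) - 1 < m (?v W) - 1"
      using m(2)[of "?v V" "?v W"] v[of V] v[of W] pos[of V] VW(1,2) by auto
  qed
  then have "len A N \<le> len A M - 1"
    unfolding len_def[of A N] by (rule Least_le[of "\<lambda>n. chain_bound {V. sub N V} n"])
  moreover have "0 < len A M" using pos[OF sub_zero[OF N]] m(1)[OF v[OF sub_zero[OF N]]] by simp
  ultimately show ?thesis by simp
qed

text \<open>The usual replacement for an induction along a filtration: a maximal submodule with a
  good property is enlarged until it has to be everything.\<close>

lemma sub_maximal:
  assumes M: "M \<in> mods" and "sub M U0" and "P U0"
  shows "\<exists>U. sub M U \<and> P U \<and> (\<forall>V. sub M V \<longrightarrow> P V \<longrightarrow> U \<subseteq> V \<longrightarrow> V = U)"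
proof -
  have "\<exists>U\<in>{U. sub M U \<and> P U}. \<forall>V\<in>{U. sub M U \<and> P U}. U \<subseteq> V \<longrightarrow> V = U"
    by (rule chain_bound_maximal[OF len_chain_bound[OF M], of _ U0]) (use assms in auto)
  then show ?thesis by blast
qed

lemma sub_minimal:
  assumes M: "M \<in> mods" and "sub M U0" and "P U0"
  shows "\<exists>U. sub M U \<and> P U \<and> (\<forall>V. sub M V \<longrightarrow> P V \<longrightarrow> V \<subseteq> U \<longrightarrow> V = U)"
proof -
  have "\<exists>U\<in>{U. sub M U \<and> P U}. \<forall>V\<in>{U. sub M U \<and> P U}. V \<subseteq> U \<longrightarrow> V = U"
    by (rule chain_bound_minimal[OF len_chain_bound[OF M], of _ U0]) (use assms in auto)
  then show ?thesis by blast
qed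

section \<open>Finite dimension of spaces of linear maps\<close>

text \<open>Subspaces of \<open>Hom(M, N)\<close>, as sets of maps that are not required to be extensional.\<close>

definition hom_subspace ::
  "('a, 'm) module \<Rightarrow> ('a, 'n) module \<Rightarrow> ('m \<Rightarrow> 'n) set \<Rightarrow> bool" where
  "hom_subspace M N H \<longleftrightarrow> (\<forall>f\<in>H. lin M N f) \<and>
  (\<forall>f\<in>H. \<forall>g\<in>H. \<forall>z\<in>Z. (\<lambda>x. f x \<oplus>\<^bsub>N\<^esub> z \<odot>\<^bsub>N\<^esub> g x) \<in> H) \<and>
  (\<forall>g. lin M N g \<longrightarrow> (\<forall>x\<in>carrier M. g x = \<zero>\<^bsub>N\<^esub>) \<longrightarrow> g \<in> H) \<and>
  (\<forall>f\<in>H. \<forall>g. (\<forall>x\<in>carrier M. g x = f x) \<longrightarrow> g \<in> H)"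

lemma hom_subspace_intro:
  assumes "\<And>f. f \<in> H \<Longrightarrow> lin M N f"
    and "\<And>f g z. f \<in> H \<Longrightarrow> g \<in> H \<Longrightarrow> z \<in> Z \<Longrightarrow> (\<lambda>x. f x \<oplus>\<^bsub>N\<^esub> z \<odot>\<^bsub>N\<^esub> g x) \<in> H"
    and "\<And>g. lin M N g \<Longrightarrow> (\<And>x. x \<in> carrier M \<Longrightarrow> g x = \<zero>\<^bsub>N\<^esub>) \<Longrightarrow> g \<in> H"
    and "\<And>f g. f \<in> H \<Longrightarrow> (\<And>x. x \<in> carrier M \<Longrightarrow> g x = f x) \<Longrightarrow> g \<in> H"
  shows "hom_subspace M N H"
  unfolding hom_subspace_def
proof (intro conjI ballI allI impI)
  fix f g assume "f \<in> H" "\<forall>x\<in>carrier M. g x = f x"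
  then show "g \<in> H" using assms(4)[of f g] by blast
next
  fix g assume "lin M N g" "\<forall>x\<in>carrier M. g x = \<zero>\<^bsub>N\<^esub>"
  then show "g \<in> H" using assms(3)[of g] by blast
qed (fact assms(1) assms(2))+

lemma hom_subspaceD:
  assumes "hom_subspace M N H"
  shows "f \<in> H \<Longrightarrow> lin M N f"
    and "f \<in> H \<Longrightarrow> g \<in> H \<Longrightarrow> z \<in> Z \<Longrightarrow> (\<lambda>x. f x \<oplus>\<^bsub>N\<^esub> z \<odot>\<^bsub>N\<^esub> g x) \<in> H"
    and "lin M N g \<Longrightarrow> (\<And>x. x \<in> carrier M \<Longrightarrow> g x = \<zero>\<^bsub>N\<^esub>) \<Longrightarrow> g \<in> H"
    and "f \<in> H \<Longrightarrow> (\<And>x. x \<in> carrier M \<Longrightarrow> g x = f x) \<Longrightarrow> g \<in> H"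
proof -
  note H = assms[unfolded hom_subspace_def]
  show "f \<in> H \<Longrightarrow> lin M N f" by (rule bspec[OF conjunct1[OF H]])
  show "f \<in> H \<Longrightarrow> g \<in> H \<Longrightarrow> z \<in> Z \<Longrightarrow> (\<lambda>x. f x \<oplus>\<^bsub>N\<^esub> z \<odot>\<^bsub>N\<^esub> g x) \<in> H"
    by (rule H[THEN conjunct2, THEN conjunct1, THEN bspec, THEN bspec, THEN bspec])
  show "lin M N g \<Longrightarrow> (\<And>x. x \<in> carrier M \<Longrightarrow> g x = \<zero>\<^bsub>N\<^esub>) \<Longrightarrow> g \<in> H"
    by (rule H[THEN conjunct2, THEN conjunct2, THEN conjunct1, THEN spec, THEN mp, THEN mp]) auto
  show "f \<in> H \<Longrightarrow> (\<And>x. x \<in> carrier M \<Longrightarrow> g x = f x) \<Longrightarrow> g \<in> H"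
    by (rule H[THEN conjunct2, THEN conjunct2, THEN conjunct2, THEN bspec, THEN spec, THEN mp]) auto
qed

text \<open>A linear map is determined by its values on finitely many generators. Evaluating at one
  generator \<open>s\<close> splits \<open>H\<close> into the maps vanishing at \<open>s\<close> and
  the subspace of values at \<open>s\<close>, and the ranks of the two parts add up.\<close>

lemma hom_subspace_chain_bound:
  assumes M: "M \<in> mods" and N: "N \<in> mods"
  shows "\<exists>n. chain_bound {H. hom_subspace M N H} n"
proof -
  interpret N: left_module A N using N by (rule modsD)
  obtain S where S: "finite S" "S \<subseteq> carrier M" "\<And>U. sub M U \<Longrightarrow> S \<subseteq> U \<Longrightarrow> U = carrier M"
    using M left_module.fin_gen_iff[OF modsD[OF M]] by (auto simp: mod_cat_def)
  obtain k where k: "chain_bound {V. subm Z N V} k"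
    using chain_bound_subspaces[OF modsD[OF N]] N by (auto simp: mod_cat_def)
  \<comment> \<open>Evaluation on \<open>F\<close> is injective on \<open>H\<close>, up to values
    outside the carrier.\<close>
  define sep where "sep F H \<longleftrightarrow> (\<forall>f\<in>H. (\<forall>s\<in>F. f s = \<zero>\<^bsub>N\<^esub>) \<longrightarrow> (\<forall>x\<in>carrier M. f x = \<zero>\<^bsub>N\<^esub>))"
    for F and H :: "('a list \<Rightarrow> 'a list) set"
  define \<H> where "\<H> F = {H. hom_subspace M N H \<and> sep F H}" for F
  have "\<exists>n. chain_bound (\<H> F) n" if "finite F" "F \<subseteq> S" for F
    using that
  proof (induction F)
    case empty
    \<comment> \<open>With no evaluation points, all maps in \<open>H\<close> vanish on the carrier,
      and such maps belong to every \<open>hom_subspace\<close>. So the family has no proper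
      inclusions.\<close>
    have "H \<subseteq> H'" if "H \<in> \<H> {}" "H' \<in> \<H> {}" for H H'
    proof
      fix f assume f: "f \<in> H"
      have H: "hom_subspace M N H" "hom_subspace M N H'" "sep {} H"
        using that by (simp_all add: \<H>_def)
      have "f x = \<zero>\<^bsub>N\<^esub>" if "x \<in> carrier M" for x
        using H(3) f that unfolding sep_def by blast
      then show "f \<in> H'" by (rule hom_subspaceD(3)[OF H(2) hom_subspaceD(1)[OF H(1) f]])
    qed
    then have "\<not> H \<subset> H'" if "H \<in> \<H> {}" "H' \<in> \<H> {}" for H H'
      using that by (simp add: less_le_not_le)
    then have "chain_bound (\<H> {}) 0" by (intro chain_boundI[of _ "\<lambda>_. 0"]) simp_all
    then show ?case by blast
  next
    case (insert s F)
    then obtain n where n: "chain_bound (\<H> F) n" by auto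
    obtain m where m: "\<And>V. V \<in> \<H> F \<Longrightarrow> m V \<le> n"
      "\<And>V W. V \<in> \<H> F \<Longrightarrow> W \<in> \<H> F \<Longrightarrow> V \<subset> W \<Longrightarrow> m V < m W"
      using chain_boundE[OF n] by blast
    obtain d where d: "\<And>V. V \<in> {V. subm Z N V} \<Longrightarrow> d V \<le> k"
      "\<And>V W. V \<in> {V. subm Z N V} \<Longrightarrow> W \<in> {V. subm Z N V} \<Longrightarrow> V \<subset> W \<Longrightarrow> d V < d W"
      using chain_boundE[OF k] by blast
    note d = d[unfolded mem_Collect_eq]
    define v where "v H = {f \<in> H. f s = \<zero>\<^bsub>N\<^esub>}" for H :: "('a list \<Rightarrow> 'a list) set"
    define e where "e H = (\<lambda>f. f s) ` H" for H :: "('a list \<Rightarrow> 'a list) set"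
    have s: "s \<in> carrier M" using insert.prems S(2) by auto
    have v: "v H \<in> \<H> F" if "H \<in> \<H> (insert s F)" for H
    proof -
      have H: "hom_subspace M N H" "sep (insert s F) H"
        using that by (simp_all add: \<H>_def)
      have "hom_subspace M N (v H)"
      proof (rule hom_subspace_intro)
        fix f assume "f \<in> v H"
        then show "lin M N f" using hom_subspaceD(1)[OF H(1), of f] by (simp add: v_def)
      next
        fix f g z assume "f \<in> v H" "g \<in> v H" "z \<in> Z"
        then show "(\<lambda>x. f x \<oplus>\<^bsub>N\<^esub> z \<odot>\<^bsub>N\<^esub> g x) \<in> v H"
          using hom_subspaceD(2)[OF H(1), of f g z] by (simp add: v_def N.smult_zero_right Z_carrier)
      next
        fix g assume "lin M N g" "\<And>x. x \<in> carrier M \<Longrightarrow> g x = \<zero>\<^bsub>N\<^esub>"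
        then show "g \<in> v H" using hom_subspaceD(3)[OF H(1), of g] s unfolding v_def by blast
      next
        fix f g assume "f \<in> v H" and gf: "\<And>x. x \<in> carrier M \<Longrightarrow> g x = f x"
        then have "f \<in> H" "f s = \<zero>\<^bsub>N\<^esub>" by (simp_all add: v_def)
        moreover from this(1) gf have "g \<in> H" by (rule hom_subspaceD(4)[OF H(1)])
        ultimately show "g \<in> v H" using gf[OF s] by (simp add: v_def)
      qed
      moreover have "sep F (v H)" using H(2) unfolding sep_def v_def by blast
      ultimately show ?thesis by (simp add: \<H>_def)
    qed
    have e: "subm Z N (e H)" if "H \<in> \<H> (insert s F)" for H
    proof -
      have H: "hom_subspace M N H" using that by (simp add: \<H>_def)
      note lH = hom_subspaceD(1)[OF H] and aH = hom_subspaceD(2)[OF H]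
      have zH: "(\<lambda>_. \<zero>\<^bsub>N\<^esub>) \<in> H" by (rule hom_subspaceD(3)[OF H lin_const_zero[OF N]]) simp
      show ?thesis
      proof (rule submI)
        show "\<zero>\<^bsub>N\<^esub> \<in> e H" using zH by (force simp: e_def)
      next
        fix x y assume "x \<in> e H" "y \<in> e H"
        then obtain f g where fg: "f \<in> H" "x = f s" "g \<in> H" "y = g s" unfolding e_def by blast
        then show "x \<oplus>\<^bsub>N\<^esub> y \<in> e H"
          unfolding e_def using aH[OF fg(1,3) Z_one] linear_closed[OF lH[OF fg(3)] s]
          by (intro image_eqI[where x = "\<lambda>x. f x \<oplus>\<^bsub>N\<^esub> \<one> \<odot>\<^bsub>N\<^esub> g x"]) (simp_all add: N.smult_one)
      next
        fix a x assume "a \<in> Z" "x \<in> e H"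
        then obtain f where f: "f \<in> H" "x = f s" "a \<in> Z" unfolding e_def by blast
        then show "a \<odot>\<^bsub>N\<^esub> x \<in> e H"
          unfolding e_def using aH[OF zH f(1,3)] linear_closed[OF lH[OF f(1)] s] Z_carrier N
          by (intro image_eqI[where x = "\<lambda>x. \<zero>\<^bsub>N\<^esub> \<oplus>\<^bsub>N\<^esub> a \<odot>\<^bsub>N\<^esub> f x"]) simp_all
      next
        show "e H \<subseteq> carrier N" unfolding e_def using linear_closed[OF lH s] by blast
      qed
    qed
    have "chain_bound (\<H> (insert s F)) (n + k)"
    proof (rule chain_boundI[of _ "\<lambda>H. m (v H) + d (e H)"])
      fix H assume "H \<in> \<H> (insert s F)"
      then show "m (v H) + d (e H) \<le> n + k" using m(1)[OF v] d(1)[OF e] by (intro add_mono)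
    next
      fix H H' assume HH: "H \<in> \<H> (insert s F)" "H' \<in> \<H> (insert s F)" "H \<subset> H'"
      have le: "v H \<subseteq> v H'" "e H \<subseteq> e H'" using HH(3) by (auto simp: v_def e_def)
      have "\<not> (v H = v H' \<and> e H = e H')"
      proof
        assume eq: "v H = v H' \<and> e H = e H'"
        have H: "hom_subspace M N H" "hom_subspace M N H'" using HH by (simp_all add: \<H>_def)
        have "f \<in> H" if f: "f \<in> H'" for f
        proof -
          have "f s \<in> e H'" using f by (simp add: e_def)
          then have "f s \<in> e H" using eq by simp
          then obtain g where g: "g \<in> H" "f s = g s" unfolding e_def by blast
          have "g \<in> H'" using g(1) HH(3) by blast
          \<comment> \<open>\<open>f\<close> and \<open>g\<close> have the same value at
            \<open>s\<close>, so their difference lies in \<open>v H'\<close>, which equals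
            \<open>v H\<close>; adding \<open>g\<close> back gives \<open>f\<close>.\<close>
          let ?d = "\<lambda>x. f x \<oplus>\<^bsub>N\<^esub> (\<ominus> \<one>) \<odot>\<^bsub>N\<^esub> g x"
          have lfg: "lin M N f" "lin M N g" using hom_subspaceD(1)[OF H(1) g(1)] hom_subspaceD(1)[OF H(2) f] by simp_all
          note cl = linear_closed[OF lfg(1)] linear_closed[OF lfg(2)]
          have "?d \<in> H'" by (rule hom_subspaceD(2)[OF H(2) f \<open>g \<in> H'\<close> Z_uminus[OF Z_one]])
          moreover have "?d s = \<zero>\<^bsub>N\<^esub>" using g(2) cl s by (simp add: N.smult_uminus_one N.r_neg)
          ultimately have "?d \<in> v H'" by (simp add: v_def)
          then have "?d \<in> v H" using eq by simp
          then have "?d \<in> H" by (simp add: v_def)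
          then have "(\<lambda>x. ?d x \<oplus>\<^bsub>N\<^esub> \<one> \<odot>\<^bsub>N\<^esub> g x) \<in> H"
            by (rule hom_subspaceD(2)[OF H(1) _ g(1) Z_one])
          moreover have "\<And>x. x \<in> carrier M \<Longrightarrow> f x = ?d x \<oplus>\<^bsub>N\<^esub> \<one> \<odot>\<^bsub>N\<^esub> g x"
            using cl by (simp add: N.smult_one N.smult_uminus_one N.a_assoc N.l_neg)
          ultimately show "f \<in> H" by (rule hom_subspaceD(4)[OF H(1)])
        qed
        then show False using HH(3) by blast
      qed
      with le have "v H \<subset> v H' \<or> e H \<subset> e H'" by blast
      moreover have "m (v H) \<le> m (v H')"
        using m(2)[OF v v, OF HH(1,2)] le(1) by (cases "v H = v H'") (simp_all add: psubset_eq less_imp_le)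
      moreover have "d (e H) \<le> d (e H')"
        using d(2)[OF e e, OF HH(1,2)] le(2) by (cases "e H = e H'") (simp_all add: psubset_eq less_imp_le)
      moreover note m(2)[OF v[OF HH(1)] v[OF HH(2)]] d(2)[OF e[OF HH(1)] e[OF HH(2)]]
      ultimately show "m (v H) + d (e H) < m (v H') + d (e H')"
        by (elim disjE) (simp_all add: add_less_le_mono add_le_less_mono)
    qed
    then show ?case by blast
  qed
  from this[OF S(1) subset_refl] obtain n where "chain_bound (\<H> S) n" by blast
  moreover have "sep S H" if H: "hom_subspace M N H" for H
    unfolding sep_def
  proof (intro ballI impI)
    fix f x assume f: "f \<in> H" "\<forall>s\<in>S. f s = \<zero>\<^bsub>N\<^esub>" and x: "x \<in> carrier M"
    have "S \<subseteq> a_kernel M N f" using f(2) S(2) by auto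
    from S(3)[OF sub_kernel[OF M N hom_subspaceD(1)[OF H f(1)]] this]
    have "x \<in> a_kernel M N f" using x by simp
    then show "f x = \<zero>\<^bsub>N\<^esub>" by simp
  qed
  then have "{H. hom_subspace M N H} = \<H> S" unfolding \<H>_def by blast
  ultimately show ?thesis by auto
qed

text \<open>The maps that factor through \<open>q\<close>. Making this subspace maximal by varying
  \<open>L\<close> and \<open>q\<close> is how the later lifting properties are obtained.\<close>

lemma hom_subspaceI:
  assumes M: "M \<in> mods" and N: "N \<in> mods" and L: "L \<in> mods" and q: "lin L N q"
  shows "hom_subspace M N {f. lin M N f \<and> (\<exists>g. lin M L g \<and> (\<forall>x\<in>carrier M. f x = q (g x)))}"
  unfolding hom_subspace_def
proof (intro conjI ballI allI impI)
  fix f g z assume "f \<in> {f. lin M N f \<and> (\<exists>g. lin M L g \<and> (\<forall>x\<in>carrier M. f x = q (g x)))}"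
    "g \<in> {f. lin M N f \<and> (\<exists>g. lin M L g \<and> (\<forall>x\<in>carrier M. f x = q (g x)))}" and z: "z \<in> Z"
  then obtain f' g' where fg: "lin M N f" "lin M L f'" "\<And>x. x \<in> carrier M \<Longrightarrow> f x = q (f' x)"
    "lin M N g" "lin M L g'" "\<And>x. x \<in> carrier M \<Longrightarrow> g x = q (g' x)" by auto
  have "lin M L (\<lambda>x. f' x \<oplus>\<^bsub>L\<^esub> z \<odot>\<^bsub>L\<^esub> g' x)" "lin M N (\<lambda>x. f x \<oplus>\<^bsub>N\<^esub> z \<odot>\<^bsub>N\<^esub> g x)"
    by (intro lin_plus lin_scalar L N z fg)+
  moreover have "f x \<oplus>\<^bsub>N\<^esub> z \<odot>\<^bsub>N\<^esub> g x = q (f' x \<oplus>\<^bsub>L\<^esub> z \<odot>\<^bsub>L\<^esub> g' x)" if "x \<in> carrier M" for x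
    using that z L fg by (simp add: linear_add[OF q] linear_smult[OF q] linear_closed[OF fg(2)]
      linear_closed[OF fg(5)] Z_carrier)
  ultimately show "(\<lambda>x. f x \<oplus>\<^bsub>N\<^esub> z \<odot>\<^bsub>N\<^esub> g x) \<in>
      {f. lin M N f \<and> (\<exists>g. lin M L g \<and> (\<forall>x\<in>carrier M. f x = q (g x)))}" by blast
next
  fix g assume "lin M N g" "\<forall>x\<in>carrier M. g x = \<zero>\<^bsub>N\<^esub>"
  then show "g \<in> {f. lin M N f \<and> (\<exists>g. lin M L g \<and> (\<forall>x\<in>carrier M. f x = q (g x)))}"
    using lin_const_zero[OF L, of M] lin_zero[OF L N q] by auto
next
  fix f g assume f: "f \<in> {f. lin M N f \<and> (\<exists>g. lin M L g \<and> (\<forall>x\<in>carrier M. f x = q (g x)))}"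
    "\<forall>x\<in>carrier M. g x = f x"
  then have "lin M N g" by (intro lin_cong[of M N f g] M) auto
  with f show "g \<in> {f. lin M N f \<and> (\<exists>g. lin M L g \<and> (\<forall>x\<in>carrier M. f x = q (g x)))}" by auto
qed auto

section \<open>Torsion classes and wide subcategories\<close>

lemma a_kernel_restrict [simp]: "a_kernel M N (restrict g (carrier M)) = a_kernel M N g"
  by auto

lemma a_kernel_restr_codom [simp]: "a_kernel M (restr N V) g = a_kernel M N g"
  by auto

lemma Hom_restrict: "M \<in> mods \<Longrightarrow> lin M N g \<Longrightarrow> restrict g (carrier M) \<in> Hom A M N"
  by (simp add: Hom_iff lin_cong)

lemma lin_inj_on:
  assumes MN: "M \<in> mods" "N \<in> mods" and g: "lin M N g"
    and ker: "\<And>x. x \<in> carrier M \<Longrightarrow> g x = \<zero>\<^bsub>N\<^esub> \<Longrightarrow> x = \<zero>\<^bsub>M\<^esub>"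
  shows "inj_on g (carrier M)"
proof (rule inj_onI)
  fix x y assume xy: "x \<in> carrier M" "y \<in> carrier M" "g x = g y"
  then have "g (x \<ominus>\<^bsub>M\<^esub> y) = \<zero>\<^bsub>N\<^esub>"
    by (simp add: lin_minus[OF MN g] linear_closed[OF g] MN)
  then have "x \<ominus>\<^bsub>M\<^esub> y = \<zero>\<^bsub>M\<^esub>" using ker xy MN by simp
  then show "x = y" using xy MN by (simp add: mods_diff_eq_zero)
qed

lemma a_kernel_prj_restr:
  assumes M: "M \<in> mods" and U: "sub M U" and V: "U \<subseteq> V" "V \<subseteq> carrier M"
  shows "a_kernel (restr M V) (quo M U) (prj M U) = U"
  using prj_eq_zero[OF M U] V by (auto simp: subset_iff)

lemma a_kernel_prj: "M \<in> mods \<Longrightarrow> sub M U \<Longrightarrow> a_kernel M (quo M U) (prj M U) = U"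
  using a_kernel_prj_restr[of M U "carrier M"] subm_subset[of "carrier A" M U] by simp

lemma iso_mem:
  assumes C: "subcategory A C" and M: "M \<in> C" and N: "N \<in> mods"
    and g: "lin M N g" "inj_on g (carrier M)" "g ` carrier M = carrier N"
  shows "N \<in> C"
proof -
  have "M \<in> mods" using C M by (auto simp: subcategory_def)
  from Hom_restrict[OF this g(1)] have "module_iso A M N"
    unfolding module_iso_def using g(2,3)
    by (intro bexI[of _ "restrict g (carrier M)"]) (simp_all add: bij_betw_def inj_on_def)
  then show ?thesis using C M N by (auto simp: subcategory_def)
qed

lemma iso_mem':
  assumes C: "subcategory A C" and M: "M \<in> mods" and N: "N \<in> C"
    and g: "lin M N g" "inj_on g (carrier M)" "g ` carrier M = carrier N"
  shows "M \<in> C"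
proof -
  have Nm: "N \<in> mods" using C N by (auto simp: subcategory_def)
  have "x = \<zero>\<^bsub>M\<^esub>" if "x \<in> carrier M" "g x = \<zero>\<^bsub>N\<^esub>" for x
    using inj_onD[OF g(2), of x "\<zero>\<^bsub>M\<^esub>"] lin_zero[OF M Nm g(1)] that M by simp
  then obtain h where h: "lin N M h" "\<forall>x\<in>carrier M. h (g x) = x"
    using lin_factor[OF M Nm M g(1,3) lin_id] by blast
  have "inj_on h (carrier N)" unfolding g(3)[symmetric] using h(2) by (intro inj_onI) auto
  moreover have "h ` carrier N = carrier M"
    unfolding g(3)[symmetric] image_image using h(2) by simp
  ultimately show ?thesis by (rule iso_mem[OF C N M h(1)])
qed

text \<open>The common part of torsion classes and wide subcategories, so that the extension
  arguments below apply to both.\<close>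

definition "extension_closed C \<longleftrightarrow> subcategory A C \<and> closed_under_extensions A C"

lemma extension_closed_mods: "extension_closed C \<Longrightarrow> M \<in> C \<Longrightarrow> M \<in> mods"
  by (auto simp: extension_closed_def subcategory_def)

lemma ext_surj:
  assumes C: "extension_closed C" and Y: "Y \<in> mods" and L: "L \<in> C"
    and f: "lin Y L f" "f ` carrier Y = carrier L" and ker: "restr Y (a_kernel Y L f) \<in> C"
  shows "Y \<in> C"
proof -
  let ?U = "a_kernel Y L f"
  have "?U \<subseteq> carrier Y" by auto
  from Hom_restrict[OF extension_closed_mods[OF C ker] lin_incl[OF this]]
  have "restrict (\<lambda>x. x) ?U \<in> Hom A (restr Y ?U) Y" by simp
  moreover have "inj_on (restrict (\<lambda>x. x) ?U) ?U" by (simp add: inj_on_def)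
  ultimately have "short_exact A (restr Y ?U) Y L (restrict (\<lambda>x. x) ?U) (restrict f (carrier Y))"
    using Hom_restrict[OF Y f(1)] f(2) by (simp add: short_exact_def)
  then show ?thesis
    using C Y L ker unfolding extension_closed_def closed_under_extensions_def by blast
qed

lemma ext_image:
  assumes C: "extension_closed C" and Y: "Y \<in> mods" and f: "lin Y L f"
    and ker: "restr Y (a_kernel Y L f) \<in> C" and im: "restr L (f ` carrier Y) \<in> C"
  shows "Y \<in> C"
  by (rule ext_surj[OF C Y im lin_into[OF f]]) (use ker in simp_all)

text \<open>The correspondence between submodules of \<open>M / U\<close> and submodules of
  \<open>M\<close> above \<open>U\<close>. The last claim holds because \<open>V\<close> is an
  extension of \<open>J\<close> by \<open>U\<close>.\<close>

lemma prj_vimage: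
  assumes M: "M \<in> mods" and U: "sub M U" and J: "sub (quo M U) J"
  defines "V \<equiv> {x \<in> carrier M. prj M U x \<in> J}"
  shows "sub M V" and "U \<subseteq> V" and "prj M U ` V = J"
    and "extension_closed C \<Longrightarrow> restr M U \<in> C \<Longrightarrow> restr (quo M U) J \<in> C \<Longrightarrow> restr M V \<in> C"
proof -
  note Q = quo_mods[OF M U] and p = lin_prj[OF M U] prj_surj[OF M U] prj_eq_zero[OF M U]
  show V: "sub M V" unfolding V_def by (rule sub_vimage[OF M Q p(1) J])
  show UV: "U \<subseteq> V"
  proof
    fix x assume x: "x \<in> U"
    have xM: "x \<in> carrier M" by (rule subm_mem[OF U x])
    then show "x \<in> V" using p(3)[OF xM] x subm_zero[OF J] by (simp add: V_def)
  qed
  show im: "prj M U ` V = J"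
  proof
    show "J \<subseteq> prj M U ` V"
    proof
      fix y assume y: "y \<in> J"
      then have "y \<in> prj M U ` carrier M" using subm_mem[OF J] p(2) by simp
      then show "y \<in> prj M U ` V" using y unfolding V_def by blast
    qed
  qed (auto simp: V_def)
  assume "extension_closed C" "restr M U \<in> C" "restr (quo M U) J \<in> C"
  then show "restr M V \<in> C"
    using ext_image[OF _ restr_mods[OF M V] lin_restr[OF p(1) subm_subset[OF V]]]
      a_kernel_prj_restr[OF M U UV subm_subset[OF V]] im by simp
qed

lemma quo_mem_iff:
  assumes C: "subcategory A C" and M: "M \<in> mods" and N: "N \<in> mods" and g: "lin M N g"
  shows "quo M (a_kernel M N g) \<in> C \<longleftrightarrow> restr N (g ` carrier M) \<in> C"
proof -
  note U = sub_kernel[OF M N g] and I = restr_mods[OF N sub_range[OF M N g]]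
  note Q = quo_mods[OF M U] and p = lin_prj[OF M U] prj_surj[OF M U] prj_eq_zero[OF M U]
  obtain h where h: "lin (quo M (a_kernel M N g)) (restr N (g ` carrier M)) h"
    "\<forall>x\<in>carrier M. h (prj M (a_kernel M N g) x) = g x"
    using lin_factor[OF M Q I p(1,2) lin_into[OF g subset_refl]] p(3) by auto
  have inj: "inj_on h (carrier (quo M (a_kernel M N g)))"
  proof (rule lin_inj_on[OF Q I h(1)])
    fix y assume y: "y \<in> carrier (quo M (a_kernel M N g))" "h y = \<zero>\<^bsub>restr N (g ` carrier M)\<^esub>"
    then obtain x where x: "x \<in> carrier M" "y = prj M (a_kernel M N g) x"
      unfolding p(2)[symmetric] by blast
    then show "y = \<zero>\<^bsub>quo M (a_kernel M N g)\<^esub>" using y(2) h(2) p(3)[OF x(1)] by simp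
  qed
  have surj: "h ` carrier (quo M (a_kernel M N g)) = carrier (restr N (g ` carrier M))"
    unfolding p(2)[symmetric] image_image using h(2) by simp
  show ?thesis
    using iso_mem[OF C _ I h(1) inj surj] iso_mem'[OF C Q _ h(1) inj surj] by blast
qed

lemma bip_mem:
  assumes C: "extension_closed C" and M: "M \<in> C" and N: "N \<in> C"
  shows "bip M N \<in> C"
proof -
  note MN = extension_closed_mods[OF C M] extension_closed_mods[OF C N]
  note [simp] = pair_closed[OF MN] fst_pair[OF MN] snd_pair[OF MN] MN bip_mods[OF MN]
  let ?U = "a_kernel (bip M N) N (snd_bip M N)"
  let ?i = "\<lambda>x. pair M N x \<zero>\<^bsub>N\<^esub>"
  have im: "?i ` carrier M = ?U"
  proof
    show "?U \<subseteq> ?i ` carrier M"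
    proof
      fix d assume d: "d \<in> ?U"
      then have "d = ?i (fst_bip M N d)" using pair_fst_snd[OF MN, of d] by simp
      then show "d \<in> ?i ` carrier M" using d linear_closed[OF lin_fst[OF MN]] by auto
    qed
  qed auto
  have inj: "inj_on ?i (carrier M)"
  proof (rule inj_onI)
    fix x y assume "x \<in> carrier M" "y \<in> carrier M" "?i x = ?i y"
    then have "fst_bip M N (?i x) = fst_bip M N (?i y)" by simp
    then show "x = y" using \<open>x \<in> carrier M\<close> \<open>y \<in> carrier M\<close> by simp
  qed
  have U: "restr (bip M N) ?U \<in> mods"
    by (rule restr_mods[OF bip_mods[OF MN] sub_kernel[OF bip_mods[OF MN] MN(2) lin_snd[OF MN]]])
  have i: "lin M (restr (bip M N) ?U) ?i" by (rule lin_into[OF lin_inl[OF MN]]) (use im in simp)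
  have "subcategory A C" using C by (simp add: extension_closed_def)
  from iso_mem[OF this M U i inj] im have "restr (bip M N) ?U \<in> C" by simp
  then show ?thesis
  proof (rule ext_surj[OF C bip_mods[OF MN] N lin_snd[OF MN], rotated])
    show "snd_bip M N ` carrier (bip M N) = carrier N"
    proof
      show "carrier N \<subseteq> snd_bip M N ` carrier (bip M N)"
      proof
        fix y assume "y \<in> carrier N"
        then show "y \<in> snd_bip M N ` carrier (bip M N)"
          by (intro image_eqI[where x = "pair M N \<zero>\<^bsub>M\<^esub> y"]) simp_all
      qed
    qed (use linear_closed[OF lin_snd[OF MN]] in auto)
  qed
qed

subsection \<open>Torsion classes\<close>

lemma tors_ext: "T \<in> tors A \<Longrightarrow> extension_closed T"
  by (simp add: tors_def extension_closed_def)

lemma tors_mods: "T \<in> tors A \<Longrightarrow> M \<in> T \<Longrightarrow> M \<in> mods"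
  by (rule extension_closed_mods[OF tors_ext])

lemma tors_quotient:
  assumes T: "T \<in> tors A" and M: "M \<in> T" and N: "N \<in> mods" and p: "lin M N p" "p ` carrier M = carrier N"
  shows "N \<in> T"
proof -
  have "restrict p (carrier M) ` carrier M = carrier N" using p(2) by simp
  then show ?thesis
    using T M N Hom_restrict[OF tors_mods[OF T M] p(1)]
    unfolding tors_def closed_under_quotients_def by blast
qed

lemma tors_image:
  assumes T: "T \<in> tors A" and M: "M \<in> T" and N: "N \<in> mods" and g: "lin M N g"
  shows "restr N (g ` carrier M) \<in> T"
  by (rule tors_quotient[OF T M restr_mods[OF N sub_range[OF tors_mods[OF T M] N g]] lin_into[OF g]])
     simp_all

text \<open>An abstract short exact sequence has an arbitrary injection as its first map. Closure
  under quotients replaces its source by the literal kernel, so only kernels have to be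
  treated.\<close>

lemma torsI:
  assumes mods: "C \<subseteq> mods" and "M0 \<in> C"
    and quot: "\<And>M N p. M \<in> C \<Longrightarrow> N \<in> mods \<Longrightarrow> lin M N p \<Longrightarrow> p ` carrier M = carrier N \<Longrightarrow> N \<in> C"
    and ext: "\<And>Y L f. Y \<in> mods \<Longrightarrow> L \<in> C \<Longrightarrow> lin Y L f \<Longrightarrow> f ` carrier Y = carrier L \<Longrightarrow>
      restr Y (a_kernel Y L f) \<in> C \<Longrightarrow> Y \<in> C"
  shows "C \<in> tors A"
  unfolding tors_def
proof (intro CollectI conjI)
  show "subcategory A C"
    unfolding subcategory_def
  proof (intro conjI ballI impI)
    fix M N assume "M \<in> C" "N \<in> mods" "module_iso A M N"
    then show "N \<in> C" using quot[of M N] by (auto simp: module_iso_def Hom_iff bij_betw_def)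
  qed (rule mods)
  show "C \<noteq> {}" using assms(2) by blast
  show "closed_under_quotients A C"
    unfolding closed_under_quotients_def using quot by (auto simp: Hom_iff)
  show "closed_under_extensions A C"
    unfolding closed_under_extensions_def
  proof (intro ballI allI impI)
    fix M L N f g assume *: "M \<in> C" "L \<in> C" "N \<in> mods" "short_exact A M N L f g"
    then have fg: "lin M N f" "lin N L g" "f ` carrier M = a_kernel N L g" "g ` carrier N = carrier L"
      by (auto simp: short_exact_def Hom_iff)
    have L: "L \<in> mods" using mods *(2) by blast
    have "lin M (restr N (a_kernel N L g)) f" by (rule lin_into[OF fg(1)]) (use fg(3) in simp)
    from quot[OF *(1) restr_mods[OF *(3) sub_kernel[OF *(3) L fg(2)]] this]
    have "restr N (a_kernel N L g) \<in> C" using fg(3) by simp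
    then show "N \<in> C" by (rule ext[OF *(3,2) fg(2,4)])
  qed
qed

lemma mods_tors: "mods \<in> tors A"
proof -
  obtain M where "M \<in> mods" using free_module_exists by blast
  then show ?thesis by (intro torsI[of mods M]) auto
qed

lemma tors_zero:
  assumes T: "T \<in> tors A" and N: "N \<in> mods" and z: "carrier N = {\<zero>\<^bsub>N\<^esub>}"
  shows "N \<in> T"
proof -
  obtain M where M: "M \<in> T" using T by (auto simp: tors_def)
  then have "\<zero>\<^bsub>M\<^esub> \<in> carrier M" using tors_mods[OF T M] by simp
  then have "(\<lambda>_. \<zero>\<^bsub>N\<^esub>) ` carrier M = carrier N" unfolding z by blast
  then show ?thesis by (rule tors_quotient[OF T M N lin_const_zero[OF N]])
qed

lemma tors_Int:
  assumes "T1 \<in> tors A" and "T2 \<in> tors A"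
  shows "T1 \<inter> T2 \<in> tors A"
proof -
  obtain M where M: "M \<in> mods" using free_module_exists by blast
  have z: "restr M {\<zero>\<^bsub>M\<^esub>} \<in> mods" by (rule restr_mods[OF M sub_zero[OF M]])
  show ?thesis
  proof (rule torsI[of _ "restr M {\<zero>\<^bsub>M\<^esub>}"])
    show "restr M {\<zero>\<^bsub>M\<^esub>} \<in> T1 \<inter> T2" using tors_zero[OF _ z] assms by simp
  next
    fix M N p assume "M \<in> T1 \<inter> T2" "N \<in> mods" "lin M N p" "p ` carrier M = carrier N"
    then show "N \<in> T1 \<inter> T2" using tors_quotient[OF assms(1)] tors_quotient[OF assms(2)] by blast
  next
    fix Y L f assume "Y \<in> mods" "L \<in> T1 \<inter> T2" "lin Y L f" "f ` carrier Y = carrier L"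
      "restr Y (a_kernel Y L f) \<in> T1 \<inter> T2"
    then show "Y \<in> T1 \<inter> T2" using ext_surj[OF tors_ext[OF assms(1)]] ext_surj[OF tors_ext[OF assms(2)]] by blast
  qed (use tors_mods[OF assms(1)] in blast)
qed

section \<open>Torsion classes of modules without nonzero maps to a given module\<close>

definition "left_perp N = {Y \<in> mods. \<forall>g. lin Y N g \<longrightarrow> (\<forall>y\<in>carrier Y. g y = \<zero>\<^bsub>N\<^esub>)}"

lemma left_perpD: "Y \<in> left_perp N \<Longrightarrow> lin Y N g \<Longrightarrow> y \<in> carrier Y \<Longrightarrow> g y = \<zero>\<^bsub>N\<^esub>"
  by (simp add: left_perp_def)

lemma left_perpI: "Y \<in> mods \<Longrightarrow> (\<And>g y. lin Y N g \<Longrightarrow> y \<in> carrier Y \<Longrightarrow> g y = \<zero>\<^bsub>N\<^esub>) \<Longrightarrow> Y \<in> left_perp N"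
  unfolding left_perp_def by blast

lemma left_perp_tors:
  assumes N: "N \<in> mods"
  shows "left_perp N \<in> tors A"
proof (rule torsI[of _ "restr N {\<zero>\<^bsub>N\<^esub>}"])
  note z = restr_mods[OF N sub_zero[OF N]]
  show "restr N {\<zero>\<^bsub>N\<^esub>} \<in> left_perp N"
    by (rule left_perpI[OF z]) (use lin_zero[OF z N] in auto)
next
  fix M L p assume *: "M \<in> left_perp N" "L \<in> mods" "lin M L p" "p ` carrier M = carrier L"
  show "L \<in> left_perp N"
  proof (rule left_perpI[OF *(2)])
    fix g y assume g: "lin L N g" and "y \<in> carrier L"
    then obtain x where "x \<in> carrier M" "y = p x" unfolding *(4)[symmetric] by blast
    then show "g y = \<zero>\<^bsub>N\<^esub>" using left_perpD[OF *(1) linear_comp[OF *(3) g]] by simp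
  qed
next
  fix Y L f assume *: "Y \<in> mods" "L \<in> left_perp N" "lin Y L f" "f ` carrier Y = carrier L"
    "restr Y (a_kernel Y L f) \<in> left_perp N"
  have L: "L \<in> mods" using *(2) by (simp add: left_perp_def)
  show "Y \<in> left_perp N"
  proof (rule left_perpI[OF *(1)])
    fix g y assume g: "lin Y N g" and y: "y \<in> carrier Y"
    have "lin (restr Y (a_kernel Y L f)) N g" by (rule lin_restr[OF g]) auto
    from left_perpD[OF *(5) this] obtain h where h: "lin L N h" "\<forall>x\<in>carrier Y. h (f x) = g x"
      using lin_factor[OF *(1) L N *(3,4) g] by auto
    then show "g y = \<zero>\<^bsub>N\<^esub>" using left_perpD[OF *(2) h(1) linear_closed[OF *(3) y]] y by simp
  qed
qed (simp add: left_perp_def)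

lemma left_perp_self:
  assumes M: "M \<in> mods" and "M \<in> left_perp M"
  shows "carrier M = {\<zero>\<^bsub>M\<^esub>}"
  using left_perpD[OF assms(2) lin_id] mods_zero[OF M] by blast

text \<open>\<open>U + V\<close> is an extension of the image of \<open>V\<close> in
  \<open>M / U\<close> by \<open>U\<close>.\<close>

lemma tors_ssum:
  assumes T: "T \<in> tors A" and M: "M \<in> mods" and U: "sub M U" "restr M U \<in> T" and V: "sub M V" "restr M V \<in> T"
  shows "restr M (ssum M U V) \<in> T"
proof -
  note S = ssum_sub[OF M U(1) V(1)]
  note Q = quo_mods[OF M U(1)] and p = lin_prj[OF M U(1)]
  have sm: "ssum M U V \<subseteq> carrier M" using S(1) by (rule subm_subset)
  have "prj M U ` ssum M U V = prj M U ` V"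
  proof
    show "prj M U ` ssum M U V \<subseteq> prj M U ` V"
    proof
      fix y assume "y \<in> prj M U ` ssum M U V"
      then obtain u v where uv: "u \<in> U" "v \<in> V" "y = prj M U (u \<oplus>\<^bsub>M\<^esub> v)" by (auto simp: ssum_def)
      have c: "u \<in> carrier M" "v \<in> carrier M" using subm_mem[OF U(1) uv(1)] subm_mem[OF V(1) uv(2)] by simp_all
      have "prj M U u = \<zero>\<^bsub>quo M U\<^esub>" using prj_eq_zero[OF M U(1) c(1)] uv(1) by simp
      then have "y = prj M U v"
        using uv(3) c Q by (simp add: linear_add[OF p] linear_closed[OF p])
      then show "y \<in> prj M U ` V" using uv(2) by blast
    qed
  qed (use S(3) in blast)
  moreover have "restr (quo M U) (prj M U ` V) \<in> T"
    using tors_image[OF T V(2) Q lin_restr[OF p subm_subset[OF V(1)]]] by simp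
  moreover have "a_kernel (restr M (ssum M U V)) (quo M U) (prj M U) = U"
    by (rule a_kernel_prj_restr[OF M U(1) S(2) sm])
  ultimately show ?thesis
    using ext_image[OF tors_ext[OF T] restr_mods[OF M S(1)] lin_restr[OF p sm]] U(2) by simp
qed

section \<open>The torsion radical\<close>

definition "rad T M = \<Union>{U. sub M U \<and> restr M U \<in> T}"

text \<open>A maximal submodule in \<open>T\<close> absorbs every other one, since \<open>T\<close>
  is closed under sums of submodules. Hence the union defining \<open>rad\<close> is attained by one
  of its members.\<close>

lemma rad_props:
  assumes T: "T \<in> tors A" and M: "M \<in> mods"
  shows rad_sub: "sub M (rad T M)" and rad_mem: "restr M (rad T M) \<in> T"
    and rad_greatest: "sub M U \<Longrightarrow> restr M U \<in> T \<Longrightarrow> U \<subseteq> rad T M"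
proof -
  have "restr M {\<zero>\<^bsub>M\<^esub>} \<in> T"
    by (rule tors_zero[OF T restr_mods[OF M sub_zero[OF M]]]) simp
  from sub_maximal[where P = "\<lambda>U. restr M U \<in> T", OF M sub_zero[OF M] this]
  obtain R where R: "sub M R" "restr M R \<in> T"
    and max: "\<forall>V. sub M V \<longrightarrow> restr M V \<in> T \<longrightarrow> R \<subseteq> V \<longrightarrow> V = R" by (elim exE conjE)
  have "V \<subseteq> R" if V: "sub M V" "restr M V \<in> T" for V
    using max[rule_format, OF ssum_sub(1)[OF M R(1) V(1)] tors_ssum[OF T M R(1,2) V]] ssum_sub(2,3)[OF M R(1) V(1)]
    by simp
  then have "rad T M = R" unfolding rad_def using R(1,2) by blast
  then show "sub M (rad T M)" "restr M (rad T M) \<in> T" using R(1,2) by simp_all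
  show "sub M U \<Longrightarrow> restr M U \<in> T \<Longrightarrow> U \<subseteq> rad T M" by (auto simp: rad_def)
qed

lemma rad_image:
  assumes T: "T \<in> tors A" and M: "M \<in> mods" and Y: "Y \<in> T" and g: "lin Y M g" and y: "y \<in> carrier Y"
  shows "g y \<in> rad T M"
  using rad_greatest[OF T M sub_range[OF tors_mods[OF T Y] M g] tors_image[OF T Y M g]] y by blast

lemma rad_map:
  assumes T: "T \<in> tors A" and M: "M \<in> mods" and N: "N \<in> mods" and g: "lin M N g" and x: "x \<in> rad T M"
  shows "g x \<in> rad T N"
  using rad_image[OF T N rad_mem[OF T M] lin_restr[OF g subm_subset[OF rad_sub[OF T M]]]] x by simp

lemma rad_eq_carrier:
  assumes T: "T \<in> tors A" and M: "M \<in> mods" and "carrier M \<subseteq> rad T M"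
  shows "M \<in> T"
proof -
  have "rad T M = carrier M" using assms(3) subm_subset[OF rad_sub[OF T M]] by blast
  then show ?thesis using rad_mem[OF T M] by simp
qed

text \<open>The preimage in \<open>M\<close> of the image of \<open>g\<close> is an extension of
  objects of \<open>T\<close>, so it is contained in the radical.\<close>

lemma quo_rad_zero:
  assumes T: "T \<in> tors A" and M: "M \<in> mods" and Y: "Y \<in> T" and g: "lin Y (quo M (rad T M)) g"
    and y: "y \<in> carrier Y"
  shows "g y = \<zero>\<^bsub>quo M (rad T M)\<^esub>"
proof -
  note R = rad_sub[OF T M]
  note Q = quo_mods[OF M R] and p = lin_prj[OF M R] prj_surj[OF M R] prj_eq_zero[OF M R]
  define V where "V = {x \<in> carrier M. prj M (rad T M) x \<in> g ` carrier Y}"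
  have I: "sub (quo M (rad T M)) (g ` carrier Y)" by (rule sub_range[OF tors_mods[OF T Y] Q g])
  note V = prj_vimage[OF M R I, folded V_def]
  have "restr M V \<in> T" by (rule V(4)[OF tors_ext[OF T] rad_mem[OF T M] tors_image[OF T Y Q g]])
  then have VR: "V \<subseteq> rad T M" by (rule rad_greatest[OF T M V(1)])
  have "g y \<in> carrier (quo M (rad T M))" using linear_closed[OF g y] .
  then obtain x where x: "x \<in> carrier M" "g y = prj M (rad T M) x" unfolding p(2)[symmetric] by blast
  then have "x \<in> V" using imageI[OF y, of g] by (simp add: V_def)
  then have "x \<in> rad T M" using VR by blast
  then show ?thesis using p(3)[OF x(1)] x(2) by simp
qed

subsection \<open>Wide subcategories\<close>

lemma wide_ext: "W \<in> wide A \<Longrightarrow> extension_closed W"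
  and wide_sub: "W \<in> wide A \<Longrightarrow> subcategory A W"
  by (simp_all add: wide_def extension_closed_def)

lemma wide_mods: "W \<in> wide A \<Longrightarrow> M \<in> W \<Longrightarrow> M \<in> mods"
  by (rule extension_closed_mods[OF wide_ext])

lemma wide_kernel:
  assumes W: "W \<in> wide A" and M: "M \<in> W" and N: "N \<in> W" and g: "lin M N g"
  shows "restr M (a_kernel M N g) \<in> W"
proof -
  have "ker_mod M N (restrict g (carrier M)) \<in> W"
    using W M N Hom_restrict[OF wide_mods[OF W M] g] unfolding wide_def closed_under_kernels_def by blast
  then show ?thesis by (simp add: ker_mod_eq)
qed

lemma wide_cokernel:
  assumes W: "W \<in> wide A" and M: "M \<in> W" and N: "N \<in> W" and g: "lin M N g"
  shows "quo N (g ` carrier M) \<in> W"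
proof -
  note MN = wide_mods[OF W M] wide_mods[OF W N]
  note U = sub_range[OF MN g]
  note Q = quo_mods[OF MN(2) U] and p = lin_prj[OF MN(2) U] prj_surj[OF MN(2) U] prj_eq_zero[OF MN(2) U]
  let ?p = "restrict (prj N (g ` carrier M)) (carrier N)" and ?g = "restrict g (carrier M)"
  have "a_kernel N (quo N (g ` carrier M)) (prj N (g ` carrier M)) = g ` carrier M"
    by (rule a_kernel_prj[OF MN(2) U])
  then have "?p ` carrier N = carrier (quo N (g ` carrier M)) \<and>
      a_kernel N (quo N (g ` carrier M)) ?p = ?g ` carrier M"
    using p(2) by simp
  then show ?thesis
    using W M N Q Hom_restrict[OF MN(1) g] Hom_restrict[OF MN(2) p(1)]
    unfolding wide_def closed_under_cokernels_def by blast
qed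

text \<open>The image is the kernel of the projection onto the cokernel.\<close>

lemma wide_image:
  assumes W: "W \<in> wide A" and M: "M \<in> W" and N: "N \<in> W" and g: "lin M N g"
  shows "restr N (g ` carrier M) \<in> W"
proof -
  note MN = wide_mods[OF W M] wide_mods[OF W N]
  note U = sub_range[OF MN g]
  have "a_kernel N (quo N (g ` carrier M)) (prj N (g ` carrier M)) = g ` carrier M"
    by (rule a_kernel_prj[OF MN(2) U])
  then show ?thesis
    using wide_kernel[OF W N wide_cokernel[OF W M N g] lin_prj[OF MN(2) U]] by simp
qed

lemma wide_zero:
  assumes W: "W \<in> wide A" and N: "N \<in> mods" and z: "carrier N = {\<zero>\<^bsub>N\<^esub>}"
  shows "N \<in> W"
proof -
  obtain L where L: "L \<in> W" "carrier L = {\<zero>\<^bsub>L\<^esub>}" using W by (auto simp: wide_def contains_zero_def)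
  show ?thesis
    by (rule iso_mem[OF wide_sub[OF W] L(1) N lin_const_zero[OF N]]) (use L(2) z in auto)
qed

text \<open>Cokernels and extensions in \<open>wide\<close> are meant up to isomorphism; it is
  enough to check the literal quotient and the literal kernel.\<close>

lemma wideI:
  assumes sc: "subcategory A C" and zero: "N0 \<in> C" "carrier N0 = {\<zero>\<^bsub>N0\<^esub>}"
    and ker: "\<And>M N g. M \<in> C \<Longrightarrow> N \<in> C \<Longrightarrow> lin M N g \<Longrightarrow> restr M (a_kernel M N g) \<in> C"
    and coker: "\<And>M N g. M \<in> C \<Longrightarrow> N \<in> C \<Longrightarrow> lin M N g \<Longrightarrow> quo N (g ` carrier M) \<in> C"
    and ext: "\<And>Y L f. Y \<in> mods \<Longrightarrow> L \<in> C \<Longrightarrow> lin Y L f \<Longrightarrow> f ` carrier Y = carrier L \<Longrightarrow>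
      restr Y (a_kernel Y L f) \<in> C \<Longrightarrow> Y \<in> C"
  shows "C \<in> wide A"
  unfolding wide_def
proof (intro CollectI conjI)
  have mods: "M \<in> mods" if "M \<in> C" for M using that sc by (auto simp: subcategory_def)
  show "contains_zero C" using zero by (auto simp: contains_zero_def)
  show "closed_under_kernels A C"
    unfolding closed_under_kernels_def ker_mod_eq using ker by (auto simp: Hom_iff)
  show "closed_under_cokernels A C"
    unfolding closed_under_cokernels_def
  proof (intro ballI impI)
    fix M N g L p assume *: "M \<in> C" "N \<in> C" "g \<in> Hom A M N" "L \<in> mods" "p \<in> Hom A N L"
      "p ` carrier N = carrier L \<and> a_kernel N L p = g ` carrier M"
    then have p: "lin N L p" and g: "lin M N g" by (auto simp: Hom_iff)
    have "restr L (p ` carrier N) \<in> C"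
      using quo_mem_iff[OF sc mods[OF *(2)] *(4) p] coker[OF *(1,2) g] *(6) by simp
    then show "L \<in> C" using *(6) by simp
  qed
  show "closed_under_extensions A C"
    unfolding closed_under_extensions_def
  proof (intro ballI allI impI)
    fix M L N f g assume *: "M \<in> C" "L \<in> C" "N \<in> mods" "short_exact A M N L f g"
    then have fg: "lin M N f" "lin N L g" "inj_on f (carrier M)" "f ` carrier M = a_kernel N L g"
      "g ` carrier N = carrier L"
      by (auto simp: short_exact_def Hom_iff)
    have "lin M (restr N (a_kernel N L g)) f" by (rule lin_into[OF fg(1)]) (use fg(4) in simp)
    from iso_mem[OF sc *(1) restr_mods[OF *(3) sub_kernel[OF *(3) mods[OF *(2)] fg(2)]] this fg(3)]
    have "restr N (a_kernel N L g) \<in> C" using fg(4) by simp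
    then show "N \<in> C" by (rule ext[OF *(3,2) fg(2,5)])
  qed
qed (rule sc)

subsection \<open>The map \<open>\<alpha>\<close>\<close>

lemma alpha_iff:
  assumes T: "T \<in> tors A"
  shows "M \<in> alpha A T \<longleftrightarrow> M \<in> T \<and> (\<forall>N\<in>T. \<forall>g. lin N M g \<longrightarrow> restr N (a_kernel N M g) \<in> T)"
proof
  assume M: "M \<in> alpha A T"
  have "restr N (a_kernel N M g) \<in> T" if "N \<in> T" "lin N M g" for N g
  proof -
    have "ker_mod N M (restrict g (carrier N)) \<in> T"
      using M that(1) Hom_restrict[OF tors_mods[OF T that(1)] that(2)] unfolding alpha_def by blast
    then show ?thesis by (simp add: ker_mod_eq)
  qed
  then show "M \<in> T \<and> (\<forall>N\<in>T. \<forall>g. lin N M g \<longrightarrow> restr N (a_kernel N M g) \<in> T)"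
    using M by (simp add: alpha_def)
next
  assume "M \<in> T \<and> (\<forall>N\<in>T. \<forall>g. lin N M g \<longrightarrow> restr N (a_kernel N M g) \<in> T)"
  then show "M \<in> alpha A T" by (auto simp: alpha_def ker_mod_eq Hom_iff)
qed

lemma alpha_kernel_tors:
  "T \<in> tors A \<Longrightarrow> M \<in> alpha A T \<Longrightarrow> N \<in> T \<Longrightarrow> lin N M g \<Longrightarrow> restr N (a_kernel N M g) \<in> T"
  by (simp add: alpha_iff)

lemma alpha_subset: "alpha A T \<subseteq> T"
  by (auto simp: alpha_def)

lemma alphaI:
  "T \<in> tors A \<Longrightarrow> M \<in> T \<Longrightarrow>
   (\<And>N g. N \<in> T \<Longrightarrow> lin N M g \<Longrightarrow> restr N (a_kernel N M g) \<in> T) \<Longrightarrow> M \<in> alpha A T"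
  by (simp add: alpha_iff)

text \<open>In the pullback, the projection to \<open>N\<close> is onto with kernel a copy of
  \<open>I\<close>, so the pullback lies in \<open>T\<close>. Its projection to \<open>M\<close>
  then has kernel in \<open>T\<close> because \<open>M\<close> is in \<open>alpha A T\<close>, and
  this kernel maps onto the kernel of \<open>g\<close>.\<close>

lemma alpha_quotient:
  assumes T: "T \<in> tors A" and M: "M \<in> alpha A T" and I: "sub M I" "restr M I \<in> T"
  shows "quo M I \<in> alpha A T"
proof (rule alphaI[OF T])
  have MT: "M \<in> T" using M alpha_subset by blast
  have Mm: "M \<in> mods" by (rule tors_mods[OF T MT])
  note Q = quo_mods[OF Mm I(1)] and p = lin_prj[OF Mm I(1)] prj_surj[OF Mm I(1)] prj_eq_zero[OF Mm I(1)]
  show "quo M I \<in> T" by (rule tors_quotient[OF T MT Q p(1,2)])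
  fix N g assume N: "N \<in> T" and g: "lin N (quo M I) g"
  have Nm: "N \<in> mods" by (rule tors_mods[OF T N])
  note NM = Nm Mm
  note [simp] = pair_closed[OF NM] fst_pair[OF NM] snd_pair[OF NM] NM bip_mods[OF NM] Q
    linear_closed[OF lin_fst[OF NM]] linear_closed[OF lin_snd[OF NM]]
    linear_closed[OF p(1)] linear_closed[OF g]
  \<comment> \<open>\<open>V\<close> is the pullback of \<open>g\<close> along the projection \<open>M \<rightarrow> M / I\<close>.\<close>
  define k where "k d = g (fst_bip N M d) \<ominus>\<^bsub>quo M I\<^esub> prj M I (snd_bip N M d)" for d
  have k: "lin (bip N M) (quo M I) k"
    unfolding k_def
    by (intro lin_diff linear_comp[OF lin_fst[OF NM] g] linear_comp[OF lin_snd[OF NM] p(1)]) simp_all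
  define V where "V = a_kernel (bip N M) (quo M I) k"
  have V: "sub (bip N M) V" unfolding V_def by (rule sub_kernel[OF _ _ k]) simp_all
  note Vm = restr_mods[OF bip_mods[OF NM] V]
  have mem: "d \<in> V \<longleftrightarrow> d \<in> carrier (bip N M) \<and> g (fst_bip N M d) = prj M I (snd_bip N M d)" for d
    by (auto simp: V_def k_def mods_diff_eq_zero)
  have Vsub: "V \<subseteq> carrier (bip N M)" by (auto simp: V_def)
  have lf: "lin (restr (bip N M) V) N (fst_bip N M)" and ls: "lin (restr (bip N M) V) M (snd_bip N M)"
    using lin_restr[OF lin_fst[OF NM] Vsub] lin_restr[OF lin_snd[OF NM] Vsub] by auto
  have VT: "restr (bip N M) V \<in> T"
  proof (rule ext_surj[OF tors_ext[OF T] Vm N lf])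
    have "y \<in> fst_bip N M ` V" if y: "y \<in> carrier N" for y
    proof -
      have "g y \<in> carrier (quo M I)" using y by simp
      then obtain x where x: "x \<in> carrier M" "g y = prj M I x" unfolding p(2)[symmetric] by blast
      then show ?thesis using y by (intro image_eqI[where x = "pair N M y x"]) (simp_all add: mem)
    qed
    then show "fst_bip N M ` carrier (restr (bip N M) V) = carrier N" using Vsub by auto
    let ?U = "a_kernel (restr (bip N M) V) N (fst_bip N M)"
    have U: "sub (restr (bip N M) V) ?U" by (rule sub_kernel[OF Vm Nm lf])
    have "g \<zero>\<^bsub>N\<^esub> = \<zero>\<^bsub>quo M I\<^esub>" by (rule lin_zero[OF Nm Q g])
    then have memU: "d \<in> ?U \<longleftrightarrow> d \<in> carrier (bip N M) \<and> fst_bip N M d = \<zero>\<^bsub>N\<^esub> \<and> snd_bip N M d \<in> I" for d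
      using p(3)[of "snd_bip N M d"] by (auto simp: mem)
    have im: "(\<lambda>x. pair N M \<zero>\<^bsub>N\<^esub> x) ` I = ?U"
    proof
      show "?U \<subseteq> (\<lambda>x. pair N M \<zero>\<^bsub>N\<^esub> x) ` I"
      proof
        fix d assume d: "d \<in> ?U"
        then have "d = pair N M \<zero>\<^bsub>N\<^esub> (snd_bip N M d)"
          using pair_fst_snd[OF NM, of d] unfolding memU by simp
        then show "d \<in> (\<lambda>x. pair N M \<zero>\<^bsub>N\<^esub> x) ` I" using d unfolding memU by blast
      qed
      show "(\<lambda>x. pair N M \<zero>\<^bsub>N\<^esub> x) ` I \<subseteq> ?U"
      proof
        fix d assume "d \<in> (\<lambda>x. pair N M \<zero>\<^bsub>N\<^esub> x) ` I"
        then obtain x where "x \<in> I" "d = pair N M \<zero>\<^bsub>N\<^esub> x" by blast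
        then show "d \<in> ?U" unfolding memU using subm_mem[OF I(1)] by simp
      qed
    qed
    have "lin (restr M I) (restr (bip N M) ?U) (\<lambda>x. pair N M \<zero>\<^bsub>N\<^esub> x)"
      by (rule lin_into[OF lin_restr[OF lin_inr[OF NM] subm_subset[OF I(1)]]]) (use im in simp)
    moreover have "restr (bip N M) ?U \<in> mods" using restr_mods[OF Vm U] by simp
    ultimately show "restr (restr (bip N M) V) ?U \<in> T"
      using tors_quotient[OF T I(2), of "restr (bip N M) ?U"] im by simp
  qed
  have kerT: "restr (bip N M) (a_kernel (restr (bip N M) V) M (snd_bip N M)) \<in> T"
    using alpha_kernel_tors[OF T M VT ls] by simp
  let ?U = "a_kernel (restr (bip N M) V) M (snd_bip N M)"
  have U: "sub (restr (bip N M) V) ?U" by (rule sub_kernel[OF Vm Mm ls])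
  have pz: "prj M I \<zero>\<^bsub>M\<^esub> = \<zero>\<^bsub>quo M I\<^esub>" by (rule lin_zero[OF Mm Q p(1)])
  have im: "fst_bip N M ` ?U = a_kernel N (quo M I) g"
  proof
    show "a_kernel N (quo M I) g \<subseteq> fst_bip N M ` ?U"
    proof
      fix y assume "y \<in> a_kernel N (quo M I) g"
      then show "y \<in> fst_bip N M ` ?U"
        by (intro image_eqI[where x = "pair N M y \<zero>\<^bsub>M\<^esub>"]) (auto simp: mem pz)
    qed
  qed (use pz in \<open>auto simp: mem\<close>)
  have UV: "?U \<subseteq> carrier (bip N M)" using Vsub by auto
  have "lin (restr (bip N M) ?U) (restr N (a_kernel N (quo M I) g)) (fst_bip N M)"
    by (rule lin_into[OF lin_restr[OF lin_fst[OF NM] UV]]) (use im in simp)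
  from tors_quotient[OF T kerT restr_mods[OF Nm sub_kernel[OF Nm Q g]] this]
  show "restr N (a_kernel N (quo M I) g) \<in> T" using im by simp
qed

text \<open>A map into a submodule of \<open>M\<close> has the same kernel as its composite with the
  inclusion, so the defining condition is inherited from \<open>M\<close>.\<close>

lemma alpha_kernel:
  assumes T: "T \<in> tors A" and M: "M \<in> alpha A T" and N: "N \<in> T" and g: "lin M N g"
    and kT: "restr M (a_kernel M N g) \<in> T"
  shows "restr M (a_kernel M N g) \<in> alpha A T"
proof (rule alphaI[OF T kT])
  fix Y h assume Y: "Y \<in> T" and h: "lin Y (restr M (a_kernel M N g)) h"
  have "a_kernel M N g \<subseteq> carrier M" by auto
  from linear_comp[OF h lin_incl[OF this]] have "lin Y M h" by simp
  from alpha_kernel_tors[OF T M Y this]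
  show "restr Y (a_kernel Y (restr M (a_kernel M N g)) h) \<in> T" by simp
qed

text \<open>The source may be any object of \<open>T\<close>. The image is the kernel of the
  projection to the quotient by it, and that quotient is in \<open>alpha A T\<close> by
  \<open>alpha_quotient\<close>.\<close>

lemma alpha_image:
  assumes T: "T \<in> tors A" and M: "M \<in> alpha A T" and Y: "Y \<in> T" and g: "lin Y M g"
  shows "restr M (g ` carrier Y) \<in> alpha A T"
proof -
  have Mm: "M \<in> mods" using tors_mods[OF T] M alpha_subset by blast
  note I = sub_range[OF tors_mods[OF T Y] Mm g] tors_image[OF T Y Mm g]
  have Q: "quo M (g ` carrier Y) \<in> T" using alpha_quotient[OF T M I] alpha_subset by blast
  have "a_kernel M (quo M (g ` carrier Y)) (prj M (g ` carrier Y)) = g ` carrier Y"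
    by (rule a_kernel_prj[OF Mm I(1)])
  then show ?thesis using alpha_kernel[OF T M Q lin_prj[OF Mm I(1)]] I(2) by simp
qed

lemma alpha_wide:
  assumes T: "T \<in> tors A"
  shows "alpha A T \<in> wide A"
proof -
  have mods: "M \<in> mods" if "M \<in> alpha A T" for M using that tors_mods[OF T] alpha_subset by blast
  obtain M0 where M0: "M0 \<in> mods" using free_module_exists by blast
  note z = restr_mods[OF M0 sub_zero[OF M0]]
  show ?thesis
  proof (rule wideI[of _ "restr M0 {\<zero>\<^bsub>M0\<^esub>}"])
    show "restr M0 {\<zero>\<^bsub>M0\<^esub>} \<in> alpha A T"
    proof (rule alphaI[OF T tors_zero[OF T z]])
      fix N g assume N: "N \<in> T" and g: "lin N (restr M0 {\<zero>\<^bsub>M0\<^esub>}) g"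
      have "a_kernel N (restr M0 {\<zero>\<^bsub>M0\<^esub>}) g = carrier N" using linear_closed[OF g] by auto
      then show "restr N (a_kernel N (restr M0 {\<zero>\<^bsub>M0\<^esub>}) g) \<in> T" using N by simp
    qed simp
  next
    show "subcategory A (alpha A T)"
      unfolding subcategory_def
    proof (intro conjI ballI impI)
      fix M N assume M: "M \<in> alpha A T" and N: "N \<in> mods" and "module_iso A M N"
      then obtain i where i: "lin M N i" "inj_on i (carrier M)" "i ` carrier M = carrier N"
        by (auto simp: module_iso_def Hom_iff bij_betw_def)
      have MT: "M \<in> T" using M alpha_subset by blast
      have ker: "x = \<zero>\<^bsub>M\<^esub>" if "x \<in> carrier M" "i x = \<zero>\<^bsub>N\<^esub>" for x
        using inj_onD[OF i(2), of x "\<zero>\<^bsub>M\<^esub>"] lin_zero[OF mods[OF M] N i(1)] that mods[OF M] by simp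
      then obtain j where j: "lin N M j" "\<forall>x\<in>carrier M. j (i x) = x"
        using lin_factor[OF mods[OF M] N mods[OF M] i(1,3) lin_id] by blast
      show "N \<in> alpha A T"
      proof (rule alphaI[OF T])
        show "N \<in> T" by (rule tors_quotient[OF T MT N i(1,3)])
        fix Y g assume Y: "Y \<in> T" and g: "lin Y N g"
        have "j (g y) = \<zero>\<^bsub>M\<^esub> \<longleftrightarrow> g y = \<zero>\<^bsub>N\<^esub>" if "y \<in> carrier Y" for y
        proof
          assume *: "j (g y) = \<zero>\<^bsub>M\<^esub>"
          have "g y \<in> carrier N" using linear_closed[OF g that] .
          then obtain x where "x \<in> carrier M" "g y = i x" unfolding i(3)[symmetric] by blast
          then show "g y = \<zero>\<^bsub>N\<^esub>" using j(2) * lin_zero[OF mods[OF M] N i(1)] by simp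
        next
          assume "g y = \<zero>\<^bsub>N\<^esub>"
          then show "j (g y) = \<zero>\<^bsub>M\<^esub>" using lin_zero[OF N mods[OF M] j(1)] by simp
        qed
        then have "a_kernel Y N g = a_kernel Y M (\<lambda>y. j (g y))"
          by - (rule Set.set_eqI, unfold mem_a_kernel, blast)
        then show "restr Y (a_kernel Y N g) \<in> T"
          using alpha_kernel_tors[OF T M Y linear_comp[OF g j(1)]] by simp
      qed
    qed (use mods in blast)
  next
    fix M N g assume *: "M \<in> alpha A T" "N \<in> alpha A T" "lin M N g"
    then have MN: "M \<in> T" "N \<in> T" using alpha_subset by blast+
    show "restr M (a_kernel M N g) \<in> alpha A T"
      using alpha_kernel[OF T *(1) MN(2) *(3)] alpha_kernel_tors[OF T *(2) MN(1) *(3)] by simp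
    show "quo N (g ` carrier M) \<in> alpha A T"
      by (rule alpha_quotient[OF T *(2) sub_range[OF mods[OF *(1)] mods[OF *(2)] *(3)]
            tors_image[OF T MN(1) mods[OF *(2)] *(3)]])
  next
    fix Y L f assume *: "Y \<in> mods" "L \<in> alpha A T" "lin Y L f" "f ` carrier Y = carrier L"
      "restr Y (a_kernel Y L f) \<in> alpha A T"
    have LT: "L \<in> T" and kT: "restr Y (a_kernel Y L f) \<in> T" using *(2,5) alpha_subset by blast+
    show "Y \<in> alpha A T"
    proof (rule alphaI[OF T ext_surj[OF tors_ext[OF T] *(1) LT *(3,4) kT]])
      fix N h assume N: "N \<in> T" and h: "lin N Y h"
      \<comment> \<open>The kernel is taken in two stages: the elements that \<open>h\<close> sends
        into the kernel of \<open>f\<close>, and among these the kernel of \<open>h\<close> as a map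
        to that kernel. Each stage uses one end of the extension.\<close>
      let ?V = "a_kernel N L (\<lambda>x. f (h x))"
      have V: "restr N ?V \<in> T" by (rule alpha_kernel_tors[OF T *(2) N linear_comp[OF h *(3)]])
      have "lin (restr N ?V) (restr Y (a_kernel Y L f)) h"
        by (rule lin_into[OF lin_restr[OF h]]) (use linear_closed[OF h] in auto)
      from alpha_kernel_tors[OF T *(5) V this]
      have "restr N (a_kernel (restr N ?V) Y h) \<in> T" by simp
      moreover have "a_kernel (restr N ?V) Y h = a_kernel N Y h"
        using lin_zero[OF *(1) mods[OF *(2)] *(3)] by auto
      ultimately show "restr N (a_kernel N Y h) \<in> T" by simp
    qed
  qed simp
qed

section \<open>Functorially finite subcategories\<close>

definition "left_approx C M D \<phi> \<longleftrightarrow> D \<in> C \<and> lin M D \<phi> \<and>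
  (\<forall>Y\<in>C. \<forall>f. lin M Y f \<longrightarrow> (\<exists>h. lin D Y h \<and> (\<forall>x\<in>carrier M. h (\<phi> x) = f x)))"

definition "right_approx C M D \<psi> \<longleftrightarrow> D \<in> C \<and> lin D M \<psi> \<and>
  (\<forall>Y\<in>C. \<forall>f. lin Y M f \<longrightarrow> (\<exists>h. lin Y D h \<and> (\<forall>y\<in>carrier Y. \<psi> (h y) = f y)))"

text \<open>Equivalently, the map from the regular module to \<open>P\<close> with
  \<open>\<one> \<mapsto> p\<close> is a left approximation.\<close>

definition "universal T P p \<longleftrightarrow> P \<in> T \<and> p \<in> carrier P \<and>
  (\<forall>Y\<in>T. \<forall>y\<in>carrier Y. \<exists>h. lin P Y h \<and> h p = y)"

lemma left_approxD:
  assumes "left_approx C M D \<phi>"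
  shows "D \<in> C" and "lin M D \<phi>"
    and "Y \<in> C \<Longrightarrow> lin M Y f \<Longrightarrow> \<exists>h. lin D Y h \<and> (\<forall>x\<in>carrier M. h (\<phi> x) = f x)"
  using assms unfolding left_approx_def by blast+

lemma universalD:
  assumes "universal T P p"
  shows "P \<in> T" and "p \<in> carrier P" and "Y \<in> T \<Longrightarrow> y \<in> carrier Y \<Longrightarrow> \<exists>h. lin P Y h \<and> h p = y"
  using assms unfolding universal_def by blast+

text \<open>Passes from linear maps with arbitrary values off the carrier to the extensional maps in
  \<open>Hom\<close>. Restricting each map to its carrier preserves the factorizations.\<close>

lemma functorially_finiteI:
  assumes C: "C \<subseteq> mods"
    and left: "\<And>M. M \<in> mods \<Longrightarrow> \<exists>D \<phi>. left_approx C M D \<phi>"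
    and right: "\<And>M. M \<in> mods \<Longrightarrow> \<exists>D \<psi>. right_approx C M D \<psi>"
  shows "functorially_finite A C"
  unfolding functorially_finite_def
proof
  fix M assume M: "M \<in> mods"
  obtain C1 \<phi> where l: "left_approx C M C1 \<phi>" using left[OF M] by blast
  obtain C2 \<psi> where r: "right_approx C M C2 \<psi>" using right[OF M] by blast
  have C12: "C1 \<in> C" "C2 \<in> C" "lin M C1 \<phi>" "lin C2 M \<psi>"
    using l r unfolding left_approx_def right_approx_def by blast+
  then have m: "C1 \<in> mods" "C2 \<in> mods" using C by blast+
  let ?g1 = "restrict \<phi> (carrier M)" and ?g2 = "restrict \<psi> (carrier C2)"
  show "\<exists>C1\<in>C. \<exists>C2\<in>C. \<exists>g1\<in>Hom A M C1. \<exists>g2\<in>Hom A C2 M. \<forall>D\<in>C.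
      (\<lambda>h. compose (carrier M) h g1) ` Hom A C1 D = Hom A M D \<and>
      (\<lambda>h. compose (carrier D) g2 h) ` Hom A D C2 = Hom A D M"
  proof (rule bexI[of _ C1], rule bexI[of _ C2], rule bexI[of _ ?g1], rule bexI[of _ ?g2], intro ballI conjI)
    fix D assume D: "D \<in> C"
    have Dm: "D \<in> mods" using C D by blast
    show "(\<lambda>h. compose (carrier M) h ?g1) ` Hom A C1 D = Hom A M D"
    proof
      show "(\<lambda>h. compose (carrier M) h ?g1) ` Hom A C1 D \<subseteq> Hom A M D"
      proof
        fix k assume "k \<in> (\<lambda>h. compose (carrier M) h ?g1) ` Hom A C1 D"
        then obtain h where h: "lin C1 D h" "k = compose (carrier M) h ?g1" by (auto simp: Hom_iff)
        then have "k = restrict (\<lambda>x. h (\<phi> x)) (carrier M)"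
          by (auto simp: compose_def restrict_def fun_eq_iff)
        then show "k \<in> Hom A M D" using Hom_restrict[OF M linear_comp[OF C12(3) h(1)]] by simp
      qed
      show "Hom A M D \<subseteq> (\<lambda>h. compose (carrier M) h ?g1) ` Hom A C1 D"
      proof
        fix f assume "f \<in> Hom A M D"
        then have f: "lin M D f" "f \<in> extensional (carrier M)" by (simp_all add: Hom_iff)
        obtain h where h: "lin C1 D h" "\<forall>x\<in>carrier M. h (\<phi> x) = f x"
          using left_approxD(3)[OF l D f(1)] by blast
        have "f = compose (carrier M) (restrict h (carrier C1)) ?g1"
          using f(2) h(2) linear_closed[OF C12(3)]
          by (auto simp: compose_def fun_eq_iff extensional_def)
        then show "f \<in> (\<lambda>h. compose (carrier M) h ?g1) ` Hom A C1 D"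
          using Hom_restrict[OF m(1) h(1)] by blast
      qed
    qed
    show "(\<lambda>h. compose (carrier D) ?g2 h) ` Hom A D C2 = Hom A D M"
    proof
      show "(\<lambda>h. compose (carrier D) ?g2 h) ` Hom A D C2 \<subseteq> Hom A D M"
      proof
        fix k assume "k \<in> (\<lambda>h. compose (carrier D) ?g2 h) ` Hom A D C2"
        then obtain h where h: "lin D C2 h" "k = compose (carrier D) ?g2 h" by (auto simp: Hom_iff)
        then have "k = restrict (\<lambda>x. \<psi> (h x)) (carrier D)"
          using linear_closed[OF h(1)] by (auto simp: compose_def restrict_def fun_eq_iff)
        then show "k \<in> Hom A D M" using Hom_restrict[OF Dm linear_comp[OF h(1) C12(4)]] by simp
      qed
      show "Hom A D M \<subseteq> (\<lambda>h. compose (carrier D) ?g2 h) ` Hom A D C2"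
      proof
        fix f assume "f \<in> Hom A D M"
        then have f: "lin D M f" "f \<in> extensional (carrier D)" by (simp_all add: Hom_iff)
        obtain h where h: "lin D C2 h" "\<forall>x\<in>carrier D. \<psi> (h x) = f x"
          using r D f(1) unfolding right_approx_def by blast
        have "f = compose (carrier D) ?g2 (restrict h (carrier D))"
          using f(2) h(2) linear_closed[OF h(1)]
          by (auto simp: compose_def fun_eq_iff extensional_def)
        then show "f \<in> (\<lambda>h. compose (carrier D) ?g2 h) ` Hom A D C2"
          using Hom_restrict[OF Dm h(1)] by blast
      qed
    qed
  qed (use C12 Hom_restrict[OF M C12(3)] Hom_restrict[OF m(2) C12(4)] in simp_all)
qed

lemma functorially_finite_left_approx:
  assumes C: "C \<subseteq> mods" and ff: "functorially_finite A C" and M: "M \<in> mods"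
  shows "\<exists>D \<phi>. left_approx C M D \<phi>"
proof -
  obtain C1 g1 where *: "C1 \<in> C" "g1 \<in> Hom A M C1"
      "\<And>D. D \<in> C \<Longrightarrow> (\<lambda>h. compose (carrier M) h g1) ` Hom A C1 D = Hom A M D"
    using bspec[OF ff[unfolded functorially_finite_def] M] by blast
  have "\<exists>h. lin C1 Y h \<and> (\<forall>x\<in>carrier M. h (g1 x) = f x)" if Y: "Y \<in> C" and f: "lin M Y f" for Y f
  proof -
    have "restrict f (carrier M) \<in> (\<lambda>h. compose (carrier M) h g1) ` Hom A C1 Y"
      using *(3)[OF Y] Hom_restrict[OF M f] by simp
    then obtain h where h: "lin C1 Y h" "restrict f (carrier M) = compose (carrier M) h g1"
      by (auto simp: Hom_iff)
    have "h (g1 x) = f x" if "x \<in> carrier M" for x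
      using fun_cong[OF h(2), of x] that by (simp add: compose_eq)
    then show ?thesis using h(1) by blast
  qed
  then have "left_approx C M C1 g1" using *(1,2) by (auto simp: left_approx_def Hom_iff)
  then show ?thesis by blast
qed

section \<open>Universal elements\<close>

text \<open>An approximation of the free module sends its generator \<open>u\<close> to a universal
  element. It is applied to torsion classes and to wide subcategories.\<close>

lemma left_approx_universal:
  assumes C: "C \<subseteq> mods" and approx: "\<And>M. M \<in> mods \<Longrightarrow> \<exists>D \<phi>. left_approx C M D \<phi>"
  shows "\<exists>P p. universal C P p"
proof -
  obtain M u where M: "M \<in> mods" and u: "u \<in> carrier M"
    and free: "\<And>N y. N \<in> mods \<Longrightarrow> y \<in> carrier N \<Longrightarrow> \<exists>h. lin M N h \<and> h u = y"
    using free_module_exists by metis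
  obtain P \<phi> where P: "left_approx C M P \<phi>"
    using approx[OF M] by blast
  have "\<exists>h. lin P Y h \<and> h (\<phi> u) = y" if Y: "Y \<in> C" and y: "y \<in> carrier Y" for Y y
  proof -
    have "Y \<in> mods" using C Y by blast
    then obtain f where f: "lin M Y f" "f u = y" using free[OF _ y] by blast
    then show ?thesis using left_approxD(3)[OF P Y f(1)] u by force
  qed
  then have "universal C P (\<phi> u)"
    using left_approxD(1)[OF P] linear_closed[OF left_approxD(2)[OF P] u] by (simp add: universal_def)
  then show ?thesis by blast
qed

text \<open>Every element of \<open>Y\<close> lies in the image of a map from \<open>P\<close>,
  hence in the radical of \<open>Y\<close>. So inclusion of \<open>T\<close> in another torsion
  class is decided by the single module \<open>P\<close>.\<close>

lemma universal_subset:
  assumes T: "T \<subseteq> mods" and P: "universal T P p" and T0: "T0 \<in> tors A" and "P \<in> T0"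
  shows "T \<subseteq> T0"
proof
  fix Y assume Y: "Y \<in> T"
  then have Ym: "Y \<in> mods" using T by blast
  have "y \<in> rad T0 Y" if y: "y \<in> carrier Y" for y
  proof -
    obtain h where h: "lin P Y h" "h p = y" using universalD(3)[OF P Y y] by blast
    then show ?thesis using rad_image[OF T0 Ym assms(4) h(1) universalD(2)[OF P]] by simp
  qed
  then show "Y \<in> T0" by (intro rad_eq_carrier[OF T0 Ym] subsetI)
qed

text \<open>The pushout of \<open>\<phi>\<close> along \<open>s\<close>, that is, \<open>C\<close>
  modulo the image of the kernel of \<open>s\<close>, is an approximation of \<open>M\<close>; being
  a quotient of \<open>C\<close>, it stays in \<open>T\<close>.\<close>

lemma left_approx_quotient:
  assumes T: "T \<in> tors A" and L: "L \<in> mods" and M: "M \<in> mods"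
    and s: "lin L M s" "s ` carrier L = carrier M" and C: "left_approx T L C \<phi>"
  shows "\<exists>D \<psi>. left_approx T M D \<psi>"
proof -
  note CT = left_approxD(1)[OF C] and \<phi> = left_approxD(2)[OF C]
  have Cm: "C \<in> mods" by (rule tors_mods[OF T CT])
  have k: "sub L (a_kernel L M s)" by (rule sub_kernel[OF L M s(1)])
  define U where "U = \<phi> ` a_kernel L M s"
  have U: "sub C U" unfolding U_def by (rule sub_image[OF L Cm \<phi> k])
  note Q = quo_mods[OF Cm U] and p = lin_prj[OF Cm U] prj_surj[OF Cm U] prj_eq_zero[OF Cm U]
  have "prj C U (\<phi> x) = \<zero>\<^bsub>quo C U\<^esub>" if "x \<in> carrier L" "s x = \<zero>\<^bsub>M\<^esub>" for x
    using that p(3)[OF linear_closed[OF \<phi> that(1)]] by (simp add: U_def)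
  then obtain \<psi> where \<psi>: "lin M (quo C U) \<psi>" "\<forall>x\<in>carrier L. \<psi> (s x) = prj C U (\<phi> x)"
    using lin_factor[OF L M Q s linear_comp[OF \<phi> p(1)]] by blast
  have "\<exists>h. lin (quo C U) Y h \<and> (\<forall>x\<in>carrier M. h (\<psi> x) = f x)" if Y: "Y \<in> T" and f: "lin M Y f" for Y f
  proof -
    have Ym: "Y \<in> mods" by (rule tors_mods[OF T Y])
    obtain h where h: "lin C Y h" "\<forall>x\<in>carrier L. h (\<phi> x) = f (s x)"
      using left_approxD(3)[OF C Y linear_comp[OF s(1) f]] by blast
    have "h y = \<zero>\<^bsub>Y\<^esub>" if "y \<in> carrier C" "prj C U y = \<zero>\<^bsub>quo C U\<^esub>" for y
    proof -
      have "y \<in> U" using p(3)[OF that(1)] that(2) by simp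
      then obtain x where "x \<in> carrier L" "s x = \<zero>\<^bsub>M\<^esub>" "y = \<phi> x" unfolding U_def by auto
      then show ?thesis using h(2) lin_zero[OF M Ym f] by simp
    qed
    then obtain h' where h': "lin (quo C U) Y h'" "\<forall>y\<in>carrier C. h' (prj C U y) = h y"
      using lin_factor[OF Cm Q Ym p(1,2) h(1)] by blast
    have "h' (\<psi> x) = f x" if "x \<in> carrier M" for x
    proof -
      obtain l where "l \<in> carrier L" "x = s l" using \<open>x \<in> carrier M\<close> unfolding s(2)[symmetric] by blast
      then show ?thesis using \<psi>(2) h'(2) h(2) linear_closed[OF \<phi>] by simp
    qed
    then show ?thesis using h'(1) by blast
  qed
  then have "left_approx T M (quo C U) \<psi>"
    unfolding left_approx_def using tors_quotient[OF T CT Q p(1,2)] \<psi>(1) by blast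
  then show ?thesis by blast
qed

lemma left_approx_bip:
  assumes T: "T \<in> tors A" and M: "M \<in> mods" "left_approx T M C \<phi>" and N: "N \<in> mods" "left_approx T N D \<psi>"
  shows "\<exists>E \<chi>. left_approx T (bip M N) E \<chi>"
proof -
  note MN = M(1) N(1) and CD = left_approxD(1)[OF M(2)] left_approxD(1)[OF N(2)]
  note CDm = tors_mods[OF T CD(1)] tors_mods[OF T CD(2)]
  note \<phi> = left_approxD(2)[OF M(2)] and \<psi> = left_approxD(2)[OF N(2)]
  let ?\<chi> = "\<lambda>d. pair C D (\<phi> (fst_bip M N d)) (\<psi> (snd_bip M N d))"
  note l = linear_comp[OF lin_fst[OF MN] \<phi>] linear_comp[OF lin_snd[OF MN] \<psi>]
  have "\<exists>h. lin (bip C D) Y h \<and> (\<forall>d\<in>carrier (bip M N). h (?\<chi> d) = f d)"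
    if Y: "Y \<in> T" and f: "lin (bip M N) Y f" for Y f
  proof -
    have Ym: "Y \<in> mods" by (rule tors_mods[OF T Y])
    obtain h where h: "lin C Y h" "\<forall>x\<in>carrier M. h (\<phi> x) = f (pair M N x \<zero>\<^bsub>N\<^esub>)"
      using left_approxD(3)[OF M(2) Y linear_comp[OF lin_inl[OF MN] f]] by blast
    obtain k where k: "lin D Y k" "\<forall>y\<in>carrier N. k (\<psi> y) = f (pair M N \<zero>\<^bsub>M\<^esub> y)"
      using left_approxD(3)[OF N(2) Y linear_comp[OF lin_inr[OF MN] f]] by blast
    let ?h = "\<lambda>d. h (fst_bip C D d) \<oplus>\<^bsub>Y\<^esub> k (snd_bip C D d)"
    have "?h (?\<chi> d) = f d" if d: "d \<in> carrier (bip M N)" for d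
    proof -
      have c: "fst_bip M N d \<in> carrier M" "snd_bip M N d \<in> carrier N"
        using linear_closed[OF lin_fst[OF MN] d] linear_closed[OF lin_snd[OF MN] d] by auto
      then have "?h (?\<chi> d) = f (pair M N (fst_bip M N d) \<zero>\<^bsub>N\<^esub>) \<oplus>\<^bsub>Y\<^esub> f (pair M N \<zero>\<^bsub>M\<^esub> (snd_bip M N d))"
        using h(2) k(2) linear_closed[OF \<phi>] linear_closed[OF \<psi>]
        by (simp add: fst_pair[OF CDm] snd_pair[OF CDm])
      also have "\<dots> = f (pair M N (fst_bip M N d) \<zero>\<^bsub>N\<^esub> \<oplus>\<^bsub>bip M N\<^esub> pair M N \<zero>\<^bsub>M\<^esub> (snd_bip M N d))"
        using c MN by (simp add: linear_add[OF f] pair_closed[OF MN])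
      also have "\<dots> = f d" by (simp add: bip_split[OF MN d])
      finally show ?thesis .
    qed
    then show ?thesis using lin_copair[OF CDm Ym h(1) k(1)] by blast
  qed
  then have "left_approx T (bip M N) (bip C D) ?\<chi>"
    unfolding left_approx_def
    using bip_mem[OF tors_ext[OF T] CD] lin_pair[OF CDm bip_mods[OF MN] l] by blast
  then show ?thesis by blast
qed

text \<open>A finitely generated module is reached from zero by passing repeatedly from
  \<open>U\<close> to a quotient of \<open>U \<oplus> F\<close> with \<open>F\<close> free on one
  generator. Left approximations survive both operations.\<close>

lemma universal_left_approx:
  assumes T: "T \<in> tors A" and P: "universal T P p" and M: "M \<in> mods"
  shows "\<exists>D \<phi>. left_approx T M D \<phi>"
proof -
  obtain F u where F: "F \<in> mods" and u: "u \<in> carrier F"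
    and gen: "\<And>U. sub F U \<Longrightarrow> u \<in> U \<Longrightarrow> U = carrier F"
    and free: "\<And>N y. N \<in> mods \<Longrightarrow> y \<in> carrier N \<Longrightarrow> \<exists>h. lin F N h \<and> h u = y"
    using free_module_exists by metis
  have Pm: "P \<in> mods" by (rule tors_mods[OF T universalD(1)[OF P]])
  obtain i where i: "lin F P i" "i u = p" using free[OF Pm universalD(2)[OF P]] by blast
  have "\<exists>h. lin P Y h \<and> (\<forall>x\<in>carrier F. h (i x) = f x)" if Y: "Y \<in> T" and f: "lin F Y f" for Y f
  proof -
    have Ym: "Y \<in> mods" by (rule tors_mods[OF T Y])
    obtain h where h: "lin P Y h" "h p = f u"
      using universalD(3)[OF P Y linear_closed[OF f u]] by blast
    \<comment> \<open>The two maps agree at \<open>u\<close>, so the kernel of their difference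
      contains a generator of \<open>F\<close>.\<close>
    let ?d = "\<lambda>x. h (i x) \<ominus>\<^bsub>Y\<^esub> f x"
    have d: "lin F Y ?d" by (rule lin_diff[OF F Ym linear_comp[OF i(1) h(1)] f])
    have "u \<in> a_kernel F Y ?d" using u h(2) i(2) linear_closed[OF f u] Ym by simp
    from gen[OF sub_kernel[OF F Ym d] this] have "x \<in> a_kernel F Y ?d" if "x \<in> carrier F" for x
      using that by simp
    then have "h (i x) \<ominus>\<^bsub>Y\<^esub> f x = \<zero>\<^bsub>Y\<^esub>" if "x \<in> carrier F" for x
      using that unfolding mem_a_kernel by blast
    then have "h (i x) = f x" if "x \<in> carrier F" for x
      using mods_diff_eq_zero[OF Ym linear_closed[OF h(1) linear_closed[OF i(1) that]]
          linear_closed[OF f that]] that by blast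
    then show ?thesis using h(1) by blast
  qed
  then have F_approx: "left_approx T F P i" using universalD(1)[OF P] i(1) by (simp add: left_approx_def)
  let ?good = "\<lambda>U. \<exists>D \<phi>. left_approx T (restr M U) D \<phi>"
  have "restr M {\<zero>\<^bsub>M\<^esub>} \<in> T" by (rule tors_zero[OF T restr_mods[OF M sub_zero[OF M]]]) simp
  then have "left_approx T (restr M {\<zero>\<^bsub>M\<^esub>}) (restr M {\<zero>\<^bsub>M\<^esub>}) (\<lambda>x. x)"
    using lin_id unfolding left_approx_def by blast
  then have "?good {\<zero>\<^bsub>M\<^esub>}" by blast
  from sub_maximal[where P = ?good, OF M sub_zero[OF M] this]
  obtain U where U0: "sub M U \<and> ?good U \<and> (\<forall>V. sub M V \<longrightarrow> ?good V \<longrightarrow> U \<subseteq> V \<longrightarrow> V = U)"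
    by (rule exE)
  note U = conjunct1[OF U0] conjunct1[OF conjunct2[OF U0]] and max = conjunct2[OF conjunct2[OF U0]]
  have Um: "restr M U \<in> mods" by (rule restr_mods[OF M U(1)])
  have "x \<in> U" if x: "x \<in> carrier M" for x
  proof -
    obtain h where h: "lin F M h" "h u = x" using free[OF M x] by blast
    note UF = Um F
    \<comment> \<open>The image of this map is \<open>U\<close> plus the submodule generated by
      \<open>x\<close>.\<close>
    let ?s = "\<lambda>d. fst_bip (restr M U) F d \<oplus>\<^bsub>M\<^esub> h (snd_bip (restr M U) F d)"
    have s: "lin (bip (restr M U) F) M ?s"
      by (rule lin_copair[OF UF M lin_incl[OF subm_subset[OF U(1)]] h(1)])
    let ?V = "?s ` carrier (bip (restr M U) F)"
    have V: "sub M ?V" by (rule sub_range[OF bip_mods[OF UF] M s])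
    obtain D \<phi> where "left_approx T (restr M U) D \<phi>" using U(2) by blast
    from left_approx_bip[OF T Um this F F_approx]
    obtain E \<chi> where "left_approx T (bip (restr M U) F) E \<chi>" by blast
    from left_approx_quotient[OF T bip_mods[OF UF] restr_mods[OF M V] lin_into[OF s subset_refl] _ this]
    have "?good ?V" by simp
    moreover have "U \<subseteq> ?V"
    proof
      fix y assume y: "y \<in> U"
      then have yM: "y \<in> carrier M" by (rule subm_mem[OF U(1)])
      show "y \<in> ?V"
        by (rule image_eqI[where x = "pair (restr M U) F y \<zero>\<^bsub>F\<^esub>"])
           (use y yM F M fst_pair[OF UF] snd_pair[OF UF] pair_closed[OF UF] lin_zero[OF F M h(1)] in simp_all)
    qed
    ultimately have "?V = U" by (rule max[rule_format, OF V])
    moreover have "x \<in> ?V"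
      by (rule image_eqI[where x = "pair (restr M U) F \<zero>\<^bsub>M\<^esub> u"])
         (use x u F M fst_pair[OF UF, of "\<zero>\<^bsub>M\<^esub>" u] snd_pair[OF UF, of "\<zero>\<^bsub>M\<^esub>" u]
            pair_closed[OF UF, of "\<zero>\<^bsub>M\<^esub>" u] subm_zero[OF U(1)] h(2) in simp_all)
    ultimately show "x \<in> U" by simp
  qed
  then have "U = carrier M" using subm_subset[OF U(1)] by blast
  then show ?thesis using U(2) by simp
qed

text \<open>Every map from an object of \<open>T\<close> to \<open>M\<close> has its image in the
  radical, so the inclusion of the radical is a right approximation.\<close>

lemma universal_functorially_finite:
  assumes T: "T \<in> tors A" and P: "universal T P p"
  shows "functorially_finite A T"
proof (rule functorially_finiteI)
  fix M assume M: "M \<in> mods"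
  show "\<exists>D \<phi>. left_approx T M D \<phi>" by (rule universal_left_approx[OF T P M])
  note R = subm_subset[OF rad_sub[OF T M]]
  have "right_approx T M (restr M (rad T M)) (\<lambda>x. x)"
    unfolding right_approx_def
  proof (intro conjI ballI allI impI rad_mem[OF T M] lin_incl[OF R])
    fix Y f assume Y: "Y \<in> T" and f: "lin Y M f"
    have "lin Y (restr M (rad T M)) f"
      by (rule lin_into[OF f]) (use rad_image[OF T M Y f] in blast)
    then show "\<exists>h. lin Y (restr M (rad T M)) h \<and> (\<forall>y\<in>carrier Y. h y = f y)" by blast
  qed
  then show "\<exists>D \<psi>. right_approx T M D \<psi>" by blast
qed (use tors_mods[OF T] in blast)

lemma functorially_finite_iff:
  assumes T: "T \<in> tors A"
  shows "functorially_finite A T \<longleftrightarrow> (\<exists>P p. universal T P p)"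
proof
  have "T \<subseteq> mods" using tors_mods[OF T] by blast
  then show "\<exists>P p. universal T P p" if "functorially_finite A T"
    using left_approx_universal[of T] functorially_finite_left_approx[OF _ that] by blast
  show "functorially_finite A T" if "\<exists>P p. universal T P p"
    using universal_functorially_finite[OF T] that by blast
qed

section \<open>Torsion classes generated by one module\<close>

text \<open>Here \<open>subm {}\<close> are the additive submonoids: \<open>G\<close> generates \<open>T\<close> in the sense that every object
  of \<open>T\<close> is the sum of the images of maps from \<open>G\<close>.\<close>

lemma universal_from_generator:
  assumes T: "T \<in> tors A" and G: "G \<in> T"
    and gen: "\<And>Y V. Y \<in> T \<Longrightarrow> subm {} Y V \<Longrightarrow>
      (\<And>f x. lin G Y f \<Longrightarrow> x \<in> carrier G \<Longrightarrow> f x \<in> V) \<Longrightarrow> V = carrier Y"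
  shows "\<exists>P p. universal T P p"
proof -
  have Gm: "G \<in> mods" by (rule tors_mods[OF T G])
  obtain n where n: "chain_bound {V. subm Z G V} n"
    using chain_bound_subspaces[OF modsD[OF Gm]] Gm by (auto simp: mod_cat_def)
  \<comment> \<open>The elements of \<open>G\<close> reachable from \<open>p\<close>. For a pointed
    module with \<open>J P p\<close> maximal, all of \<open>G\<close> is reachable: passing to
    \<open>P \<oplus> G\<close> with the point \<open>(p, g)\<close> loses nothing and makes
    \<open>g\<close> reachable by the second projection.\<close>
  define J where "J P p = {h p | h. lin P G h}" for P :: "('a, 'a list) module" and p
  have J: "subm Z G (J P p)" if P: "P \<in> T" and p: "p \<in> carrier P" for P p
  proof (rule submI)
    show "J P p \<subseteq> carrier G"
    proof
      fix y assume "y \<in> J P p"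
      then obtain h where h: "lin P G h" "y = h p" unfolding J_def by blast
      then show "y \<in> carrier G" using linear_closed[OF h(1) p] by simp
    qed
    show "\<zero>\<^bsub>G\<^esub> \<in> J P p"
      unfolding J_def by (rule CollectI, rule exI[of _ "\<lambda>_. \<zero>\<^bsub>G\<^esub>"]) (simp add: lin_const_zero[OF Gm])
  next
    fix x y assume "x \<in> J P p" "y \<in> J P p"
    then obtain h k where h: "lin P G h" "x = h p" and k: "lin P G k" "y = k p" unfolding J_def by blast
    show "x \<oplus>\<^bsub>G\<^esub> y \<in> J P p"
      unfolding J_def h(2) k(2)
      by (rule CollectI, rule exI[of _ "\<lambda>x. h x \<oplus>\<^bsub>G\<^esub> k x"]) (simp add: lin_plus[OF Gm h(1) k(1)])
  next
    fix z x assume z: "z \<in> Z" and "x \<in> J P p"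
    then obtain h where h: "lin P G h" "x = h p" unfolding J_def by blast
    show "z \<odot>\<^bsub>G\<^esub> x \<in> J P p"
      unfolding J_def h(2)
      by (rule CollectI, rule exI[of _ "\<lambda>x. z \<odot>\<^bsub>G\<^esub> h x"]) (simp add: lin_scalar[OF Gm h(1) z])
  qed
  define \<T> where "\<T> = {J P p | P p. P \<in> T \<and> p \<in> carrier P}"
  have \<T>I: "J P p \<in> \<T>" if "P \<in> T" "p \<in> carrier P" for P p
    unfolding \<T>_def using that by blast
  have \<T>D: "\<exists>P p. W = J P p \<and> P \<in> T \<and> p \<in> carrier P" if "W \<in> \<T>" for W
    using that unfolding \<T>_def by (rule CollectD)
  have "\<T> \<subseteq> {V. subm Z G V}"
  proof
    fix W assume "W \<in> \<T>"
    from \<T>D[OF this] show "W \<in> {V. subm Z G V}" by (elim exE conjE) (simp add: J)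
  qed
  from chain_bound_maximal[OF n this \<T>I[OF G mods_zero[OF Gm]]]
  obtain W where W: "W \<in> \<T>" "\<forall>V\<in>\<T>. W \<subseteq> V \<longrightarrow> V = W" by (rule bexE)
  from \<T>D[OF W(1)] obtain P p where WP: "W = J P p" and P: "P \<in> T" "p \<in> carrier P" by (elim exE conjE)
  have max: "V = J P p" if "V \<in> \<T>" "J P p \<subseteq> V" for V
    using W(2) that unfolding WP by simp
  have Pm: "P \<in> mods" by (rule tors_mods[OF T P(1)])
  have all: "\<exists>h. lin P G h \<and> h p = g" if g: "g \<in> carrier G" for g
  proof -
    note PG = Pm Gm
    let ?B = "bip P G" and ?b = "pair P G p g"
    have b: "?b \<in> carrier ?B" by (rule pair_closed[OF PG P(2) g])
    have "J ?B ?b \<in> \<T>" by (rule \<T>I[OF bip_mem[OF tors_ext[OF T] P(1) G] b])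
    moreover have "J P p \<subseteq> J ?B ?b"
    proof
      fix y assume "y \<in> J P p"
      then obtain h where h: "lin P G h" "y = h p" by (auto simp: J_def)
      have "y = h (fst_bip P G ?b)" using h(2) fst_pair[OF PG P(2) g] by simp
      then show "y \<in> J ?B ?b"
        unfolding J_def
        by (intro CollectI exI[of _ "\<lambda>x. h (fst_bip P G x)"]) (simp add: linear_comp[OF lin_fst[OF PG] h(1)])
    qed
    ultimately have "J ?B ?b = J P p" by (rule max)
    moreover have "g \<in> J ?B ?b"
      unfolding J_def
      by (rule CollectI, rule exI[of _ "snd_bip P G"]) (simp add: lin_snd[OF PG] snd_pair[OF PG P(2) g])
    ultimately have "g \<in> J P p" by simp
    then show ?thesis unfolding J_def by blast
  qed
  have "\<exists>h. lin P Y h \<and> h p = y" if Y: "Y \<in> T" and y: "y \<in> carrier Y" for Y y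
  proof -
    have Ym: "Y \<in> mods" by (rule tors_mods[OF T Y])
    \<comment> \<open>The values at \<open>p\<close> form an additive submonoid. It contains the
      image of each map from \<open>G\<close>, because every element of \<open>G\<close> is itself a
      value at \<open>p\<close>.\<close>
    define V where "V = {y \<in> carrier Y. \<exists>h. lin P Y h \<and> h p = y}"
    have "V = carrier Y"
    proof (rule gen[OF Y])
      show "subm {} Y V"
      proof (rule submI)
        show "\<zero>\<^bsub>Y\<^esub> \<in> V"
          unfolding V_def by (rule CollectI, rule conjI[OF mods_zero[OF Ym]], rule exI[of _ "\<lambda>_. \<zero>\<^bsub>Y\<^esub>"])
            (simp add: lin_const_zero[OF Ym])
      next
        fix x x' assume "x \<in> V" "x' \<in> V"
        then obtain h k where h: "lin P Y h" "x = h p" and k: "lin P Y k" "x' = k p" unfolding V_def by blast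
        show "x \<oplus>\<^bsub>Y\<^esub> x' \<in> V"
          unfolding V_def h(2) k(2)
          by (rule CollectI, rule conjI[OF mods_add[OF Ym linear_closed[OF h(1) P(2)] linear_closed[OF k(1) P(2)]]],
              rule exI[of _ "\<lambda>x. h x \<oplus>\<^bsub>Y\<^esub> k x"]) (simp add: lin_plus[OF Ym h(1) k(1)])
      qed (auto simp: V_def)
      fix f x assume f: "lin G Y f" and x: "x \<in> carrier G"
      obtain h where h: "lin P G h" "h p = x" using all[OF x] by blast
      then show "f x \<in> V"
        unfolding V_def
        by (intro CollectI conjI[OF linear_closed[OF f x]] exI[of _ "\<lambda>x. f (h x)"])
          (simp add: linear_comp[OF h(1) f])
    qed
    then show ?thesis using y unfolding V_def by blast
  qed
  then have "universal T P p" using P by (simp add: universal_def)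
  then show ?thesis by blast
qed

section \<open>Functorial finiteness of all torsion classes\<close>

lemma copair_image:
  assumes MN: "M \<in> mods" "N \<in> mods" and L: "L \<in> mods" and f: "lin M L f" and g: "lin N L g"
  shows "f ` carrier M \<subseteq> (\<lambda>d. f (fst_bip M N d) \<oplus>\<^bsub>L\<^esub> g (snd_bip M N d)) ` carrier (bip M N)"
    and "g ` carrier N \<subseteq> (\<lambda>d. f (fst_bip M N d) \<oplus>\<^bsub>L\<^esub> g (snd_bip M N d)) ` carrier (bip M N)"
proof -
  note [simp] = MN L pair_closed[OF MN] fst_pair[OF MN] snd_pair[OF MN] lin_zero[OF _ _ f] lin_zero[OF _ _ g]
    linear_closed[OF f] linear_closed[OF g]
  show "f ` carrier M \<subseteq> (\<lambda>d. f (fst_bip M N d) \<oplus>\<^bsub>L\<^esub> g (snd_bip M N d)) ` carrier (bip M N)"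
  proof
    fix y assume "y \<in> f ` carrier M"
    then obtain x where "x \<in> carrier M" "y = f x" by blast
    then show "y \<in> (\<lambda>d. f (fst_bip M N d) \<oplus>\<^bsub>L\<^esub> g (snd_bip M N d)) ` carrier (bip M N)"
      by (intro image_eqI[where x = "pair M N x \<zero>\<^bsub>N\<^esub>"]) simp_all
  qed
  show "g ` carrier N \<subseteq> (\<lambda>d. f (fst_bip M N d) \<oplus>\<^bsub>L\<^esub> g (snd_bip M N d)) ` carrier (bip M N)"
  proof
    fix y assume "y \<in> g ` carrier N"
    then obtain x where "x \<in> carrier N" "y = g x" by blast
    then show "y \<in> (\<lambda>d. f (fst_bip M N d) \<oplus>\<^bsub>L\<^esub> g (snd_bip M N d)) ` carrier (bip M N)"
      by (intro image_eqI[where x = "pair M N \<zero>\<^bsub>M\<^esub> x"]) simp_all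
  qed
qed

section \<open>Presentations with kernel in the torsion class\<close>

text \<open>With \<open>R = P / A p\<close>, the module \<open>P \<oplus> R\<close> plays the role of the Ext-progenerator of \<open>T\<close>: if every
  map \<open>R \<rightarrow> Y\<close> factors through \<open>q : Q \<rightarrow> Y\<close>, then every element of the kernel of \<open>q\<close> is the image of
  \<open>p\<close> under a map from \<open>P\<close> to the kernel.\<close>

lemma bongartz_sequence:
  assumes T: "T \<in> tors A" and P: "universal T P p" and QT: "\<Q> \<subseteq> T"
    and PQ: "P \<in> \<Q>" and RQ: "quo P ((\<lambda>a. a \<odot>\<^bsub>P\<^esub> p) ` carrier A) \<in> \<Q>"
    and bip: "\<And>Q Q'. Q \<in> \<Q> \<Longrightarrow> Q' \<in> \<Q> \<Longrightarrow> bip Q Q' \<in> \<Q>" and Y: "Y \<in> T"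
  shows "\<exists>Q\<in>\<Q>. \<exists>q. lin Q Y q \<and> q ` carrier Q = carrier Y \<and> restr Q (a_kernel Q Y q) \<in> T"
proof -
  have Ym: "Y \<in> mods" by (rule tors_mods[OF T Y])
  have Qm: "Q \<in> mods" if "Q \<in> \<Q>" for Q using tors_mods[OF T] QT that by blast
  note Pm = Qm[OF PQ]
  define C where "C = (\<lambda>a. a \<odot>\<^bsub>P\<^esub> p) ` carrier A"
  note C = cyclic_sub[OF Pm universalD(2)[OF P], folded C_def]
  define R where "R = quo P C"
  have RQ': "R \<in> \<Q>" using RQ by (simp add: R_def C_def)
  note Rm = Qm[OF RQ']
  note r = lin_prj[OF Pm C(1), folded R_def] prj_surj[OF Pm C(1), folded R_def]
    prj_eq_zero[OF Pm C(1), folded R_def]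
  \<comment> \<open>A maximal image of an object of \<open>\<Q>\<close> in \<open>Y\<close> is all
    of \<open>Y\<close>, because each element of \<open>Y\<close> is hit by a map from
    \<open>P\<close>, which can be added as a further summand.\<close>
  let ?im = "\<lambda>U. \<exists>Q\<in>\<Q>. \<exists>q. lin Q Y q \<and> q ` carrier Q = U"
  have "?im ((\<lambda>_. \<zero>\<^bsub>Y\<^esub>) ` carrier P)" using PQ lin_const_zero[OF Ym] by blast
  from sub_maximal[where P = ?im, OF Ym sub_range[OF Pm Ym lin_const_zero[OF Ym]] this]
  obtain U where U0: "sub Y U \<and> ?im U \<and> (\<forall>V. sub Y V \<longrightarrow> ?im V \<longrightarrow> U \<subseteq> V \<longrightarrow> V = U)"
    by (rule exE)
  note U = conjunct1[OF U0] conjunct1[OF conjunct2[OF U0]] and max = conjunct2[OF conjunct2[OF U0]]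
  obtain Q1 q1 where Q1: "Q1 \<in> \<Q>" "lin Q1 Y q1" "q1 ` carrier Q1 = U" using U(2) by blast
  have "y \<in> U" if y: "y \<in> carrier Y" for y
  proof -
    obtain h where h: "lin P Y h" "h p = y" using universalD(3)[OF P Y y] by blast
    note QP = Qm[OF Q1(1)] Pm
    let ?c = "\<lambda>d. q1 (fst_bip Q1 P d) \<oplus>\<^bsub>Y\<^esub> h (snd_bip Q1 P d)"
    let ?V = "?c ` carrier (bip Q1 P)"
    have c: "lin (bip Q1 P) Y ?c" by (rule lin_copair[OF QP Ym Q1(2) h(1)])
    have "?im ?V" using bip[OF Q1(1) PQ] c by blast
    moreover have "U \<subseteq> ?V" using copair_image(1)[OF QP Ym Q1(2) h(1)] Q1(3) by simp
    ultimately have "?V = U"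
      using max[rule_format, OF sub_range[OF bip_mods[OF QP] Ym c]] by blast
    moreover have "y \<in> h ` carrier P" using h(2) universalD(2)[OF P] by blast
    ultimately show "y \<in> U" using copair_image(2)[OF QP Ym Q1(2) h(1)] by blast
  qed
  then have Q1_surj: "q1 ` carrier Q1 = carrier Y" using Q1(3) subm_subset[OF U(1)] by blast
  \<comment> \<open>Among the surjections onto \<open>Y\<close>, one with the largest space of
    liftable maps from \<open>R\<close> is taken. If some \<open>f\<close> did not lift, the summand
    \<open>R\<close> with the map \<open>f\<close> could be added, making \<open>f\<close> liftable
    and keeping the old lifts.\<close>
  define I where "I Q q = {f. lin R Y f \<and> (\<exists>g. lin R Q g \<and> (\<forall>x\<in>carrier R. f x = q (g x)))}"
    for Q :: "('a, 'a list) module" and q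
  define \<T> where "\<T> = {I Q q | Q q. Q \<in> \<Q> \<and> lin Q Y q \<and> q ` carrier Q = carrier Y}"
  obtain n where n: "chain_bound {H. hom_subspace R Y H} n"
    using hom_subspace_chain_bound[OF Rm Ym] by blast
  have \<T>D: "\<exists>Q q. H = I Q q \<and> Q \<in> \<Q> \<and> lin Q Y q \<and> q ` carrier Q = carrier Y" if "H \<in> \<T>" for H
    using that unfolding \<T>_def by (rule CollectD)
  have \<T>I: "I Q q \<in> \<T>" if "Q \<in> \<Q>" "lin Q Y q" "q ` carrier Q = carrier Y" for Q q
    unfolding \<T>_def using that by blast
  have "\<T> \<subseteq> {H. hom_subspace R Y H}"
  proof
    fix H assume "H \<in> \<T>"
    from \<T>D[OF this] obtain Q q where "H = I Q q" "Q \<in> \<Q>" "lin Q Y q" by (elim exE conjE)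
    then show "H \<in> {H. hom_subspace R Y H}"
      using hom_subspaceI[OF Rm Ym Qm[of Q], of q] by (simp add: I_def)
  qed
  from chain_bound_maximal[OF n this \<T>I[OF Q1(1,2) Q1_surj]]
  obtain H where H: "H \<in> \<T>" "\<forall>H'\<in>\<T>. H \<subseteq> H' \<longrightarrow> H' = H" by (rule bexE)
  from \<T>D[OF H(1)] obtain Q q where HI: "H = I Q q" and Q: "Q \<in> \<Q>" and q: "lin Q Y q"
    and q_surj: "q ` carrier Q = carrier Y" by (elim exE conjE)
  note Q' = Qm[OF Q]
  have lift: "\<exists>g. lin R Q g \<and> (\<forall>x\<in>carrier R. f x = q (g x))" if f: "lin R Y f" for f
  proof -
    note QR = Q' Rm
    let ?c = "\<lambda>d. q (fst_bip Q R d) \<oplus>\<^bsub>Y\<^esub> f (snd_bip Q R d)"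
    have c: "lin (bip Q R) Y ?c" by (rule lin_copair[OF QR Ym q f])
    have "carrier Y \<subseteq> ?c ` carrier (bip Q R)" using copair_image(1)[OF QR Ym q f] q_surj by simp
    then have "?c ` carrier (bip Q R) = carrier Y" using subm_subset[OF sub_range[OF bip_mods[OF QR] Ym c]] by blast
    then have "I (bip Q R) ?c \<in> \<T>" by (rule \<T>I[OF bip[OF Q RQ'] c])
    moreover have "I Q q \<subseteq> I (bip Q R) ?c"
    proof
      fix k assume "k \<in> I Q q"
      then obtain g where k: "lin R Y k" and g: "lin R Q g" "\<forall>x\<in>carrier R. k x = q (g x)"
        unfolding I_def by blast
      let ?g = "\<lambda>x. pair Q R (g x) \<zero>\<^bsub>R\<^esub>"
      have "\<forall>x\<in>carrier R. k x = ?c (?g x)"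
        using g Rm Ym linear_closed[OF g(1)] linear_closed[OF q]
        by (simp add: fst_pair[OF QR] snd_pair[OF QR] lin_zero[OF Rm Ym f])
      then show "k \<in> I (bip Q R) ?c"
        unfolding I_def using k linear_comp[OF g(1) lin_inl[OF QR]]
        by (intro CollectI conjI exI[of _ ?g]) simp_all
    qed
    ultimately have eq: "I (bip Q R) ?c = I Q q" using H(2) HI by simp
    let ?g = "\<lambda>x. pair Q R \<zero>\<^bsub>Q\<^esub> x"
    have "\<forall>x\<in>carrier R. f x = ?c (?g x)"
      using Q' Ym linear_closed[OF f] by (simp add: fst_pair[OF QR] snd_pair[OF QR] lin_zero[OF Q' Ym q])
    then have "f \<in> I (bip Q R) ?c"
      unfolding I_def using f lin_inr[OF QR] by (intro CollectI conjI exI[of _ ?g]) simp_all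
    then have "f \<in> I Q q" using eq by simp
    then show ?thesis unfolding I_def by blast
  qed
  let ?L = "a_kernel Q Y q"
  have L: "sub Q ?L" by (rule sub_kernel[OF Q' Ym q])
  note Lm = restr_mods[OF Q' L]
  have "l \<in> rad T (restr Q ?L)" if l: "l \<in> ?L" for l
  proof -
    have lQ: "l \<in> carrier Q" "q l = \<zero>\<^bsub>Y\<^esub>" using l by auto
    have QT': "Q \<in> T" using Q QT by blast
    obtain h where h: "lin P Q h" "h p = l" using universalD(3)[OF P QT' lQ(1)] by blast
    \<comment> \<open>\<open>q \<circ> h\<close> sends \<open>p\<close> to \<open>q l\<close>, which
      is zero, so it kills the submodule generated by \<open>p\<close> and factors through
      \<open>R\<close>.\<close>
    have "q (h x) = \<zero>\<^bsub>Y\<^esub>" if x: "x \<in> carrier P" "prj P C x = \<zero>\<^bsub>R\<^esub>" for x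
    proof -
      have "x \<in> C" using r(3)[OF x(1)] x(2) by simp
      then obtain a where a: "a \<in> carrier A" "x = a \<odot>\<^bsub>P\<^esub> p" unfolding C_def by blast
      then show ?thesis
        using lQ h(2) Ym by (simp add: linear_smult[OF h(1)] linear_smult[OF q] universalD(2)[OF P])
    qed
    then obtain f where f: "lin R Y f" "\<forall>x\<in>carrier P. f (prj P C x) = q (h x)"
      using lin_factor[OF Pm Rm Ym r(1,2) linear_comp[OF h(1) q]] by blast
    obtain g where g: "lin R Q g" "\<forall>x\<in>carrier R. f x = q (g x)" using lift[OF f(1)] by blast
    \<comment> \<open>The lift \<open>g\<close> corrects \<open>h\<close> so that it lands in the
      kernel of \<open>q\<close>. The value at \<open>p\<close> is still \<open>l\<close>, since
      \<open>p\<close> becomes zero in \<open>R\<close>.\<close>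
    let ?k = "\<lambda>x. h x \<ominus>\<^bsub>Q\<^esub> g (prj P C x)"
    have k: "lin P Q ?k" by (rule lin_diff[OF Pm Q' h(1) linear_comp[OF r(1) g(1)]])
    have "?k ` carrier P \<subseteq> ?L"
    proof
      fix y assume "y \<in> ?k ` carrier P"
      then obtain x where x: "x \<in> carrier P" "y = ?k x" by blast
      note c = linear_closed[OF h(1) x(1)] linear_closed[OF r(1) x(1)]
      note c' = linear_closed[OF g(1) c(2)]
      have "q y = q (h x) \<ominus>\<^bsub>Y\<^esub> q (g (prj P C x))"
        unfolding x(2) by (rule lin_minus[OF Q' Ym q c(1) c'])
      also have "q (g (prj P C x)) = q (h x)" using bspec[OF f(2) x(1)] bspec[OF g(2) c(2)] by simp
      finally have "q y = \<zero>\<^bsub>Y\<^esub>" using linear_closed[OF q c(1)] Ym by simp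
      moreover have "y \<in> carrier Q" using x(2) c(1) c' Q' by simp
      ultimately show "y \<in> ?L" by simp
    qed
    from rad_image[OF T Lm universalD(1)[OF P] lin_into[OF k this] universalD(2)[OF P]]
    have "?k p \<in> rad T (restr Q ?L)" .
    moreover have "prj P C p = \<zero>\<^bsub>R\<^esub>" using r(3)[OF universalD(2)[OF P]] C(2) by simp
    moreover have "l \<ominus>\<^bsub>Q\<^esub> \<zero>\<^bsub>Q\<^esub> = l"
      using mods_diff_add[OF Q' lQ(1) mods_zero[OF Q']] lQ(1) Q' by simp
    ultimately show ?thesis using h(2) by (simp add: lin_zero[OF Rm Q' g(1)])
  qed
  then have "restr Q ?L \<in> T" by (intro rad_eq_carrier[OF T Lm]) auto
  then show ?thesis using Q q q_surj by blast
qed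

section \<open>Descending to a smaller functorially finite torsion class\<close>

text \<open>For \<open>Y \<in> T \<inter> left_perp S\<close> and \<open>q : Q \<rightarrow> Y\<close> as in \<open>bongartz_sequence\<close>, a minimal submodule of \<open>Q\<close> that
  still maps onto \<open>Y\<close> with kernel in \<open>T\<close> has no nonzero map to \<open>S\<close>. So the torsion part of \<open>P \<oplus> R\<close> with
  respect to \<open>T \<inter> left_perp S\<close> generates this torsion class.\<close>

lemma mutation_universal:
  assumes T: "T \<in> tors A" and P: "universal T P p" and S: "S \<in> alpha A T"
    and simple: "\<And>Y g. Y \<in> T \<Longrightarrow> lin Y S g \<Longrightarrow>
      (\<forall>y\<in>carrier Y. g y = \<zero>\<^bsub>S\<^esub>) \<or> g ` carrier Y = carrier S"
  shows "\<exists>G g. universal (T \<inter> left_perp S) G g"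
proof -
  have Sm: "S \<in> mods" using tors_mods[OF T] S alpha_subset by blast
  define T2 where "T2 = T \<inter> left_perp S"
  have T2: "T2 \<in> tors A" unfolding T2_def by (rule tors_Int[OF T left_perp_tors[OF Sm]])
  have PT: "P \<in> T" by (rule universalD(1)[OF P])
  have Pm: "P \<in> mods" by (rule tors_mods[OF T PT])
  define C where "C = (\<lambda>a. a \<odot>\<^bsub>P\<^esub> p) ` carrier A"
  have C: "sub P C" unfolding C_def by (rule cyclic_sub[OF Pm universalD(2)[OF P]])
  define R where "R = quo P C"
  have Rm: "R \<in> mods" unfolding R_def by (rule quo_mods[OF Pm C])
  have RT: "R \<in> T"
    unfolding R_def by (rule tors_quotient[OF T PT quo_mods[OF Pm C] lin_prj[OF Pm C] prj_surj[OF Pm C]])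
  note PR = Pm Rm
  define B where "B = bip P R"
  have Bm: "B \<in> mods" unfolding B_def by (rule bip_mods[OF PR])
  define G where "G = restr B (rad T2 B)"
  have G: "G \<in> T2" unfolding G_def by (rule rad_mem[OF T2 Bm])
  \<comment> \<open>The images of the torsion part of \<open>B\<close> additively generate the
    torsion part of \<open>Q\<close>. This holds for \<open>P\<close> and \<open>R\<close> as direct
    summands of \<open>B\<close>, and passes to direct sums because radicals are functorial.\<close>
  define gen where "gen Q \<longleftrightarrow> (\<forall>V. subm {} Q V \<longrightarrow>
      (\<forall>g. lin B Q g \<longrightarrow> g ` rad T2 B \<subseteq> V) \<longrightarrow> rad T2 Q \<subseteq> V)" for Q :: "('a, 'a list) module"
  define \<Q> where "\<Q> = {Q \<in> T. gen Q}"
  have "gen P"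
    unfolding gen_def
  proof (intro allI impI subsetI)
    fix V d assume V: "\<forall>g. lin B P g \<longrightarrow> g ` rad T2 B \<subseteq> V" and d: "d \<in> rad T2 P"
    have dP: "d \<in> carrier P" by (rule subm_mem[OF rad_sub[OF T2 Pm] d])
    have "pair P R d \<zero>\<^bsub>R\<^esub> \<in> rad T2 B"
      using rad_map[OF T2 Pm Bm, of "\<lambda>x. pair P R x \<zero>\<^bsub>R\<^esub>", OF _ d] lin_inl[OF PR] by (simp add: B_def)
    moreover have "fst_bip P R ` rad T2 B \<subseteq> V" using V lin_fst[OF PR] by (simp add: B_def)
    ultimately have "fst_bip P R (pair P R d \<zero>\<^bsub>R\<^esub>) \<in> V" by blast
    then show "d \<in> V" using fst_pair[OF PR dP mods_zero[OF Rm]] by simp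
  qed
  then have PQ: "P \<in> \<Q>" using PT by (simp add: \<Q>_def)
  have "gen R"
    unfolding gen_def
  proof (intro allI impI subsetI)
    fix V d assume V: "\<forall>g. lin B R g \<longrightarrow> g ` rad T2 B \<subseteq> V" and d: "d \<in> rad T2 R"
    have dR: "d \<in> carrier R" by (rule subm_mem[OF rad_sub[OF T2 Rm] d])
    have "pair P R \<zero>\<^bsub>P\<^esub> d \<in> rad T2 B"
      using rad_map[OF T2 Rm Bm, of "\<lambda>x. pair P R \<zero>\<^bsub>P\<^esub> x", OF _ d] lin_inr[OF PR] by (simp add: B_def)
    moreover have "snd_bip P R ` rad T2 B \<subseteq> V" using V lin_snd[OF PR] by (simp add: B_def)
    ultimately have "snd_bip P R (pair P R \<zero>\<^bsub>P\<^esub> d) \<in> V" by blast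
    then show "d \<in> V" using snd_pair[OF PR mods_zero[OF Pm] dR] by simp
  qed
  then have RQ: "quo P ((\<lambda>a. a \<odot>\<^bsub>P\<^esub> p) ` carrier A) \<in> \<Q>" using RT by (simp add: \<Q>_def R_def C_def)
  have bip: "bip Q1 Q2 \<in> \<Q>" if Q1: "Q1 \<in> \<Q>" and Q2: "Q2 \<in> \<Q>" for Q1 Q2
  proof -
    have QT: "Q1 \<in> T" "Q2 \<in> T" and genQ: "gen Q1" "gen Q2" using Q1 Q2 by (simp_all add: \<Q>_def)
    note Qm = tors_mods[OF T QT(1)] tors_mods[OF T QT(2)]
    note Dm = bip_mods[OF Qm]
    have "gen (bip Q1 Q2)"
      unfolding gen_def
    proof (intro allI impI subsetI)
      fix V d assume V: "subm {} (bip Q1 Q2) V" and im: "\<forall>g. lin B (bip Q1 Q2) g \<longrightarrow> g ` rad T2 B \<subseteq> V"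
        and d: "d \<in> rad T2 (bip Q1 Q2)"
      have part: "k x \<in> V" if M: "M \<in> mods" and genM: "gen M" and k: "lin M (bip Q1 Q2) k" and x: "x \<in> rad T2 M"
        for M k x
      proof -
        define V1 where "V1 = {x \<in> carrier M. k x \<in> V}"
        have "subm {} M V1"
        proof (rule submI)
          show "\<zero>\<^bsub>M\<^esub> \<in> V1" using M lin_zero[OF M Dm k] subm_zero[OF V] by (simp add: V1_def)
        next
          fix x y assume "x \<in> V1" "y \<in> V1"
          then show "x \<oplus>\<^bsub>M\<^esub> y \<in> V1" using M subm_add[OF V] by (simp add: V1_def linear_add[OF k])
        qed (auto simp: V1_def)
        moreover have "g ` rad T2 B \<subseteq> V1" if g: "lin B M g" for g
        proof
          fix y assume "y \<in> g ` rad T2 B"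
          then obtain b where b: "b \<in> rad T2 B" "y = g b" by blast
          have "(\<lambda>x. k (g x)) ` rad T2 B \<subseteq> V" using im linear_comp[OF g k] by blast
          then have "k (g b) \<in> V" using b(1) by blast
          then show "y \<in> V1" using b linear_closed[OF g subm_mem[OF rad_sub[OF T2 Bm] b(1)]] by (simp add: V1_def)
        qed
        ultimately have "rad T2 M \<subseteq> V1" using genM unfolding gen_def by blast
        then show "k x \<in> V" using x by (auto simp: V1_def)
      qed
      have "pair Q1 Q2 (fst_bip Q1 Q2 d) \<zero>\<^bsub>Q2\<^esub> \<in> V"
        by (rule part[OF Qm(1) genQ(1) lin_inl[OF Qm] rad_map[OF T2 Dm Qm(1) lin_fst[OF Qm] d]])
      moreover have "pair Q1 Q2 \<zero>\<^bsub>Q1\<^esub> (snd_bip Q1 Q2 d) \<in> V"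
        by (rule part[OF Qm(2) genQ(2) lin_inr[OF Qm] rad_map[OF T2 Dm Qm(2) lin_snd[OF Qm] d]])
      ultimately show "d \<in> V"
        using subm_add[OF V] bip_split[OF Qm subm_mem[OF rad_sub[OF T2 Dm] d]] by metis
    qed
    then show ?thesis using bip_mem[OF tors_ext[OF T] QT] by (simp add: \<Q>_def)
  qed
  have QT: "\<Q> \<subseteq> T" by (auto simp: \<Q>_def)
  have "\<exists>P p. universal T2 P p"
  proof (rule universal_from_generator[OF T2 G])
    fix Y V assume Y: "Y \<in> T2" and V: "subm {} Y V" and im: "\<And>f x. lin G Y f \<Longrightarrow> x \<in> carrier G \<Longrightarrow> f x \<in> V"
    have YT: "Y \<in> T" and Yperp: "Y \<in> left_perp S" using Y by (auto simp: T2_def)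
    have Ym: "Y \<in> mods" by (rule tors_mods[OF T YT])
    obtain Q q where Q: "Q \<in> \<Q>" and q: "lin Q Y q" "q ` carrier Q = carrier Y"
      and kT: "restr Q (a_kernel Q Y q) \<in> T"
      using bongartz_sequence[OF T P QT PQ RQ bip YT] by blast
    have QT': "Q \<in> T" and genQ: "gen Q" using Q by (simp_all add: \<Q>_def)
    have Qm: "Q \<in> mods" by (rule tors_mods[OF T QT'])
    let ?K = "a_kernel Q Y q"
    \<comment> \<open>The intersection with \<open>?K\<close> has to stay in \<open>T\<close> so
      that the simplicity of \<open>S\<close> can be applied to it below.\<close>
    let ?good = "\<lambda>U. restr Q U \<in> T \<and> q ` U = carrier Y \<and> restr Q (U \<inter> ?K) \<in> T"
    have "carrier Q \<inter> ?K = ?K" by auto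
    then have "?good (carrier Q)" using QT' q(2) kT by simp
    from sub_minimal[where P = ?good, OF Qm sub_carrier[OF Qm] this]
    obtain U where U0: "sub Q U \<and> ?good U \<and> (\<forall>V. sub Q V \<longrightarrow> ?good V \<longrightarrow> V \<subseteq> U \<longrightarrow> V = U)"
      by (rule exE)
    note U = conjunct1[OF U0] and good = conjunct1[OF conjunct2[OF U0]]
      and min = conjunct2[OF conjunct2[OF U0]]
    have UQ: "U \<subseteq> carrier Q" by (rule subm_subset[OF U])
    note Um = restr_mods[OF Qm U]
    have KQ: "sub Q ?K" by (rule sub_kernel[OF Qm Ym q(1)])
    have "restr Q U \<in> left_perp S"
    proof (rule left_perpI[OF Um])
      fix g y assume g: "lin (restr Q U) S g" and y: "y \<in> carrier (restr Q U)"
      have qU: "lin (restr Q U) Y q" by (rule lin_restr[OF q(1) UQ])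
      have gK: "lin (restr Q (U \<inter> ?K)) S g" using lin_restr[OF g, of "U \<inter> ?K"] by simp
      have KT: "restr Q (U \<inter> ?K) \<in> T" using good by simp
      from simple[OF KT gK] show "g y = \<zero>\<^bsub>S\<^esub>"
      proof
        \<comment> \<open>\<open>g\<close> vanishes on the kernel of \<open>q\<close> and so factors
          through \<open>Y\<close>, which has only zero maps to \<open>S\<close>.\<close>
        assume z: "\<forall>x\<in>carrier (restr Q (U \<inter> ?K)). g x = \<zero>\<^bsub>S\<^esub>"
        have "g x = \<zero>\<^bsub>S\<^esub>" if "x \<in> carrier (restr Q U)" "q x = \<zero>\<^bsub>Y\<^esub>" for x
          using bspec[OF z, of x] that UQ by auto
        moreover have "q ` carrier (restr Q U) = carrier Y" using good by simp
        ultimately obtain h where h: "lin Y S h" "\<forall>x\<in>carrier (restr Q U). h (q x) = g x"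
          using lin_factor[OF Um Ym Sm qU _ g] by blast
        then show ?thesis using left_perpD[OF Yperp h(1) linear_closed[OF qU y]] y by simp
      next
        \<comment> \<open>Every \<open>x\<close> in \<open>U\<close> can be moved into the kernel of
          \<open>g\<close> by subtracting an element of \<open>?K\<close>, without changing
          \<open>q x\<close>. So the kernel of \<open>g\<close> still maps onto \<open>Y\<close>.
          The conditions on \<open>T\<close> persist because \<open>S\<close> is in
          \<open>alpha A T\<close>, and minimality of \<open>U\<close> forces \<open>g\<close> to
          vanish.\<close>
        assume surj: "g ` carrier (restr Q (U \<inter> ?K)) = carrier S"
        define U' where "U' = a_kernel (restr Q U) S g"
        have U'U: "U' \<subseteq> U" by (auto simp: U'_def)
        have U': "sub Q U'"
          using sub_kernel[OF Um Sm g] sub_restr_iff[OF UQ] by (simp add: U'_def)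
        have "restr Q U' \<in> T" using alpha_kernel_tors[OF T S _ g] good by (simp add: U'_def)
        moreover have "q ` U' = carrier Y"
        proof
          show "q ` U' \<subseteq> carrier Y" using U'U UQ linear_closed[OF q(1)] by blast
          show "carrier Y \<subseteq> q ` U'"
          proof
            fix z assume "z \<in> carrier Y"
            then have "z \<in> q ` U" using good by simp
            then obtain x where x: "x \<in> U" "z = q x" by blast
            have "g x \<in> carrier S" using linear_closed[OF g] x(1) by simp
            then have "g x \<in> g ` (U \<inter> ?K)" using surj by simp
            then obtain l where l: "l \<in> U" "l \<in> ?K" "g x = g l" by blast
            have c: "x \<in> carrier Q" "l \<in> carrier Q" "q l = \<zero>\<^bsub>Y\<^esub>" using x(1) l(1,2) UQ by auto
            have "g (x \<ominus>\<^bsub>restr Q U\<^esub> l) = g x \<ominus>\<^bsub>S\<^esub> g l" by (rule lin_minus[OF Um Sm g]) (use x l in simp_all)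
            moreover have "x \<ominus>\<^bsub>restr Q U\<^esub> l \<in> U" using mods_minus[OF Um, of x l] x(1) l(1) by simp
            moreover have "x \<ominus>\<^bsub>restr Q U\<^esub> l = x \<ominus>\<^bsub>Q\<^esub> l"
              using lin_minus[OF Um Qm lin_incl[OF UQ], of x l] x(1) l(1) by simp
            ultimately have "x \<ominus>\<^bsub>Q\<^esub> l \<in> U'"
              using l(3) linear_closed[OF g, of l] l(1) Sm by (simp add: U'_def)
            moreover have "q (x \<ominus>\<^bsub>Q\<^esub> l) = z"
            proof -
              have "q (x \<ominus>\<^bsub>Q\<^esub> l) = q x \<ominus>\<^bsub>Y\<^esub> \<zero>\<^bsub>Y\<^esub>" using lin_minus[OF Qm Ym q(1) c(1,2)] c(3) by simp
              also have "\<dots> = q x"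
                using mods_diff_add[OF Ym linear_closed[OF q(1) c(1)] mods_zero[OF Ym]]
                  linear_closed[OF q(1) c(1)] Ym by simp
              finally show ?thesis using x(2) by simp
            qed
            ultimately show "z \<in> q ` U'" by blast
          qed
        qed
        moreover have "restr Q (U' \<inter> ?K) \<in> T"
        proof -
          have "a_kernel (restr Q (U \<inter> ?K)) S g = U' \<inter> ?K" by (auto simp: U'_def)
          then show ?thesis using alpha_kernel_tors[OF T S KT gK] by simp
        qed
        ultimately have "U' = U" using min[rule_format, OF U' _ U'U] by blast
        then have "y \<in> U'" using y by simp
        then show ?thesis by (simp add: U'_def)
      qed
    qed
    then have "restr Q U \<in> T2" using good by (simp add: T2_def)
    then have Urad: "U \<subseteq> rad T2 Q" by (rule rad_greatest[OF T2 Qm U])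
    \<comment> \<open>Pulled back along \<open>q\<close>, the submonoid \<open>V\<close> absorbs the
      torsion part of \<open>Q\<close>, which contains \<open>U\<close>; and \<open>U\<close> maps
      onto \<open>Y\<close>.\<close>
    define V' where "V' = {d \<in> carrier Q. q d \<in> V}"
    have "subm {} Q V'"
    proof (rule submI)
      show "\<zero>\<^bsub>Q\<^esub> \<in> V'" using Qm lin_zero[OF Qm Ym q(1)] subm_zero[OF V] by (simp add: V'_def)
    next
      fix x y assume "x \<in> V'" "y \<in> V'"
      then show "x \<oplus>\<^bsub>Q\<^esub> y \<in> V'" using Qm subm_add[OF V] by (simp add: V'_def linear_add[OF q(1)])
    qed (auto simp: V'_def)
    moreover have "g ` rad T2 B \<subseteq> V'" if g: "lin B Q g" for g
    proof
      fix y assume "y \<in> g ` rad T2 B"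
      then obtain b where b: "b \<in> rad T2 B" "y = g b" by blast
      have "lin G Y (\<lambda>x. q (g x))"
        unfolding G_def by (rule lin_restr[OF linear_comp[OF g q(1)] subm_subset[OF rad_sub[OF T2 Bm]]])
      from im[OF this, of b] have "q (g b) \<in> V" using b(1) by (simp add: G_def)
      then show "y \<in> V'" using b linear_closed[OF g subm_mem[OF rad_sub[OF T2 Bm] b(1)]] by (simp add: V'_def)
    qed
    ultimately have radV': "rad T2 Q \<subseteq> V'" using genQ unfolding gen_def by blast
    show "V = carrier Y"
    proof
      show "carrier Y \<subseteq> V"
      proof
        fix y assume "y \<in> carrier Y"
        then have "y \<in> q ` U" using good by simp
        then show "y \<in> V" using Urad radV' by (auto simp: V'_def)
      qed
    qed (rule subm_subset[OF V])
  qed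
  then show ?thesis by (simp add: T2_def)
qed

section \<open>A simple object separating two torsion classes\<close>

text \<open>A nonzero map to \<open>S\<close> is onto, as its image would otherwise be a shorter
  torsion free object. Its kernel lies in \<open>T\<close>: after division of \<open>Y\<close> by
  the torsion part of the kernel, \<open>S\<close> splits off, and the projection to the complement
  is zero because the complement is torsion free.\<close>

lemma exists_simple:
  assumes T: "T \<in> tors A" and P: "universal T P p" and T0: "T0 \<in> tors A" and "\<not> T \<subseteq> T0"
  shows "\<exists>S\<in>alpha A T. carrier S \<noteq> {\<zero>\<^bsub>S\<^esub>} \<and> T \<inter> T0 \<subseteq> left_perp S \<and>
    (\<forall>Y\<in>T. \<forall>g. lin Y S g \<longrightarrow> (\<forall>y\<in>carrier Y. g y = \<zero>\<^bsub>S\<^esub>) \<or> g ` carrier Y = carrier S)"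
proof -
  note Tm = tors_mods[OF T]
  have Tsub: "T \<subseteq> mods" using Tm by blast
  have PT: "P \<in> T" by (rule universalD(1)[OF P])
  have "P \<notin> T0" using universal_subset[OF Tsub P T0] assms(4) by blast
  define \<F> where "\<F> = {T1 \<in> tors A. T \<inter> T0 \<subseteq> T1 \<and> T1 \<subseteq> T \<and> P \<notin> T1}"
  have "\<exists>T1\<in>\<F>. \<forall>T2\<in>\<F>. T1 \<subseteq> T2 \<longrightarrow> T2 = T1"
  proof (rule subset_Zorn_nonempty)
    have "T \<inter> T0 \<in> \<F>" using tors_Int[OF T T0] \<open>P \<notin> T0\<close> by (simp add: \<F>_def)
    then show "\<F> \<noteq> {}" by blast
  next
    fix \<C> assume ne: "\<C> \<noteq> {}" and chain: "subset.chain \<F> \<C>"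
    have C: "\<C> \<subseteq> \<F>" and ord: "\<And>B D. B \<in> \<C> \<Longrightarrow> D \<in> \<C> \<Longrightarrow> B \<subseteq> D \<or> D \<subseteq> B"
      using chain unfolding subset_chain_def by blast+
    have tC: "B \<in> tors A" if "B \<in> \<C>" for B using C that by (auto simp: \<F>_def)
    obtain B0 where B0: "B0 \<in> \<C>" using ne by blast
    obtain M0 where M0: "M0 \<in> B0" using tC[OF B0] by (auto simp: tors_def)
    have "\<Union>\<C> \<in> tors A"
    proof (rule torsI[of _ M0])
      show "\<Union>\<C> \<subseteq> mods" using tors_mods[OF tC] by blast
      show "M0 \<in> \<Union>\<C>" using B0 M0 by blast
    next
      fix M N p assume "M \<in> \<Union>\<C>" "N \<in> mods" "lin M N p" "p ` carrier M = carrier N"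
      then show "N \<in> \<Union>\<C>" using tors_quotient[OF tC] by blast
    next
      fix Y L f assume *: "Y \<in> mods" "L \<in> \<Union>\<C>" "lin Y L f" "f ` carrier Y = carrier L"
        "restr Y (a_kernel Y L f) \<in> \<Union>\<C>"
      then obtain B D where B: "B \<in> \<C>" "L \<in> B" and D: "D \<in> \<C>" "restr Y (a_kernel Y L f) \<in> D" by blast
      obtain E where E: "E \<in> \<C>" "L \<in> E" "restr Y (a_kernel Y L f) \<in> E"
        using ord[OF B(1) D(1)] B D by blast
      have "Y \<in> E" by (rule ext_surj[OF tors_ext[OF tC[OF E(1)]] *(1) E(2) *(3,4) E(3)])
      then show "Y \<in> \<Union>\<C>" using E(1) by blast
    qed
    moreover have "T \<inter> T0 \<subseteq> \<Union>\<C>" using B0 C by (auto simp: \<F>_def)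
    moreover have "\<Union>\<C> \<subseteq> T" "P \<notin> \<Union>\<C>" using C by (auto simp: \<F>_def)
    ultimately show "\<Union>\<C> \<in> \<F>" by (simp add: \<F>_def)
  qed
  then obtain T1 where "T1 \<in> \<F>" and max: "\<forall>T2\<in>\<F>. T1 \<subseteq> T2 \<longrightarrow> T2 = T1" by (rule bexE)
  then have T1: "T1 \<in> tors A" "T \<inter> T0 \<subseteq> T1" "T1 \<subseteq> T" "P \<notin> T1" by (simp_all add: \<F>_def)
  have maxT1: "T2 = T1 \<or> T \<subseteq> T2" if "T2 \<in> tors A" "T1 \<subseteq> T2" "T2 \<subseteq> T" for T2
  proof (cases "P \<in> T2")
    case True
    then show ?thesis using universal_subset[OF Tsub P that(1)] by blast
  next
    case False
    then have "T2 \<in> \<F>" using that T1(2) unfolding \<F>_def by blast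
    then show ?thesis using max that(2) by blast
  qed
  \<comment> \<open>Nonzero objects of \<open>T\<close> that are torsion free for \<open>T1\<close>.
    The quotient of \<open>P\<close> by its \<open>T1\<close>-radical is one, since \<open>P\<close>
    is not in \<open>T1\<close>.\<close>
  define free where "free S \<longleftrightarrow> S \<in> T \<and> carrier S \<noteq> {\<zero>\<^bsub>S\<^esub>} \<and> T1 \<subseteq> left_perp S" for S
  have Pm: "P \<in> mods" by (rule Tm[OF PT])
  have "\<exists>S. free S"
  proof
    note r = rad_sub[OF T1(1) Pm]
    note Q = quo_mods[OF Pm r]
    have "quo P (rad T1 P) \<in> T" by (rule tors_quotient[OF T PT Q lin_prj[OF Pm r] prj_surj[OF Pm r]])
    moreover have "T1 \<subseteq> left_perp (quo P (rad T1 P))"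
    proof
      fix Y assume Y: "Y \<in> T1"
      show "Y \<in> left_perp (quo P (rad T1 P))"
        by (rule left_perpI[OF tors_mods[OF T1(1) Y]]) (rule quo_rad_zero[OF T1(1) Pm Y])
    qed
    moreover have "carrier (quo P (rad T1 P)) \<noteq> {\<zero>\<^bsub>quo P (rad T1 P)\<^esub>}"
    proof
      assume z: "carrier (quo P (rad T1 P)) = {\<zero>\<^bsub>quo P (rad T1 P)\<^esub>}"
      have "x \<in> rad T1 P" if x: "x \<in> carrier P" for x
        using prj_eq_zero[OF Pm r x] linear_closed[OF lin_prj[OF Pm r] x] z by simp
      then have "P \<in> T1" by (intro rad_eq_carrier[OF T1(1) Pm] subsetI)
      then show False using T1(4) by blast
    qed
    ultimately show "free (quo P (rad T1 P))" by (simp add: free_def)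
  qed
  then obtain S1 where "free S1" by blast
  then have "\<exists>S. free S \<and> (\<forall>S'. free S' \<longrightarrow> len A S \<le> len A S')" by (rule ex_has_least_nat)
  then obtain S where "free S" and least: "\<And>S'. free S' \<Longrightarrow> len A S \<le> len A S'" by blast
  then have S: "S \<in> T" "carrier S \<noteq> {\<zero>\<^bsub>S\<^esub>}" and Sperp: "T1 \<subseteq> left_perp S" by (simp_all add: free_def)
  have Sm: "S \<in> mods" by (rule Tm[OF S(1)])
  have sub_free: "free (restr M I)"
    if M: "M \<in> mods" "T1 \<subseteq> left_perp M" and I: "sub M I" "restr M I \<in> T" "I \<noteq> {\<zero>\<^bsub>M\<^esub>}" for M I
  proof -
    have "T1 \<subseteq> left_perp (restr M I)"
    proof
      fix Y assume Y: "Y \<in> T1"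
      have YM: "Y \<in> left_perp M" using Y M(2) by blast
      show "Y \<in> left_perp (restr M I)"
      proof (rule left_perpI[OF tors_mods[OF T1(1) Y]])
        fix k y assume k: "lin Y (restr M I) k" and y: "y \<in> carrier Y"
        have "lin Y M k" using linear_comp[OF k lin_incl[OF subm_subset[OF I(1)]]] .
        from left_perpD[OF YM this y] show "k y = \<zero>\<^bsub>restr M I\<^esub>" by simp
      qed
    qed
    then show ?thesis using I(2,3) by (simp add: free_def)
  qed
  have simple: "(\<forall>y\<in>carrier Y. g y = \<zero>\<^bsub>S\<^esub>) \<or> g ` carrier Y = carrier S"
    if Y: "Y \<in> T" and g: "lin Y S g" for Y g
  proof (rule disjCI)
    assume ns: "g ` carrier Y \<noteq> carrier S"
    note I = sub_range[OF Tm[OF Y] Sm g]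
    have "g ` carrier Y = {\<zero>\<^bsub>S\<^esub>}"
    proof (rule ccontr)
      assume "g ` carrier Y \<noteq> {\<zero>\<^bsub>S\<^esub>}"
      from least[OF sub_free[OF Sm Sperp I tors_image[OF T Y Sm g] this]] len_restr_less[OF Sm I ns]
      show False by simp
    qed
    then show "\<forall>y\<in>carrier Y. g y = \<zero>\<^bsub>S\<^esub>" by blast
  qed
  have "S \<in> alpha A T"
  proof (rule alphaI[OF T S(1)])
    fix Y g assume Y: "Y \<in> T" and g: "lin Y S g"
    have Ym: "Y \<in> mods" by (rule Tm[OF Y])
    let ?N = "a_kernel Y S g"
    from simple[OF Y g] show "restr Y ?N \<in> T"
    proof
      assume "\<forall>y\<in>carrier Y. g y = \<zero>\<^bsub>S\<^esub>"
      then have "?N = carrier Y" by auto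
      then show ?thesis using Y by simp
    next
      assume g_surj: "g ` carrier Y = carrier S"
      have N: "sub Y ?N" by (rule sub_kernel[OF Ym Sm g])
      note Nm = restr_mods[OF Ym N]
      \<comment> \<open>Two torsion theories are in play: \<open>S\<close> is torsion free for
        \<open>T1\<close>, whereas this radical of the kernel is taken with respect to
        \<open>T\<close>. The goal is that it is the whole kernel.\<close>
      define R where "R = rad T (restr Y ?N)"
      have RN: "R \<subseteq> ?N" using subm_subset[OF rad_sub[OF T Nm]] by (simp add: R_def)
      have R: "sub Y R" using rad_sub[OF T Nm] sub_restr_iff[OF subm_subset[OF N]] by (simp add: R_def)
      have RT: "restr Y R \<in> T" using rad_mem[OF T Nm] by (simp add: R_def)
      define Q where "Q = quo Y R"
      define pr where "pr = prj Y R"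
      have Qm: "Q \<in> mods" and pr: "lin Y Q pr" "pr ` carrier Y = carrier Q"
        and pr0: "\<And>x. x \<in> carrier Y \<Longrightarrow> pr x = \<zero>\<^bsub>Q\<^esub> \<longleftrightarrow> x \<in> R"
        unfolding Q_def pr_def using quo_mods[OF Ym R] lin_prj[OF Ym R] prj_surj[OF Ym R] prj_eq_zero[OF Ym R]
        by blast+
      have QT: "Q \<in> T" by (rule tors_quotient[OF T Y Qm pr])
      have "g x = \<zero>\<^bsub>S\<^esub>" if "x \<in> carrier Y" "pr x = \<zero>\<^bsub>Q\<^esub>" for x
        using pr0[OF that(1)] that(2) RN by auto
      then obtain g' where g': "lin Q S g'" "\<forall>x\<in>carrier Y. g' (pr x) = g x"
        using lin_factor[OF Ym Qm Sm pr g] by blast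
      \<comment> \<open>The kernel of \<open>g'\<close> is torsion free, so it suffices to split off \<open>S\<close> from \<open>Q\<close>.\<close>
      have tf: "k z = \<zero>\<^bsub>Q\<^esub>" if V: "V \<in> T" and k: "lin V Q k" and gk: "\<And>z. z \<in> carrier V \<Longrightarrow> g' (k z) = \<zero>\<^bsub>S\<^esub>"
        and z: "z \<in> carrier V" for V k z
      proof -
        define J where "J = {x \<in> carrier Y. pr x \<in> k ` carrier V}"
        have kI: "sub Q (k ` carrier V)" by (rule sub_range[OF Tm[OF V] Qm k])
        note J = prj_vimage[OF Ym R kI[unfolded Q_def], folded Q_def pr_def, folded J_def]
        have JN: "J \<subseteq> ?N"
        proof
          fix x assume "x \<in> J"
          then obtain v where v: "x \<in> carrier Y" "v \<in> carrier V" "pr x = k v" unfolding J_def by blast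
          have "g x = g' (k v)" using bspec[OF g'(2) v(1)] v(3) by simp
          then show "x \<in> ?N" using gk[OF v(2)] v(1) by simp
        qed
        have "restr Y J \<in> T" by (rule J(4)[OF tors_ext[OF T] RT tors_image[OF T V Qm k]])
        then have "J \<subseteq> R"
          using rad_greatest[OF T Nm, of J] sub_restr_iff[OF subm_subset[OF N]] J(1) JN by (simp add: R_def)
        have "k z \<in> pr ` J" unfolding J(3) using z by blast
        then obtain x where "x \<in> J" "k z = pr x" by blast
        then show ?thesis using \<open>J \<subseteq> R\<close> pr0[OF subm_mem[OF J(1)]] by (metis subsetD)
      qed
      \<comment> \<open>\<open>T1 \<subseteq> T2\<close> by \<open>tf\<close>, and \<open>T2\<close>
        is not all of \<open>T\<close> because the nonzero \<open>Q\<close> has an identity map.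
        Maximality gives \<open>T2 = T1\<close>; as \<open>S\<close> is not in \<open>T1\<close>,
        there must be a nonzero map from \<open>S\<close> to \<open>Q\<close>.\<close>
      define T2 where "T2 = T \<inter> left_perp Q"
      have T2: "T2 \<in> tors A" unfolding T2_def by (rule tors_Int[OF T left_perp_tors[OF Qm]])
      have "T1 \<subseteq> T2"
      proof
        fix V assume V: "V \<in> T1"
        have VT: "V \<in> T" using V T1(3) by blast
        have VS: "V \<in> left_perp S" using V Sperp by blast
        have "V \<in> left_perp Q"
        proof (rule left_perpI[OF Tm[OF VT]])
          fix k y assume k: "lin V Q k" and y: "y \<in> carrier V"
          show "k y = \<zero>\<^bsub>Q\<^esub>"
            by (rule tf[OF VT k _ y]) (rule left_perpD[OF VS linear_comp[OF k g'(1)]])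
        qed
        then show "V \<in> T2" using VT by (simp add: T2_def)
      qed
      have Q_nz: "\<exists>y\<in>carrier Q. y \<noteq> \<zero>\<^bsub>Q\<^esub>"
      proof (rule ccontr)
        assume "\<not> (\<exists>y\<in>carrier Q. y \<noteq> \<zero>\<^bsub>Q\<^esub>)"
        then have "pr x = \<zero>\<^bsub>Q\<^esub>" if "x \<in> carrier Y" for x using linear_closed[OF pr(1) that] by blast
        then have "g x = \<zero>\<^bsub>S\<^esub>" if "x \<in> carrier Y" for x
          using bspec[OF g'(2) that] that lin_zero[OF Qm Sm g'(1)] by simp
        then have "carrier S \<subseteq> {\<zero>\<^bsub>S\<^esub>}" unfolding g_surj[symmetric] by blast
        then show False using S(2) mods_zero[OF Sm] by blast
      qed
      have "\<not> T \<subseteq> T2"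
      proof
        assume "T \<subseteq> T2"
        then have "Q \<in> left_perp Q" using QT by (auto simp: T2_def)
        from left_perp_self[OF Qm this] Q_nz show False by blast
      qed
      then have "T2 = T1" using maxT1[OF T2 \<open>T1 \<subseteq> T2\<close>] by (auto simp: T2_def)
      have "S \<notin> T1"
      proof
        assume "S \<in> T1"
        then have "S \<in> left_perp S" using Sperp by blast
        from left_perp_self[OF Sm this] show False using S(2) by blast
      qed
      then have "S \<notin> left_perp Q" using S(1) \<open>T2 = T1\<close> by (auto simp: T2_def)
      then obtain k s where k: "lin S Q k" and s: "s \<in> carrier S" "k s \<noteq> \<zero>\<^bsub>Q\<^esub>"
        unfolding left_perp_def using Sm by blast
      have T1Q: "T1 \<subseteq> left_perp Q" using \<open>T2 = T1\<close> by (auto simp: T2_def)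
      have kI: "sub Q (k ` carrier S)" by (rule sub_range[OF Sm Qm k])
      have "free (restr Q (k ` carrier S))"
        by (rule sub_free[OF Qm T1Q kI tors_image[OF T S(1) Qm k]]) (use s in blast)
      note gk_simple = simple[OF S(1) linear_comp[OF k g'(1)]]
      have "\<not> (\<forall>y\<in>carrier S. g' (k y) = \<zero>\<^bsub>S\<^esub>)" using tf[OF S(1) k _ s(1)] s(2) by blast
      then have gk_surj: "(\<lambda>x. g' (k x)) ` carrier S = carrier S" using gk_simple by blast
      \<comment> \<open>A nonzero kernel would make the length of \<open>S\<close> smaller than
        itself.\<close>
      have gk0: "x = \<zero>\<^bsub>S\<^esub>" if x: "x \<in> carrier S" "g' (k x) = \<zero>\<^bsub>S\<^esub>" for x
      proof (rule ccontr)
        assume "x \<noteq> \<zero>\<^bsub>S\<^esub>"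
        from len_quotient_less[OF Sm Sm linear_comp[OF k g'(1)] gk_surj x this] show False by simp
      qed
      obtain u where u: "lin S S u" "\<forall>x\<in>carrier S. u (g' (k x)) = x"
        using lin_factor[OF Sm Sm Sm linear_comp[OF k g'(1)] gk_surj lin_id gk0] by blast
      have gku: "g' (k (u y)) = y" if y: "y \<in> carrier S" for y
      proof -
        have "y \<in> (\<lambda>x. g' (k x)) ` carrier S" using y gk_surj by simp
        then obtain x where x: "x \<in> carrier S" "y = g' (k x)" by blast
        then show ?thesis using bspec[OF u(2) x(1)] by simp
      qed
      \<comment> \<open>The projection of \<open>Q\<close> onto the kernel of \<open>g'\<close>
        along the copy of \<open>S\<close>. As \<open>g'\<close> kills its image, \<open>tf\<close>
        makes it zero; hence \<open>g'\<close> is injective and the kernel of \<open>g\<close> is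
        contained in \<open>R\<close>.\<close>
      let ?e = "\<lambda>y. y \<ominus>\<^bsub>Q\<^esub> k (u (g' y))"
      have e: "lin Q Q ?e"
        by (rule lin_diff[OF Qm Qm lin_id linear_comp[OF linear_comp[OF g'(1) u(1)] k]])
      have ge: "g' (?e y) = \<zero>\<^bsub>S\<^esub>" if y: "y \<in> carrier Q" for y
      proof -
        note c = linear_closed[OF g'(1) y]
        have "g' (?e y) = g' y \<ominus>\<^bsub>S\<^esub> g' (k (u (g' y)))"
          by (rule lin_minus[OF Qm Sm g'(1) y linear_closed[OF k linear_closed[OF u(1) c]]])
        then show ?thesis using gku[OF c] c Sm by simp
      qed
      have e0: "?e y = \<zero>\<^bsub>Q\<^esub>" if "y \<in> carrier Q" for y by (rule tf[OF QT e ge that])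
      have "?N \<subseteq> R"
      proof
        fix x assume "x \<in> ?N"
        then have x: "x \<in> carrier Y" "g x = \<zero>\<^bsub>S\<^esub>" by auto
        note c = linear_closed[OF pr(1) x(1)]
        have "g' (pr x) = \<zero>\<^bsub>S\<^esub>" using bspec[OF g'(2) x(1)] x(2) by simp
        then have "k (u (g' (pr x))) = \<zero>\<^bsub>Q\<^esub>"
          by (simp add: lin_zero[OF Sm Sm u(1)] lin_zero[OF Sm Qm k])
        then have "pr x = \<zero>\<^bsub>Q\<^esub>"
          using e0[OF c] mods_diff_eq_zero[OF Qm c mods_zero[OF Qm]] by simp
        then show "x \<in> R" using pr0[OF x(1)] by simp
      qed
      then show ?thesis using RT RN by (metis subset_antisym)
    qed
  qed
  moreover have "T \<inter> T0 \<subseteq> left_perp S" using T1(2) Sperp by blast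
  ultimately show ?thesis using S(2) simple by blast
qed

text \<open>If a minimal functorially finite class \<open>T\<close> above \<open>T0\<close> were
  larger than \<open>T0\<close>, then \<open>T \<inter> left_perp S\<close> would be another such
  class: it still contains \<open>T0\<close>, but not \<open>S\<close>.\<close>

lemma all_tors_universal:
  assumes fin: "finite {T \<in> tors A. functorially_finite A T}" and T0: "T0 \<in> tors A"
  shows "\<exists>P p. universal T0 P p"
proof -
  define F where "F = {T \<in> tors A. functorially_finite A T \<and> T0 \<subseteq> T}"
  obtain M u where M: "M \<in> mods" "u \<in> carrier M"
    "\<forall>N\<in>mods. \<forall>y\<in>carrier N. \<exists>h. lin M N h \<and> h u = y"
    using free_module_exists by blast
  \<comment> \<open>The free module makes \<open>mods\<close> functorially finite, so some class
    above \<open>T0\<close> is available to start from.\<close>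
  have "universal mods M u" unfolding universal_def by (intro conjI M)
  from universal_functorially_finite[OF mods_tors this] have "mods \<in> F"
    using mods_tors tors_mods[OF T0] by (simp add: F_def subsetI)
  then have "F \<noteq> {}" by blast
  have "finite F" by (rule finite_subset[OF _ fin]) (simp add: F_def subset_iff)
  from finite_has_minimal[OF this \<open>F \<noteq> {}\<close>]
  obtain T where "T \<in> F" and min: "\<forall>T'\<in>F. T' \<subseteq> T \<longrightarrow> T = T'" by (rule bexE)
  then have T: "T \<in> tors A" "T0 \<subseteq> T" and "functorially_finite A T" by (simp_all add: F_def)
  then obtain P p where P: "universal T P p" using functorially_finite_iff[OF T(1)] by blast
  have "T \<subseteq> T0"
  proof (rule ccontr)
    assume "\<not> T \<subseteq> T0"
    from exists_simple[OF T(1) P T0 this]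
    obtain S where S: "S \<in> alpha A T" "carrier S \<noteq> {\<zero>\<^bsub>S\<^esub>}" "T \<inter> T0 \<subseteq> left_perp S"
      and simple: "\<forall>Y\<in>T. \<forall>g. lin Y S g \<longrightarrow> (\<forall>y\<in>carrier Y. g y = \<zero>\<^bsub>S\<^esub>) \<or> g ` carrier Y = carrier S"
      by blast
    have ST: "S \<in> T" using S(1) alpha_subset by blast
    have Sm: "S \<in> mods" by (rule tors_mods[OF T(1) ST])
    let ?T = "T \<inter> left_perp S"
    have T': "?T \<in> tors A" by (rule tors_Int[OF T(1) left_perp_tors[OF Sm]])
    have "\<exists>G g. universal ?T G g"
      by (rule mutation_universal[OF T(1) P S(1)]) (use simple in blast)
    then have "functorially_finite A ?T" using functorially_finite_iff[OF T'] by blast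
    moreover have "T0 \<subseteq> ?T" using T(2) S(3) by blast
    ultimately have "?T \<in> F" using T' by (simp add: F_def)
    then have "T = ?T" using bspec[OF min, of ?T] by simp
    then have "S \<in> left_perp S" using ST by blast
    from left_perp_self[OF Sm this] show False using S(2) by blast
  qed
  then have "T = T0" using T(2) by (rule subset_antisym)
  then show ?thesis using P by blast
qed

section \<open>The bijection\<close>

text \<open>Otherwise the \<open>S\<close> of \<open>exists_simple\<close> would lie in
  \<open>T \<inter> T0\<close>, which has only zero maps to \<open>S\<close>, and its identity map
  would vanish.\<close>

lemma alpha_subset_imp_subset:
  assumes T: "T \<in> tors A" and P: "universal T P p" and T0: "T0 \<in> tors A" and "alpha A T \<subseteq> T0"
  shows "T \<subseteq> T0"
proof (rule ccontr)
  assume "\<not> T \<subseteq> T0"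
  from exists_simple[OF T P T0 this]
  obtain S where S: "S \<in> alpha A T" "carrier S \<noteq> {\<zero>\<^bsub>S\<^esub>}" "T \<inter> T0 \<subseteq> left_perp S" by blast
  then have ST: "S \<in> T" "S \<in> T0" using alpha_subset assms(4) by blast+
  then have "S \<in> left_perp S" using S(3) by blast
  from left_perp_self[OF tors_mods[OF T ST(1)] this] show False using S(2) by blast
qed

section \<open>Wide subcategories as values of \<alpha>\<close>

text \<open>The description by \<open>\<Psi>\<close> gives \<open>W \<subseteq> alpha A T\<close>.
  For the converse, \<open>M\<close> is divided by a maximal submodule \<open>I\<close> in
  \<open>W\<close>. The quotient receives only zero maps from \<open>W\<close>, hence from
  \<open>T\<close>, and it lies in \<open>T\<close> itself, so it is zero.\<close>

lemma alpha_surj: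
  assumes W: "W \<in> wide A"
  shows "\<exists>T\<in>tors A. alpha A T = W"
proof -
  note Wm = wide_mods[OF W]
  define T where "T = \<Inter>{T \<in> tors A. W \<subseteq> T}"
  have least: "T \<subseteq> T'" if "T' \<in> tors A" "W \<subseteq> T'" for T' using that by (auto simp: T_def)
  have WT: "W \<subseteq> T" by (auto simp: T_def)
  obtain M0 where M0: "M0 \<in> W" using W by (auto simp: wide_def contains_zero_def)
  have T: "T \<in> tors A"
  proof (rule torsI[of _ M0])
    show "T \<subseteq> mods" using least[OF mods_tors] Wm by blast
    show "M0 \<in> T" using M0 WT by blast
  next
    fix M N p assume *: "M \<in> T" "N \<in> mods" "lin M N p" "p ` carrier M = carrier N"
    show "N \<in> T"
      unfolding T_def
    proof (rule InterI)
      fix T' assume "T' \<in> {T \<in> tors A. W \<subseteq> T}"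
      then show "N \<in> T'" using tors_quotient[of T' M N p] * least by blast
    qed
  next
    fix Y L f assume *: "Y \<in> mods" "L \<in> T" "lin Y L f" "f ` carrier Y = carrier L"
      "restr Y (a_kernel Y L f) \<in> T"
    show "Y \<in> T"
      unfolding T_def
    proof (rule InterI)
      fix T' assume "T' \<in> {T \<in> tors A. W \<subseteq> T}"
      then have T': "T' \<in> tors A" "T \<subseteq> T'" using least by auto
      show "Y \<in> T'" by (rule ext_surj[OF tors_ext[OF T'(1)] *(1) _ *(3,4)]) (use T'(2) *(2,5) in blast)+
    qed
  qed
  \<comment> \<open>\<open>\<Psi>\<close> will turn out to be all of \<open>T\<close>, which replaces an induction along filtrations of the modules in
    \<open>T\<close> by quotients of objects of \<open>W\<close>.\<close>
  define \<Psi> where "\<Psi> = {Y \<in> T. \<forall>M\<in>W. \<forall>g. lin Y M g \<longrightarrow>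
      restr M (g ` carrier Y) \<in> W \<and> restr Y (a_kernel Y M g) \<in> T}"
  have \<Psi>D: "restr M (g ` carrier Y) \<in> W" "restr Y (a_kernel Y M g) \<in> T"
    if "Y \<in> \<Psi>" "M \<in> W" "lin Y M g" for Y M g
    using that unfolding \<Psi>_def by blast+
  have \<Psi>I: "Y \<in> \<Psi>" if "Y \<in> T" "\<And>M g. M \<in> W \<Longrightarrow> lin Y M g \<Longrightarrow> restr M (g ` carrier Y) \<in> W"
    "\<And>M g. M \<in> W \<Longrightarrow> lin Y M g \<Longrightarrow> restr Y (a_kernel Y M g) \<in> T" for Y
    using that unfolding \<Psi>_def by blast
  have \<Psi>T: "\<Psi> \<subseteq> T" unfolding \<Psi>_def by blast
  have W\<Psi>: "W \<subseteq> \<Psi>"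
  proof
    fix Y assume Y: "Y \<in> W"
    show "Y \<in> \<Psi>"
      by (rule \<Psi>I) (use Y WT wide_image[OF W Y] wide_kernel[OF W Y] in blast)+
  qed
  have "\<Psi> \<in> tors A"
  proof (rule torsI[of _ M0])
    show "\<Psi> \<subseteq> mods" using \<Psi>T tors_mods[OF T] by blast
    show "M0 \<in> \<Psi>" using M0 W\<Psi> by blast
  next
    fix Y Y' p assume *: "Y \<in> \<Psi>" "Y' \<in> mods" "lin Y Y' p" "p ` carrier Y = carrier Y'"
    have YT: "Y \<in> T" using * \<Psi>T by blast
    have Ym: "Y \<in> mods" by (rule tors_mods[OF T YT])
    show "Y' \<in> \<Psi>"
    proof (rule \<Psi>I)
      show "Y' \<in> T" by (rule tors_quotient[OF T YT *(2-4)])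
    next
      fix M g assume M: "M \<in> W" and g: "lin Y' M g"
      have "(\<lambda>x. g (p x)) ` carrier Y = g ` carrier Y'" unfolding *(4)[symmetric] by (rule image_image[symmetric])
      then show "restr M (g ` carrier Y') \<in> W" using \<Psi>D(1)[OF *(1) M linear_comp[OF *(3) g]] by simp
    next
      fix M g assume M: "M \<in> W" and g: "lin Y' M g"
      let ?k = "a_kernel Y M (\<lambda>x. g (p x))"
      have im: "p ` ?k = a_kernel Y' M g"
      proof
        show "a_kernel Y' M g \<subseteq> p ` ?k"
        proof
          fix y assume y: "y \<in> a_kernel Y' M g"
          then have "y \<in> p ` carrier Y" using *(4) by simp
          then show "y \<in> p ` ?k" using y by auto
        qed
      qed (use linear_closed[OF *(3)] in auto)
      have "?k \<subseteq> carrier Y" by auto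
      from lin_into[OF lin_restr[OF *(3) this], of "a_kernel Y' M g"]
      have "lin (restr Y ?k) (restr Y' (a_kernel Y' M g)) p" using im by simp
      from tors_quotient[OF T \<Psi>D(2)[OF *(1) M linear_comp[OF *(3) g]] restr_mods[OF *(2) sub_kernel[OF *(2) Wm[OF M] g]] this]
      show "restr Y' (a_kernel Y' M g) \<in> T" using im by simp
    qed
  next
    fix Y L f assume *: "Y \<in> mods" "L \<in> \<Psi>" "lin Y L f" "f ` carrier Y = carrier L"
      "restr Y (a_kernel Y L f) \<in> \<Psi>"
    have LT: "L \<in> T" and UT: "restr Y (a_kernel Y L f) \<in> T" using *(2,5) \<Psi>T by blast+
    have Lm: "L \<in> mods" by (rule tors_mods[OF T LT])
    let ?U = "a_kernel Y L f"
    have U: "sub Y ?U" by (rule sub_kernel[OF *(1) Lm *(3)])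
    have "restr M (g ` carrier Y) \<in> W \<and> restr Y (a_kernel Y M g) \<in> T" if M: "M \<in> W" and g: "lin Y M g" for M g
    proof -
      note Mm = Wm[OF M]
      \<comment> \<open>\<open>g\<close> induces a map \<open>h\<close> from \<open>L\<close> to
        \<open>M / ?I\<close>. The image of \<open>g\<close> is an extension of the image of
        \<open>h\<close> by \<open>?I\<close>, and the kernel of \<open>g\<close> is an extension of
        the kernel of \<open>h\<close> by the kernel of \<open>g\<close> on
        \<open>?U\<close>.\<close>
      let ?I = "g ` ?U"
      have gU: "lin (restr Y ?U) M g" by (rule lin_restr[OF g subm_subset[OF U]])
      have IW: "restr M ?I \<in> W" using \<Psi>D(1)[OF *(5) M gU] by simp
      have I: "sub M ?I" by (rule sub_image[OF *(1) Mm g U])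
      have QW: "quo M ?I \<in> W" using wide_cokernel[OF W IW M lin_incl[OF subm_subset[OF I]]] by simp
      note Qm = Wm[OF QW] and pr = lin_prj[OF Mm I] and pr0 = prj_eq_zero[OF Mm I]
      have "prj M ?I (g y) = \<zero>\<^bsub>quo M ?I\<^esub>" if "y \<in> carrier Y" "f y = \<zero>\<^bsub>L\<^esub>" for y
        using pr0[OF linear_closed[OF g that(1)]] that by auto
      then obtain h where h: "lin L (quo M ?I) h" "\<forall>y\<in>carrier Y. h (f y) = prj M ?I (g y)"
        using lin_factor[OF *(1) Lm Qm *(3,4) linear_comp[OF g pr]] by blast
      let ?J = "g ` carrier Y"
      have J: "sub M ?J" by (rule sub_range[OF *(1) Mm g])
      have IJ: "?I \<subseteq> ?J" using subm_subset[OF U] by blast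
      have "prj M ?I ` ?J = h ` carrier L"
        unfolding *(4)[symmetric] image_image by (rule image_cong[OF refl]) (use h(2) in simp)
      then have "restr M ?J \<in> W"
        using ext_image[OF wide_ext[OF W] restr_mods[OF Mm J] lin_restr[OF pr subm_subset[OF J]]]
          a_kernel_prj_restr[OF Mm I IJ subm_subset[OF J]] IW \<Psi>D(1)[OF *(2) QW h(1)] by simp
      moreover have "restr Y (a_kernel Y M g) \<in> T"
      proof (rule ext_image[OF tors_ext[OF T] restr_mods[OF *(1) sub_kernel[OF *(1) Mm g]]])
        show "lin (restr Y (a_kernel Y M g)) L f" by (rule lin_restr[OF *(3)]) auto
        have "a_kernel (restr Y (a_kernel Y M g)) L f = a_kernel (restr Y ?U) M g" by auto
        then show "restr (restr Y (a_kernel Y M g)) (a_kernel (restr Y (a_kernel Y M g)) L f) \<in> T"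
          using \<Psi>D(2)[OF *(5) M gU] by simp
        have "f ` a_kernel Y M g = a_kernel L (quo M ?I) h"
        proof
          show "f ` a_kernel Y M g \<subseteq> a_kernel L (quo M ?I) h"
          proof
            fix z assume "z \<in> f ` a_kernel Y M g"
            then obtain y where y: "y \<in> carrier Y" "g y = \<zero>\<^bsub>M\<^esub>" "z = f y" by auto
            have "h z = prj M ?I (g y)" using bspec[OF h(2) y(1)] y(3) by simp
            then have "h z = \<zero>\<^bsub>quo M ?I\<^esub>" using y(2) lin_zero[OF Mm Qm pr] by simp
            then show "z \<in> a_kernel L (quo M ?I) h" using y linear_closed[OF *(3) y(1)] by simp
          qed
          show "a_kernel L (quo M ?I) h \<subseteq> f ` a_kernel Y M g"
          proof
            fix z assume "z \<in> a_kernel L (quo M ?I) h"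
            then have z: "z \<in> carrier L" "h z = \<zero>\<^bsub>quo M ?I\<^esub>" by simp_all
            then have "z \<in> f ` carrier Y" using *(4) by simp
            then obtain y where y: "y \<in> carrier Y" "z = f y" by blast
            note gy = linear_closed[OF g y(1)]
            have "prj M ?I (g y) = \<zero>\<^bsub>quo M ?I\<^esub>" using bspec[OF h(2) y(1)] y(2) z(2) by simp
            then have "g y \<in> ?I" using pr0[OF gy] by simp
            then obtain v where v: "v \<in> carrier Y" "f v = \<zero>\<^bsub>L\<^esub>" "g y = g v" by auto
            \<comment> \<open>\<open>y\<close> is changed by an element of \<open>?U\<close> with
              the same image under \<open>g\<close>, which leaves \<open>f y\<close>
              unchanged.\<close>
            have "g (y \<ominus>\<^bsub>Y\<^esub> v) = \<zero>\<^bsub>M\<^esub>"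
              using lin_minus[OF *(1) Mm g y(1) v(1)] v(3) linear_closed[OF g v(1)] Mm by simp
            moreover have "f (y \<ominus>\<^bsub>Y\<^esub> v) = z"
            proof -
              have "f (y \<ominus>\<^bsub>Y\<^esub> v) = z \<ominus>\<^bsub>L\<^esub> \<zero>\<^bsub>L\<^esub>"
                using lin_minus[OF *(1) Lm *(3) y(1) v(1)] v(2) y(2) by simp
              then show ?thesis using mods_diff_add[OF Lm z(1) mods_zero[OF Lm]] z(1) Lm by simp
            qed
            moreover have "y \<ominus>\<^bsub>Y\<^esub> v \<in> carrier Y" using *(1) y(1) v(1) by simp
            ultimately show "z \<in> f ` a_kernel Y M g" by (intro image_eqI[where x = "y \<ominus>\<^bsub>Y\<^esub> v"]) simp_all
          qed
        qed
        then show "restr L (f ` carrier (restr Y (a_kernel Y M g))) \<in> T"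
          using \<Psi>D(2)[OF *(2) QW h(1)] by simp
      qed
      ultimately show ?thesis ..
    qed
    then show "Y \<in> \<Psi>" by (intro \<Psi>I ext_surj[OF tors_ext[OF T] *(1) LT *(3,4) UT]) blast+
  qed
  then have T\<Psi>: "T \<subseteq> \<Psi>" by (rule least[OF _ W\<Psi>])
  have "W \<subseteq> alpha A T"
  proof
    fix M assume M: "M \<in> W"
    show "M \<in> alpha A T" by (rule alphaI[OF T]) (use M WT \<Psi>D(2) T\<Psi> in blast)+
  qed
  moreover have "alpha A T \<subseteq> W"
  proof
    fix M assume M: "M \<in> alpha A T"
    have MT: "M \<in> T" using M alpha_subset by blast
    have Mm: "M \<in> mods" by (rule tors_mods[OF T MT])
    have "restr M {\<zero>\<^bsub>M\<^esub>} \<in> W" by (rule wide_zero[OF W restr_mods[OF Mm sub_zero[OF Mm]]]) simp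
    from sub_maximal[where P = "\<lambda>U. restr M U \<in> W", OF Mm sub_zero[OF Mm] this]
    obtain I where I: "sub M I" "restr M I \<in> W"
      and max: "\<forall>V. sub M V \<longrightarrow> restr M V \<in> W \<longrightarrow> I \<subseteq> V \<longrightarrow> V = I" by (elim exE conjE)
    have "restr M I \<in> T" using I(2) WT by blast
    then have Q: "quo M I \<in> alpha A T" by (rule alpha_quotient[OF T M I(1)])
    then have QT: "quo M I \<in> T" using alpha_subset by blast
    note Qm = quo_mods[OF Mm I(1)] and pr = lin_prj[OF Mm I(1)] prj_surj[OF Mm I(1)]
      and pr0 = prj_eq_zero[OF Mm I(1)]
    have "V \<in> left_perp (quo M I)" if V: "V \<in> W" for V
    proof (rule left_perpI[OF Wm[OF V]])
      fix k y assume k: "lin V (quo M I) k" and y: "y \<in> carrier V"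
      note Vm = Wm[OF V]
      let ?k = "a_kernel V (quo M I) k" and ?J = "k ` carrier V"
      have ks: "sub V ?k" by (rule sub_kernel[OF Vm Qm k])
      \<comment> \<open>The kernel of \<open>k\<close> is in \<open>T\<close> because
        \<open>quo M I\<close> is in \<open>alpha A T\<close>. As the image of an object of
        \<open>\<Psi>\<close> in \<open>V\<close>, it is even in \<open>W\<close>. So the image of
        \<open>k\<close> is in \<open>W\<close>, and its preimage in \<open>M\<close> is a submodule
        in \<open>W\<close> above \<open>I\<close>, hence equal to \<open>I\<close>.\<close>
      have "restr V ?k \<in> T" using alpha_kernel_tors[OF T Q _ k] V WT by blast
      then have "restr V ?k \<in> \<Psi>" using T\<Psi> by blast
      from \<Psi>D(1)[OF this V lin_incl[OF subm_subset[OF ks]]] have kW: "restr V ?k \<in> W" by simp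
      have "quo V ?k \<in> W" using wide_cokernel[OF W kW V lin_incl[OF subm_subset[OF ks]]] by simp
      then have JW: "restr (quo M I) ?J \<in> W" using quo_mem_iff[OF wide_sub[OF W] Vm Qm k] by simp
      have J: "sub (quo M I) ?J" by (rule sub_range[OF Vm Qm k])
      define I' where "I' = {x \<in> carrier M. prj M I x \<in> ?J}"
      note I' = prj_vimage[OF Mm I(1) J, folded I'_def]
      have "restr M I' \<in> W" by (rule I'(4)[OF wide_ext[OF W] I(2) JW])
      then have "I' = I" using max I'(1,2) by blast
      have "k y \<in> prj M I ` I'" unfolding I'(3) using y by blast
      then obtain x where x: "x \<in> I" "k y = prj M I x" unfolding \<open>I' = I\<close> by blast
      then show "k y = \<zero>\<^bsub>quo M I\<^esub>" using pr0[OF subm_mem[OF I(1) x(1)]] by simp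
    qed
    then have "T \<subseteq> left_perp (quo M I)" by (intro least left_perp_tors[OF Qm] subsetI)
    then have Qperp: "quo M I \<in> left_perp (quo M I)" using QT by blast
    have "carrier M \<subseteq> I"
    proof
      fix x assume x: "x \<in> carrier M"
      have "prj M I x = \<zero>\<^bsub>quo M I\<^esub>" by (rule left_perpD[OF Qperp lin_id linear_closed[OF pr(1) x]])
      then show "x \<in> I" using pr0[OF x] by simp
    qed
    then have "I = carrier M" using subm_subset[OF I(1)] by blast
    then show "M \<in> W" using I(2) by simp
  qed
  ultimately show ?thesis using T by blast
qed

section \<open>Functorial finiteness of wide subcategories\<close>

text \<open>An approximation \<open>D\<close> in \<open>T\<close> is followed by the projection to
  the largest quotient of \<open>D\<close> in \<open>alpha A T\<close>. Dividing \<open>D\<close> by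
  the kernel of a map to an object of \<open>alpha A T\<close> gives a quotient of this kind by
  \<open>alpha_image\<close>.\<close>

lemma alpha_left_approx:
  assumes T: "T \<in> tors A" and P: "universal T P p" and M: "M \<in> mods"
  shows "\<exists>D \<phi>. left_approx (alpha A T) M D \<phi>"
proof -
  note W = alpha_wide[OF T]
  obtain D \<phi> where D: "left_approx T M D \<phi>" using universal_left_approx[OF T P M] by blast
  note DT = left_approxD(1)[OF D] and \<phi> = left_approxD(2)[OF D]
  have Dm: "D \<in> mods" by (rule tors_mods[OF T DT])
  let ?ker = "\<lambda>N. \<exists>C\<in>alpha A T. \<exists>g. lin D C g \<and> a_kernel D C g = N"
  note zm = restr_mods[OF M sub_zero[OF M]]
  have "restr M {\<zero>\<^bsub>M\<^esub>} \<in> alpha A T" by (rule wide_zero[OF W zm]) simp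
  then have "?ker (carrier D)"
    using lin_const_zero[OF zm, of D] by (intro bexI[of _ "restr M {\<zero>\<^bsub>M\<^esub>}"] exI[of _ "\<lambda>_. \<zero>\<^bsub>M\<^esub>"]) auto
  from sub_minimal[where P = ?ker, OF Dm sub_carrier[OF Dm] this]
  obtain N where N0: "sub D N \<and> ?ker N \<and> (\<forall>V. sub D V \<longrightarrow> ?ker V \<longrightarrow> V \<subseteq> N \<longrightarrow> V = N)" by (rule exE)
  note N = conjunct1[OF N0] and min = conjunct2[OF conjunct2[OF N0]]
  obtain C g where C: "C \<in> alpha A T" and g: "lin D C g" "a_kernel D C g = N"
    using conjunct1[OF conjunct2[OF N0]] by blast
  have Cm: "C \<in> mods" by (rule wide_mods[OF W C])
  have QW: "quo D N \<in> alpha A T"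
    using quo_mem_iff[OF wide_sub[OF W] Dm Cm g(1)] alpha_image[OF T C DT g(1)] g(2) by simp
  note Qm = quo_mods[OF Dm N] and pr = lin_prj[OF Dm N] prj_surj[OF Dm N] and pr0 = prj_eq_zero[OF Dm N]
  have "\<exists>h. lin (quo D N) Y h \<and> (\<forall>x\<in>carrier M. h (prj D N (\<phi> x)) = f x)"
    if Y: "Y \<in> alpha A T" and f: "lin M Y f" for Y f
  proof -
    have YT: "Y \<in> T" using Y alpha_subset by blast
    have Ym: "Y \<in> mods" by (rule tors_mods[OF T YT])
    obtain h where h: "lin D Y h" "\<forall>x\<in>carrier M. h (\<phi> x) = f x"
      using left_approxD(3)[OF D YT f] by blast
    note CY = Cm Ym
    \<comment> \<open>The kernel of the pairing is the intersection of the kernels of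
      \<open>g\<close> and \<open>h\<close>. Minimality of \<open>N\<close> makes it equal to
      \<open>N\<close>, so \<open>h\<close> vanishes on \<open>N\<close>.\<close>
    let ?k = "\<lambda>x. pair C Y (g x) (h x)"
    have k: "lin D (bip C Y) ?k" by (rule lin_pair[OF CY Dm g(1) h(1)])
    note K = sub_kernel[OF Dm bip_mods[OF CY] k]
    have kz: "g x = \<zero>\<^bsub>C\<^esub> \<and> h x = \<zero>\<^bsub>Y\<^esub>" if x: "x \<in> a_kernel D (bip C Y) ?k" for x
    proof -
      have xD: "x \<in> carrier D" and kx: "?k x = \<zero>\<^bsub>bip C Y\<^esub>" using x by simp_all
      note c = linear_closed[OF g(1) xD] linear_closed[OF h(1) xD]
      have "fst_bip C Y (?k x) = \<zero>\<^bsub>C\<^esub>" unfolding kx by (rule lin_zero[OF bip_mods[OF CY] Cm lin_fst[OF CY]])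
      moreover have "snd_bip C Y (?k x) = \<zero>\<^bsub>Y\<^esub>" unfolding kx by (rule lin_zero[OF bip_mods[OF CY] Ym lin_snd[OF CY]])
      ultimately show ?thesis unfolding fst_pair[OF CY c] snd_pair[OF CY c] by (rule conjI)
    qed
    have "?ker (a_kernel D (bip C Y) ?k)" using bip_mem[OF wide_ext[OF W] C Y] k by blast
    moreover have "a_kernel D (bip C Y) ?k \<subseteq> N"
    proof
      fix x assume x: "x \<in> a_kernel D (bip C Y) ?k"
      then have "x \<in> carrier D" by simp
      then show "x \<in> N" unfolding g(2)[symmetric] using kz[OF x] by simp
    qed
    ultimately have eq: "a_kernel D (bip C Y) ?k = N" by (rule min[rule_format, OF K])
    have "h x = \<zero>\<^bsub>Y\<^esub>" if "x \<in> carrier D" "prj D N x = \<zero>\<^bsub>quo D N\<^esub>" for x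
      using kz[of x] pr0[OF that(1)] that(2) eq by blast
    then obtain h' where h': "lin (quo D N) Y h'" "\<forall>x\<in>carrier D. h' (prj D N x) = h x"
      using lin_factor[OF Dm Qm Ym pr h(1)] by blast
    have "h' (prj D N (\<phi> x)) = f x" if "x \<in> carrier M" for x
      using bspec[OF h'(2) linear_closed[OF \<phi> that]] bspec[OF h(2) that] by simp
    then show ?thesis using h'(1) by blast
  qed
  then have "left_approx (alpha A T) M (quo D N) (\<lambda>x. prj D N (\<phi> x))"
    unfolding left_approx_def using QW linear_comp[OF \<phi> pr(1)] by blast
  then show ?thesis by blast
qed

text \<open>Among the maps \<open>d : D \<rightarrow> M\<close> from objects of \<open>W\<close> whose kernel contains no nonzero object of \<open>W\<close>, one
  with the largest image of \<open>Hom(Q, D)\<close> in \<open>Hom(Q, M)\<close> is a right approximation.\<close>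

lemma wide_right_approx:
  assumes W: "W \<in> wide A" and Q: "universal W Q q" and M: "M \<in> mods"
  shows "\<exists>D \<psi>. right_approx W M D \<psi>"
proof -
  note Wm = wide_mods[OF W]
  have QW: "Q \<in> W" by (rule universalD(1)[OF Q])
  have Qm: "Q \<in> mods" by (rule Wm[OF QW])
  define adm where "adm D d \<longleftrightarrow> D \<in> W \<and> lin D M d \<and>
      (\<forall>V. sub D V \<longrightarrow> restr D V \<in> W \<longrightarrow> V \<subseteq> a_kernel D M d \<longrightarrow> V = {\<zero>\<^bsub>D\<^esub>})" for D d
  define I where "I D d = {f. lin Q M f \<and> (\<exists>g. lin Q D g \<and> (\<forall>x\<in>carrier Q. f x = d (g x)))}"
    for D :: "('a, 'a list) module" and d
  define \<T> where "\<T> = {I D d | D d. adm D d}"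
  obtain n where n: "chain_bound {H. hom_subspace Q M H} n"
    using hom_subspace_chain_bound[OF Qm M] by blast
  have \<T>D: "\<exists>D d. H = I D d \<and> adm D d" if "H \<in> \<T>" for H
    using that unfolding \<T>_def by (rule CollectD)
  have \<T>I: "I D d \<in> \<T>" if "adm D d" for D d unfolding \<T>_def using that by blast
  have "\<T> \<subseteq> {H. hom_subspace Q M H}"
  proof
    fix H assume "H \<in> \<T>"
    from \<T>D[OF this] obtain D d where "H = I D d" and "adm D d" by (elim exE conjE)
    moreover from this(2) have "D \<in> W" "lin D M d" unfolding adm_def by blast+
    ultimately show "H \<in> {H. hom_subspace Q M H}"
      using hom_subspaceI[OF Qm M Wm, of D d] by (simp add: I_def)
  qed
  note zm = restr_mods[OF M sub_zero[OF M]]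
  have "restr M {\<zero>\<^bsub>M\<^esub>} \<in> W" by (rule wide_zero[OF W zm]) simp
  moreover have "V = {\<zero>\<^bsub>M\<^esub>}" if "sub (restr M {\<zero>\<^bsub>M\<^esub>}) V" for V
    using subm_subset[OF that] subm_zero[OF that] by auto
  moreover have "lin (restr M {\<zero>\<^bsub>M\<^esub>}) M (\<lambda>x. x)" by (rule lin_incl) (use M in simp)
  ultimately have "adm (restr M {\<zero>\<^bsub>M\<^esub>}) (\<lambda>x. x)" unfolding adm_def restr_simps by blast
  from chain_bound_maximal[OF n \<open>\<T> \<subseteq> _\<close> \<T>I[OF this]]
  obtain H where H: "H \<in> \<T>" "\<forall>H'\<in>\<T>. H \<subseteq> H' \<longrightarrow> H' = H" by (rule bexE)
  from \<T>D[OF H(1)] obtain D d where HI: "H = I D d" and adm: "adm D d" by (elim exE conjE)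
  have DW: "D \<in> W" and d: "lin D M d" and adm0: "\<And>V. sub D V \<Longrightarrow> restr D V \<in> W \<Longrightarrow> V \<subseteq> a_kernel D M d \<Longrightarrow> V = {\<zero>\<^bsub>D\<^esub>}"
    using adm unfolding adm_def by blast+
  have Dm: "D \<in> mods" by (rule Wm[OF DW])
  have "\<exists>h. lin Y D h \<and> (\<forall>y\<in>carrier Y. d (h y) = f y)" if Y: "Y \<in> W" and f: "lin Y M f" for Y f
  proof -
    have Ym: "Y \<in> mods" by (rule Wm[OF Y])
    note DY = Dm Ym
    \<comment> \<open>Both \<open>d\<close> and \<open>f\<close> factor through \<open>e\<close>,
      which need not be admissible. Dividing \<open>E\<close> by a maximal submodule
      \<open>N\<close> in \<open>W\<close> below the kernel of \<open>e\<close> repairs this: a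
      nonzero submodule of \<open>D2\<close> violating admissibility would pull back to one larger
      than \<open>N\<close>.\<close>
    define E where "E = bip D Y"
    define e where "e z = d (fst_bip D Y z) \<oplus>\<^bsub>M\<^esub> f (snd_bip D Y z)" for z
    have EW: "E \<in> W" unfolding E_def by (rule bip_mem[OF wide_ext[OF W] DW Y])
    have Em: "E \<in> mods" by (rule Wm[OF EW])
    have e: "lin E M e" unfolding E_def e_def by (rule lin_copair[OF DY M d f])
    let ?good = "\<lambda>U. restr E U \<in> W \<and> U \<subseteq> a_kernel E M e"
    have "restr E {\<zero>\<^bsub>E\<^esub>} \<in> W" by (rule wide_zero[OF W restr_mods[OF Em sub_zero[OF Em]]]) simp
    then have "?good {\<zero>\<^bsub>E\<^esub>}" using lin_zero[OF Em M e] Em by simp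
    from sub_maximal[where P = ?good, OF Em sub_zero[OF Em] this]
    obtain N where N0: "sub E N \<and> ?good N \<and> (\<forall>V. sub E V \<longrightarrow> ?good V \<longrightarrow> N \<subseteq> V \<longrightarrow> V = N)" by (rule exE)
    note N = conjunct1[OF N0] and Ng = conjunct1[OF conjunct2[OF N0]] and max = conjunct2[OF conjunct2[OF N0]]
    define D2 where "D2 = quo E N"
    define pr where "pr = prj E N"
    have D2m: "D2 \<in> mods" and pr: "lin E D2 pr" "pr ` carrier E = carrier D2"
      and pr0: "\<And>x. x \<in> carrier E \<Longrightarrow> pr x = \<zero>\<^bsub>D2\<^esub> \<longleftrightarrow> x \<in> N"
      unfolding D2_def pr_def using quo_mods[OF Em N] lin_prj[OF Em N] prj_surj[OF Em N] prj_eq_zero[OF Em N]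
      by blast+
    have D2W: "D2 \<in> W"
      using wide_cokernel[OF W conjunct1[OF Ng] EW lin_incl[OF subm_subset[OF N]]] by (simp add: D2_def)
    have "e x = \<zero>\<^bsub>M\<^esub>" if "x \<in> carrier E" "pr x = \<zero>\<^bsub>D2\<^esub>" for x
      using pr0[OF that(1)] that(2) conjunct2[OF Ng] by auto
    then obtain d2 where d2: "lin D2 M d2" "\<forall>x\<in>carrier E. d2 (pr x) = e x"
      using lin_factor[OF Em D2m M pr e] by blast
    have adm2: "V = {\<zero>\<^bsub>D2\<^esub>}" if V: "sub D2 V" "restr D2 V \<in> W" "V \<subseteq> a_kernel D2 M d2" for V
    proof -
      define J where "J = {x \<in> carrier E. pr x \<in> V}"
      note J = prj_vimage[OF Em N V(1)[unfolded D2_def], folded D2_def pr_def, folded J_def]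
      have "restr E J \<in> W" by (rule J(4)[OF wide_ext[OF W] conjunct1[OF Ng] V(2)])
      moreover have "J \<subseteq> a_kernel E M e"
      proof
        fix x assume "x \<in> J"
        then have x: "x \<in> carrier E" "pr x \<in> V" by (simp_all add: J_def)
        then have "d2 (pr x) = \<zero>\<^bsub>M\<^esub>" using V(3) by auto
        then show "x \<in> a_kernel E M e" using bspec[OF d2(2) x(1)] x(1) by simp
      qed
      ultimately have "J = N" using max[rule_format, OF J(1) _ J(2)] by blast
      have "V \<subseteq> {\<zero>\<^bsub>D2\<^esub>}"
      proof
        fix y assume "y \<in> V"
        then obtain x where x: "x \<in> N" "y = pr x" unfolding J(3)[symmetric] \<open>J = N\<close> by blast
        then show "y \<in> {\<zero>\<^bsub>D2\<^esub>}" using pr0[OF subm_mem[OF N x(1)]] by simp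
      qed
      then show "V = {\<zero>\<^bsub>D2\<^esub>}" using subm_zero[OF V(1)] by blast
    qed
    have "adm D2 d2" unfolding adm_def using D2W d2(1) adm2 by blast
    then have "I D2 d2 \<in> \<T>" by (rule \<T>I)
    \<comment> \<open>\<open>d\<close> equals \<open>d2 \<circ> j\<close>, so maximality of
      \<open>I D d\<close> makes the two spaces of factoring maps equal. This forces
      \<open>j\<close> to be an isomorphism, and its inverse carries the factorization of
      \<open>f\<close> from \<open>D2\<close> back to \<open>D\<close>.\<close>
    define j where "j x = pr (pair D Y x \<zero>\<^bsub>Y\<^esub>)" for x
    have inl: "lin D E (\<lambda>x. pair D Y x \<zero>\<^bsub>Y\<^esub>)" unfolding E_def by (rule lin_inl[OF DY])
    have inr: "lin Y E (\<lambda>y. pair D Y \<zero>\<^bsub>D\<^esub> y)" unfolding E_def by (rule lin_inr[OF DY])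
    have j: "lin D D2 j" unfolding j_def by (rule linear_comp[OF inl pr(1)])
    have d2j: "d2 (j x) = d x" if x: "x \<in> carrier D" for x
    proof -
      have "d2 (j x) = e (pair D Y x \<zero>\<^bsub>Y\<^esub>)" using bspec[OF d2(2) linear_closed[OF inl x]] by (simp add: j_def)
      also have "\<dots> = d x"
        using x linear_closed[OF d x] M Ym
        by (simp add: e_def fst_pair[OF DY] snd_pair[OF DY] lin_zero[OF Ym M f])
      finally show ?thesis .
    qed
    have "I D d \<subseteq> I D2 d2"
    proof
      fix k assume "k \<in> I D d"
      then obtain g where k: "lin Q M k" and g: "lin Q D g" "\<forall>x\<in>carrier Q. k x = d (g x)"
        unfolding I_def by blast
      have "\<forall>x\<in>carrier Q. k x = d2 (j (g x))"
        using g(2) d2j[OF linear_closed[OF g(1)]] by simp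
      then show "k \<in> I D2 d2"
        unfolding I_def using k linear_comp[OF g(1) j] by (intro CollectI conjI exI[of _ "\<lambda>x. j (g x)"]) simp_all
    qed
    then have I_eq: "I D2 d2 = I D d" using H(2) HI \<open>I D2 d2 \<in> \<T>\<close> by simp
    have j_surj: "j ` carrier D = carrier D2"
    proof
      show "j ` carrier D \<subseteq> carrier D2" using linear_closed[OF j] by blast
      show "carrier D2 \<subseteq> j ` carrier D"
      proof
        fix y assume y: "y \<in> carrier D2"
        obtain k where k: "lin Q D2 k" "k q = y" using universalD(3)[OF Q D2W y] by blast
        have "(\<lambda>x. d2 (k x)) \<in> I D2 d2"
          unfolding I_def using linear_comp[OF k(1) d2(1)] k(1) by (intro CollectI conjI exI[of _ k]) simp_all
        then have "(\<lambda>x. d2 (k x)) \<in> I D d" using I_eq by simp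
        then obtain g where g: "lin Q D g" "\<forall>x\<in>carrier Q. d2 (k x) = d (g x)" unfolding I_def by blast
        \<comment> \<open>The image of this map is in \<open>W\<close> and is killed by
          \<open>d2\<close>, so it is zero by admissibility of \<open>d2\<close>. Evaluation at
          \<open>q\<close> gives the preimage \<open>g q\<close> of \<open>y\<close>.\<close>
        let ?r = "\<lambda>x. k x \<ominus>\<^bsub>D2\<^esub> j (g x)"
        have r: "lin Q D2 ?r" by (rule lin_diff[OF Qm D2m k(1) linear_comp[OF g(1) j]])
        have "?r ` carrier Q \<subseteq> a_kernel D2 M d2"
        proof
          fix z assume "z \<in> ?r ` carrier Q"
          then obtain x where x: "x \<in> carrier Q" "z = ?r x" by blast
          note c = linear_closed[OF k(1) x(1)] linear_closed[OF g(1) x(1)]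
          note c' = linear_closed[OF j c(2)]
          have "d2 z = d2 (k x) \<ominus>\<^bsub>M\<^esub> d2 (j (g x))" unfolding x(2) by (rule lin_minus[OF D2m M d2(1) c(1) c'])
          also have "d2 (k x) = d2 (j (g x))" using bspec[OF g(2) x(1)] d2j[OF c(2)] by simp
          finally have "d2 z = \<zero>\<^bsub>M\<^esub>" using linear_closed[OF d2(1) c'] M by simp
          then show "z \<in> a_kernel D2 M d2" using linear_closed[OF r x(1)] x(2) by simp
        qed
        from adm2[OF sub_range[OF Qm D2m r] wide_image[OF W QW D2W r] this]
        have "?r q = \<zero>\<^bsub>D2\<^esub>" using universalD(2)[OF Q] by blast
        note c = universalD(2)[OF Q]
        have "y = j (g q)"
          using \<open>?r q = \<zero>\<^bsub>D2\<^esub>\<close> mods_diff_eq_zero[OF D2m linear_closed[OF k(1) c]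
            linear_closed[OF j linear_closed[OF g(1) c]]] k(2) by simp
        then show "y \<in> j ` carrier D" using linear_closed[OF g(1) c] by blast
      qed
    qed
    have jk: "sub D (a_kernel D D2 j)" by (rule sub_kernel[OF Dm D2m j])
    have "a_kernel D D2 j \<subseteq> a_kernel D M d"
    proof
      fix x assume "x \<in> a_kernel D D2 j"
      then have x: "x \<in> carrier D" "j x = \<zero>\<^bsub>D2\<^esub>" by simp_all
      then show "x \<in> a_kernel D M d" using d2j[OF x(1)] lin_zero[OF D2m M d2(1)] by simp
    qed
    \<comment> \<open>The kernel of \<open>j\<close> is an object of \<open>W\<close> killed by
      \<open>d\<close>, so admissibility of \<open>d\<close> applies.\<close>
    then have jker: "a_kernel D D2 j = {\<zero>\<^bsub>D\<^esub>}" by (rule adm0[OF jk wide_kernel[OF W DW D2W j]])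
    have j0: "x = \<zero>\<^bsub>D\<^esub>" if "x \<in> carrier D" "j x = \<zero>\<^bsub>D2\<^esub>" for x
    proof -
      have "x \<in> a_kernel D D2 j" using that by simp
      then show ?thesis unfolding jker by simp
    qed
    obtain i where i: "lin D2 D i" "\<forall>x\<in>carrier D. i (j x) = x"
      using lin_factor[OF Dm D2m Dm j j_surj lin_id j0] by blast
    have di: "d (i y) = d2 y" if y: "y \<in> carrier D2" for y
    proof -
      have "y \<in> j ` carrier D" using y j_surj by simp
      then obtain x where x: "x \<in> carrier D" "y = j x" by blast
      then show ?thesis using bspec[OF i(2) x(1)] d2j[OF x(1)] by simp
    qed
    let ?h = "\<lambda>y. i (pr (pair D Y \<zero>\<^bsub>D\<^esub> y))"
    have "d (?h y) = f y" if y: "y \<in> carrier Y" for y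
    proof -
      note c = linear_closed[OF inr y]
      have "d (?h y) = d2 (pr (pair D Y \<zero>\<^bsub>D\<^esub> y))" by (rule di[OF linear_closed[OF pr(1) c]])
      also have "\<dots> = e (pair D Y \<zero>\<^bsub>D\<^esub> y)" by (rule bspec[OF d2(2) c])
      also have "\<dots> = f y"
        using y linear_closed[OF f y] M Dm
        by (simp add: e_def fst_pair[OF DY] snd_pair[OF DY] lin_zero[OF Dm M d])
      finally show ?thesis .
    qed
    then show ?thesis using linear_comp[OF linear_comp[OF inr pr(1)] i(1)] by blast
  qed
  then have "right_approx W M D d" using DW d unfolding right_approx_def by blast
  then show ?thesis by blast
qed

text \<open>The left approximations supply the universal element on which the construction of right
  approximations rests.\<close>

lemma alpha_functorially_finite:
  assumes T: "T \<in> tors A" and P: "universal T P p"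
  shows "functorially_finite A (alpha A T)"
proof -
  note W = alpha_wide[OF T]
  have Wm: "alpha A T \<subseteq> mods" using wide_mods[OF W] by blast
  note left = alpha_left_approx[OF T P]
  obtain Q q where "universal (alpha A T) Q q" using left_approx_universal[OF Wm left] by blast
  then show ?thesis by (intro functorially_finiteI[OF Wm left] wide_right_approx[OF W])
qed

theorem alpha_bijection:
  assumes fin: "finite {T \<in> tors A. functorially_finite A T}"
  shows "bij_betw (alpha A) (tors A) (wide A) \<and>
    (\<forall>T\<in>tors A. functorially_finite A T) \<and> (\<forall>W\<in>wide A. functorially_finite A W)"
proof (intro conjI ballI)
  have univ: "\<exists>P p. universal T P p" if "T \<in> tors A" for T
    by (rule all_tors_universal[OF fin that])
  show "functorially_finite A T" if "T \<in> tors A" for T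
    using functorially_finite_iff[OF that] univ[OF that] by blast
  show "functorially_finite A W" if W: "W \<in> wide A" for W
  proof -
    obtain T where T: "T \<in> tors A" "alpha A T = W" using alpha_surj[OF W] by blast
    obtain P p where "universal T P p" using univ[OF T(1)] by blast
    from alpha_functorially_finite[OF T(1) this] show ?thesis using T(2) by simp
  qed
  have le: "T1 \<subseteq> T2" if T: "T1 \<in> tors A" "T2 \<in> tors A" "alpha A T1 = alpha A T2" for T1 T2
  proof -
    obtain P p where "universal T1 P p" using univ[OF T(1)] by blast
    then show ?thesis
      by (rule alpha_subset_imp_subset[OF T(1) _ T(2)]) (use T(3) alpha_subset in simp)
  qed
  have "inj_on (alpha A) (tors A)"
  proof (rule inj_onI)
    fix T1 T2 assume T: "T1 \<in> tors A" "T2 \<in> tors A" "alpha A T1 = alpha A T2"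
    show "T1 = T2" by (rule equalityI[OF le[OF T] le[OF T(2,1) T(3)[symmetric]]])
  qed
  moreover have "alpha A ` tors A = wide A"
    using alpha_wide alpha_surj by (intro equalityI subsetI) blast+
  ultimately show "bij_betw (alpha A) (tors A) (wide A)" by (simp add: bij_betw_def)
qed

end

section \<open>Finite dimensional algebras over a field\<close>

text \<open>Multiplication by \<open>k \<odot> \<one>\<close> is the action of the scalar
  \<open>k\<close>, so these elements are central, and the subspaces of \<open>reg A\<close> over
  them are the \<open>K\<close>-subspaces of \<open>A\<close>.\<close>

lemma (in fin_dim_algebra) scalar_algebra_scalars:
  "scalar_algebra A ((\<lambda>k. k \<odot>\<^bsub>A\<^esub> \<one>\<^bsub>A\<^esub>) ` carrier K)"
proof -
  let ?Z = "(\<lambda>k. k \<odot>\<^bsub>A\<^esub> \<one>\<^bsub>A\<^esub>) ` carrier K"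
  have mult: "(k \<odot>\<^bsub>A\<^esub> \<one>\<^bsub>A\<^esub>) \<otimes>\<^bsub>A\<^esub> x = k \<odot>\<^bsub>A\<^esub> x" if "k \<in> carrier K" "x \<in> carrier A" for k x
    using that smult_mult_left[of k "\<one>\<^bsub>A\<^esub>" x] by simp
  have mult': "x \<otimes>\<^bsub>A\<^esub> (k \<odot>\<^bsub>A\<^esub> \<one>\<^bsub>A\<^esub>) = k \<odot>\<^bsub>A\<^esub> x" if "k \<in> carrier K" "x \<in> carrier A" for k x
    using that smult_mult_right[of k x "\<one>\<^bsub>A\<^esub>"] by simp
  have L: "left_module K A"
    by (intro left_module.intro left_module_axioms.intro K.ring_axioms A.is_abelian_group)
       (simp_all add: smult_l_distr smult_r_distr smult_assoc1)
  obtain F where F: "finite F" "F \<subseteq> carrier A"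
    "\<And>U. subm (carrier K) A U \<Longrightarrow> F \<subseteq> U \<Longrightarrow> U = carrier A"
    using finite_dimension left_module.fin_gen_iff[OF L] by blast
  show ?thesis
  proof (intro scalar_algebra.intro scalar_algebra_axioms.intro A.ring_axioms)
    show "?Z \<subseteq> carrier A" by auto
    show "\<one>\<^bsub>A\<^esub> \<in> ?Z"
      by (rule image_eqI[where x = "\<one>\<^bsub>K\<^esub>"]) simp_all
  next
    fix z assume "z \<in> ?Z"
    then obtain k where k: "k \<in> carrier K" "z = k \<odot>\<^bsub>A\<^esub> \<one>\<^bsub>A\<^esub>" by blast
    then show "\<ominus>\<^bsub>A\<^esub> z \<in> ?Z"
      by (intro image_eqI[where x = "\<ominus>\<^bsub>K\<^esub> k"]) (simp_all add: smult_l_minus)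
  next
    fix z w assume "z \<in> ?Z" "w \<in> ?Z"
    then obtain k l where k: "k \<in> carrier K" "z = k \<odot>\<^bsub>A\<^esub> \<one>\<^bsub>A\<^esub>" and l: "l \<in> carrier K" "w = l \<odot>\<^bsub>A\<^esub> \<one>\<^bsub>A\<^esub>"
      by blast
    then show "z \<oplus>\<^bsub>A\<^esub> w \<in> ?Z"
      by (intro image_eqI[where x = "k \<oplus>\<^bsub>K\<^esub> l"]) (simp_all add: smult_l_distr)
    from k l show "z \<otimes>\<^bsub>A\<^esub> w \<in> ?Z"
      by (intro image_eqI[where x = "k \<otimes>\<^bsub>K\<^esub> l"]) (simp_all add: mult smult_assoc1)
  next
    fix z assume "z \<in> ?Z" and nz: "z \<noteq> \<zero>\<^bsub>A\<^esub>"
    then obtain k where k: "k \<in> carrier K" "z = k \<odot>\<^bsub>A\<^esub> \<one>\<^bsub>A\<^esub>" by blast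
    have "k \<noteq> \<zero>\<^bsub>K\<^esub>" using k nz by auto
    then have inv: "inv\<^bsub>K\<^esub> k \<in> carrier K" "inv\<^bsub>K\<^esub> k \<otimes>\<^bsub>K\<^esub> k = \<one>\<^bsub>K\<^esub>"
      using k(1) K.field_Units by auto
    have "(inv\<^bsub>K\<^esub> k \<odot>\<^bsub>A\<^esub> \<one>\<^bsub>A\<^esub>) \<otimes>\<^bsub>A\<^esub> z = \<one>\<^bsub>A\<^esub>"
      using k inv by (simp add: mult smult_assoc1[symmetric])
    then show "\<exists>w\<in>?Z. w \<otimes>\<^bsub>A\<^esub> z = \<one>\<^bsub>A\<^esub>" using inv(1) by blast
  next
    fix z a assume "z \<in> ?Z" "a \<in> carrier A"
    then show "z \<otimes>\<^bsub>A\<^esub> a = a \<otimes>\<^bsub>A\<^esub> z" by (auto simp: mult mult')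
  next
    have "U = carrier A" if U: "subm ?Z (reg A) U" "F \<subseteq> U" for U
    proof (rule F(3)[OF _ U(2)])
      show "subm (carrier K) A U"
      proof (rule submI)
        fix k x assume k: "k \<in> carrier K" and x: "x \<in> U"
        have "(k \<odot>\<^bsub>A\<^esub> \<one>\<^bsub>A\<^esub>) \<odot>\<^bsub>reg A\<^esub> x \<in> U" by (rule subm_smult[OF U(1)]) (use k x in auto)
        moreover have "x \<in> carrier A" using subm_mem[OF U(1) x] by simp
        ultimately show "k \<odot>\<^bsub>A\<^esub> x \<in> U" using k by (simp add: mult)
      qed (use U(1) in \<open>auto simp: subm_def\<close>)
    qed
    then show "\<exists>F. finite F \<and> F \<subseteq> carrier A \<and> (\<forall>U. subm ?Z (reg A) U \<and> F \<subseteq> U \<longrightarrow> U = carrier A)"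
      using F(1,2) by blast
  qed
qed

theorem corollary3p11:
  fixes K :: "'k ring" and A :: "('k, 'a) module"
  assumes "algebraically_closed K"
    and "fin_dim_algebra K A"
    and "finite {T \<in> tors A. functorially_finite A T}"
  shows "bij_betw (alpha A) (tors A) (wide A) \<and>
    (\<forall>T\<in>tors A. functorially_finite A T) \<and> (\<forall>W\<in>wide A. functorially_finite A W)"
  using scalar_algebra.alpha_bijection[OF fin_dim_algebra.scalar_algebra_scalars[OF assms(2)] assms(3)] .

end
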